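(* Let $n\ge2$ and let $a,b$ satisfy $0<a\le1$, $0<b\le\frac12$, $2a\ge1+b$. Set $$s:=\frac14+\frac{n-1}{2(n+1)}\big(n-(n-1)a-b\big),$$ and, for $k\ge k_0$, $R_k=2^k$, $D_k=R_k^{(n-(n-1)a+nb)/(n+1)}$, $Q_k=R_k^{\frac{n-1}{n+1}(2a-b-1)}$. Define $$g_{a,b}=\sum_{k\ge k_0}R_k^{-s}\,\frac{k}{\|f^{(k)}\|_{L^2}}\,f^{(k)},$$ where $f^{(k)}$ is the function $f_D$ (defined in the context) with $R=R_k$ and $D=D_k$. Let $F$ be the $(a,b)$-set of divergence (with slab constant $c$). Then, provided $k_0$ is sufficiently large and $0<c_1\ll c\ll1$, with $c_0:=\frac{1}{10}c_1$, there is a set $\Omega\subset\mathbb{R}^n$ with $\mathcal{H}^\gamma(\Omega)=0$ for every $\gamma>n-2s$ such that $$\limsup_{t\to0^+}\big|e^{it\hbar\Delta/2}g_{a,b}(x)\big|=\infty\qquad\text{for every } x\in\big(F\cap([c_0,c_1]\times[0,c_1]^{n-1})\big)\setminus\Omega.$$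
   Context: $\hbar=1/(2\pi)$; $\hat f(\xi)=\int f(x)e^{-2\pi ix\cdot\xi}dx$. For $f\in H^{\sigma}(\mathbb{R}^n)$ the solution is defined pointwise by $e^{it\hbar\Delta/2}f(x)=\lim_{N\to\infty}\int_{Q(N)}\hat f(\xi)e^{i(-\pi t|\xi|^2+2\pi x\cdot\xi)}d\xi$ at each $x$ where this limit exists, $Q(N)$ being the cube of side $N$ centered at $0$. Fix a smooth positive $\varphi$ on $\mathbb{R}$ with $\operatorname{supp}\hat\varphi\subset(-1,1)$ and $\varphi(0)=1$, and for $R,D>0$ let $f_D(x)=e^{2\pi i Rx_1}\varphi(R^{1/2}x_1)\prod_{j=2}^n\varphi(x_j)\big(\sum_{l_j\in\mathbb{Z},\ R/(2D)<l_j<R/D}e^{2\pi iDl_jx_j}\big)$. A point $(p_1/q,\dots,p_n/q)$, $p_j,q\in\mathbb{Z}$, is an admissible fraction if $\gcd(p_1,q)=1$ and: $p_2,\dots,p_n$ arbitrary when $q$ is odd; $p_2,\dots,p_n$ all even when $q\equiv0\pmod4$; $p_2,\dots,p_n$ all odd when $q\equiv2\pmod4$. For $0<c\ll1$ and $k\ge k_0$, let $\mathcal{A}_k$ be the collection of closed axis-parallel boxes ("slabs") of dimensions $cR_k^{-1/2}\times cR_k^{-1}\times\cdots\times cR_k^{-1}$ (the long side in the $x_1$ direction) centered at $\big(2p_1R_k/(qD_k^2),\,p_2/(D_kq),\dots,p_n/(D_kq)\big)$, where $(p_1/q,\dots,p_n/q)$ is an admissible fraction with $1\le q\le Q_k$.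 Let $F_k=\bigcup_{s\in\mathcal{A}_k}s$ and $F=\limsup_{k\to\infty}F_k=\bigcap_{N}\bigcup_{k\ge N}F_k$; this is the $(a,b)$-set of divergence. $\mathcal{H}^\gamma$ is the $\gamma$-dimensional Hausdorff measure. *)

theory Defs
  imports "HOL-Analysis.Analysis"
begin

text \<open>Points of R^n are represented as pairs (x1, x') with x' in R^(n-1) = real^'m,
  so that n = CARD('m) + 1 >= 2.  The product metric/inner product is Euclidean.\<close>

text \<open>gamma-dimensional Hausdorff measure (up to normalisation constant).\<close>
definition hausdorff_measure :: "real \<Rightarrow> 'a::metric_space set \<Rightarrow> ennreal" where
  "hausdorff_measure \<gamma> A =
     (SUP \<delta>\<in>{0<..}. INF U\<in>{U::nat \<Rightarrow> 'a set. A \<subseteq> (\<Union>i. U i) \<and>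
          (\<forall>i. bounded (U i) \<and> diameter (U i) \<le> \<delta>)}.
        (\<Sum>i. ennreal (diameter (U i) powr \<gamma>)))"

definition FT :: "('a::euclidean_space \<Rightarrow> complex) \<Rightarrow> 'a \<Rightarrow> complex" where
  "FT f \<xi> = (\<integral>x. f x * cis (- 2 * pi * (x \<bullet> \<xi>)) \<partial>lborel)"

definition L2norm :: "('a::euclidean_space \<Rightarrow> complex) \<Rightarrow> real" where
  "L2norm f = sqrt (\<integral>x. (cmod (f x))\<^sup>2 \<partial>lborel)"

definition fD :: "(real \<Rightarrow> real) \<Rightarrow> real \<Rightarrow> real \<Rightarrow> real \<times> (real^'m::finite) \<Rightarrow> complex" where
  "fD \<phi> R D x =
     cis (2 * pi * R * fst x) * complex_of_real (\<phi> (sqrt R * fst x)) *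
     (\<Prod>j\<in>UNIV. complex_of_real (\<phi> (snd x $ j)) *
        (\<Sum>l\<in>{l::int. R / (2 * D) < of_int l \<and> of_int l < R / D}.
            cis (2 * pi * D * of_int l * (snd x $ j))))"

definition s_exp :: "real \<Rightarrow> real \<Rightarrow> real \<Rightarrow> real" where
  "s_exp n a b = 1/4 + (n - 1) / (2 * (n + 1)) * (n - (n - 1) * a - b)"

definition Rk :: "nat \<Rightarrow> real" where "Rk k = 2 ^ k"

definition Dk :: "real \<Rightarrow> real \<Rightarrow> real \<Rightarrow> nat \<Rightarrow> real" where
  "Dk n a b k = Rk k powr ((n - (n - 1) * a + n * b) / (n + 1))"

definition Qk :: "real \<Rightarrow> real \<Rightarrow> real \<Rightarrow> nat \<Rightarrow> real" where
  "Qk n a b k = Rk k powr ((n - 1) / (n + 1) * (2 * a - b - 1))"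

definition fk :: "(real \<Rightarrow> real) \<Rightarrow> real \<Rightarrow> real \<Rightarrow> nat \<Rightarrow> real \<times> (real^'m::finite) \<Rightarrow> complex" where
  "fk \<phi> a b k = fD \<phi> (Rk k) (Dk (real CARD('m) + 1) a b k)"

text \<open>Fourier transform of g_{a,b} = sum_{k>=k0} R_k^{-s} k/||f^(k)|| f^(k),
  computed termwise (the f^(k) hat have pairwise disjoint supports).\<close>
definition ghat :: "(real \<Rightarrow> real) \<Rightarrow> real \<Rightarrow> real \<Rightarrow> nat \<Rightarrow> real \<times> (real^'m::finite) \<Rightarrow> complex" where
  "ghat \<phi> a b k0 \<xi> =
     (\<Sum>k. if k0 \<le> k then
        complex_of_real (Rk k powr (- s_exp (real CARD('m) + 1) a b) * real k
            / L2norm (fk \<phi> a b k :: real \<times> (real^'m) \<Rightarrow> complex))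
        * FT (fk \<phi> a b k) \<xi>
      else 0)"

definition cubeQ :: "real \<Rightarrow> (real \<times> (real^'m::finite)) set" where
  "cubeQ N = {\<xi>. \<bar>fst \<xi>\<bar> \<le> N / 2 \<and> (\<forall>j. \<bar>snd \<xi> $ j\<bar> \<le> N / 2)}"

text \<open>schro_conv h t x L : the limit defining e^{it hbar Delta/2} f(x) (with hat f = h)
  exists and equals L.\<close>
definition schro_conv :: "(real \<times> (real^'m::finite) \<Rightarrow> complex) \<Rightarrow> real \<Rightarrow> real \<times> (real^'m) \<Rightarrow> complex \<Rightarrow> bool" where
  "schro_conv h t x L \<longleftrightarrow>
     ((\<lambda>N. LINT \<xi>:cubeQ N|lborel. h \<xi> * cis (- pi * t * (norm \<xi>)\<^sup>2 + 2 * pi * (x \<bullet> \<xi>)))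
        \<longlongrightarrow> L) at_top"

definition admissible :: "int \<Rightarrow> ('m \<Rightarrow> int) \<Rightarrow> int \<Rightarrow> bool" where
  "admissible p1 p q \<longleftrightarrow> gcd p1 q = 1 \<and>
     (odd q \<or> (q mod 4 = 0 \<and> (\<forall>j. even (p j))) \<or> (q mod 4 = 2 \<and> (\<forall>j. odd (p j))))"

definition Fset :: "real \<Rightarrow> real \<Rightarrow> real \<Rightarrow> real \<Rightarrow> (real \<times> (real^'m::finite)) set" where
  "Fset c R D Q = {x. \<exists>p1 (p::'m \<Rightarrow> int) q. admissible p1 p q \<and> 1 \<le> q \<and> of_int q \<le> Q \<and>
      \<bar>fst x - 2 * of_int p1 * R / (of_int q * D\<^sup>2)\<bar> \<le> c * R powr (- 1/2) / 2 \<and>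
      (\<forall>j. \<bar>snd x $ j - of_int (p j) / (D * of_int q)\<bar> \<le> c * R powr (- 1) / 2)}"

definition divset :: "real \<Rightarrow> real \<Rightarrow> real \<Rightarrow> nat \<Rightarrow> (real \<times> (real^'m::finite)) set" where
  "divset c a b k0 = (\<Inter>N. \<Union>k\<in>{max N k0..}.
      Fset c (Rk k) (Dk (real CARD('m) + 1) a b k) (Qk (real CARD('m) + 1) a b k))"

definition region :: "real \<Rightarrow> real \<Rightarrow> (real \<times> (real^'m::finite)) set" where
  "region c0 c1 = {x. c0 \<le> fst x \<and> fst x \<le> c1 \<and> (\<forall>j. 0 \<le> snd x $ j \<and> snd x $ j \<le> c1)}"

end

theory Submission
  imports Defs "HOL-Probability.Probability" "HOL-Number_Theory.Cong" "HOL-Real_Asymp.Real_Asymp"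
begin

text \<open>
  Write the solution as the superposition of the packets evolving from the \<open>f\<^sup>(\<^sup>k\<^sup>)\<close>.
  At a time \<open>t > 0\<close> the packets with \<open>D\<^sub>k \<ge> t\<^sup>-\<^sup>2\<close> have dispersed so much that their sum converges
  absolutely at every point, also after truncation to cubes; hence the limit that defines the
  solution always exists and no exceptional set is needed (\<open>\<Omega> = {}\<close>).

  If \<open>x\<close> lies in a slab of \<open>F\<^sub>k\<close> with the fraction \<open>p/q\<close>, then a Gauss sum computation shows that the
  \<open>k\<close>-th packet has size at least a constant times \<open>k\<close> at \<open>x\<close> and the time \<open>t = 2p\<^sub>1/(qD\<^sub>k\<^sup>2)\<close>. The other
  packets may be large there as well, since \<open>\<phi>\<close> is only known to be integrable. However, the
  \<open>k\<close>-th packet oscillates in time with frequencies in a band of size \<open>R\<^sub>k\<^sup>2\<close> that is separated from the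
  bands of all other packets. Averaging the solution over \<open>{t/2..3t/2}\<close> against a kernel of
  \<open>L\<^sup>1\<close>-norm \<open>O(\<surd>k)\<close> therefore isolates the \<open>k\<close>-th packet up to a bounded error, and a solution that is
  bounded as \<open>t \<rightarrow> 0\<close> would give \<open>k = O(\<surd>k)\<close> for infinitely many \<open>k\<close>.
\<close>

section \<open>Gaussians and Fourier inversion\<close>

text \<open>The dispersion is square-root cancellation: once t D_k is large, each lattice sum of N_k
  bumps has size O(sqrt(N_k)) instead of N_k at every point, and then the packet is O(k
  R_k^(1/4-s)), which is summable because s > 1/4. In a slab the same sums are Gauss sums of size
  about N_k/sqrt(q). The exponents of D_k, Q_k and s make all powers of R_k cancel at q = Q_k, so
  that the weight k survives. The obstacle is the range in between: for t of order 1/R_k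
  cancellation is only ensured from an index k1 of order 3k/\<beta> on, where D_k = R_k^\<beta>, and
  below it there are only bounds of size roughly 2^(m k1). The filter has to beat these. A Gaussian
  in frequency of width l suppresses bands at distance R_k^2 by exp(-const (R_k^2/l)^2), so l =
  R_k^2/sqrt(C k) gains any exponential in k, and the kernel has L1 norm of order bandwidth over l;
  hence the sqrt(k). The time window is wide enough since l t is of order R_k/sqrt(k).\<close>

lemma borel_measurable_cis[measurable]:
  "f \<in> borel_measurable M \<Longrightarrow> (\<lambda>x. cis (f x)) \<in> borel_measurable M"
  unfolding cis_conv_exp by measurable

lemma lborel_pair_integrable_times:
  fixes f :: "'a::euclidean_space \<Rightarrow> complex" and g :: "'b::euclidean_space \<Rightarrow> complex"
  assumes f: "integrable lborel f" and g: "integrable lborel g"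
  shows "integrable (lborel \<Otimes>\<^sub>M lborel) (\<lambda>(x, y). f x * g y)"
proof -
  have [measurable]: "f \<in> borel_measurable borel" "g \<in> borel_measurable borel"
    using assms by (simp_all add: borel_measurable_integrable)
  show ?thesis
    by (rule lborel_pair.Fubini_integrable) (use assms in \<open>auto simp: norm_mult\<close>)
qed

text \<open>All Gaussian integrals below, with or without a phase, are rescalings of the
  characteristic function of the standard normal distribution.\<close>

lemma
  fixes l y :: real
  assumes "0 < l"
  shows gaussian_fourier_integrable: "integrable lborel (\<lambda>s. complex_of_real (exp (- (l * s)\<^sup>2 / 2)) * cis (y * s))"
    and gaussian_fourier_integral: "(LBINT s. complex_of_real (exp (- (l * s)\<^sup>2 / 2)) * cis (y * s))
      = complex_of_real (sqrt (2 * pi) / l * exp (- (y / l)\<^sup>2 / 2))"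
proof -
  have int1: "integrable lborel (\<lambda>s. std_normal_density s *\<^sub>R cis (z * s))" for z
    by (rule Bochner_Integration.integrable_bound[OF integrable_normal_density[of 1 0]]) auto
  have eq1: "(LBINT s. std_normal_density s *\<^sub>R cis (z * s)) = complex_of_real (exp (- z\<^sup>2 / 2))" for z
  proof -
    have "char std_normal_distribution z = (LBINT s. std_normal_density s *\<^sub>R cis (z * s))"
      unfolding char_def by (subst integral_density) (auto simp: cis_conv_exp)
    thus ?thesis using char_std_normal_distribution by (metis)
  qed
  have e: "complex_of_real (exp (- (l * s)\<^sup>2 / 2)) * cis (y * s) =
     complex_of_real (sqrt (2 * pi)) * (std_normal_density (0 + l * s) *\<^sub>R cis (y / l * (0 + l * s)))" for s
    using assms by (simp add: std_normal_density_def scaleR_conv_of_real field_simps)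
  have int2: "integrable lborel (\<lambda>s. std_normal_density (0 + l * s) *\<^sub>R cis (y / l * (0 + l * s)))"
    using lborel_integrable_real_affine[OF int1[of "y / l"], of l 0] assms by simp
  show "integrable lborel (\<lambda>s. complex_of_real (exp (- (l * s)\<^sup>2 / 2)) * cis (y * s))"
    unfolding e by (rule integrable_mult_right) (rule int2)
  have "complex_of_real (exp (- (y / l)\<^sup>2 / 2)) = \<bar>l\<bar> *\<^sub>R (LBINT s. std_normal_density (0 + l * s) *\<^sub>R cis (y / l * (0 + l * s)))"
    unfolding eq1[symmetric] using assms by (intro lborel_integral_real_affine) auto
  hence "(LBINT s. std_normal_density (0 + l * s) *\<^sub>R cis (y / l * (0 + l * s))) = complex_of_real (exp (- (y / l)\<^sup>2 / 2)) / l"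
    using assms by (simp add: scaleR_conv_of_real)
  thus "(LBINT s. complex_of_real (exp (- (l * s)\<^sup>2 / 2)) * cis (y * s))
      = complex_of_real (sqrt (2 * pi) / l * exp (- (y / l)\<^sup>2 / 2))"
    unfolding e integral_mult_right_zero by simp
qed

lemma gaussian_integral:
  fixes l :: real
  assumes "0 < l"
  shows gaussian_integrable: "integrable lborel (\<lambda>s. exp (- (l * s)\<^sup>2 / 2))"
    and gaussian_integral_eq: "(LBINT s. exp (- (l * s)\<^sup>2 / 2)) = sqrt (2 * pi) / l"
proof -
  have i: "integrable lborel (\<lambda>s. complex_of_real (exp (- (l * s)\<^sup>2 / 2)))"
    using gaussian_fourier_integrable[OF assms, of 0] by simp
  thus "integrable lborel (\<lambda>s. exp (- (l * s)\<^sup>2 / 2))"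
    by (simp only: complex_of_real_integrable_eq)
  have "complex_of_real (LBINT s. exp (- (l * s)\<^sup>2 / 2)) = complex_of_real (sqrt (2 * pi) / l)"
    using gaussian_fourier_integral[OF assms, of 0] by (simp add: integral_complex_of_real[symmetric] del: integral_complex_of_real)
  thus "(LBINT s. exp (- (l * s)\<^sup>2 / 2)) = sqrt (2 * pi) / l"
    using of_real_eq_iff by blast
qed

lemma FT_measurable[measurable]:
  fixes f :: "real \<Rightarrow> complex"
  assumes [measurable]: "f \<in> borel_measurable borel"
  shows "FT f \<in> borel_measurable borel"
proof -
  have "(\<lambda>\<xi>. LBINT x. f x * cis (- 2 * pi * (x \<bullet> \<xi>))) \<in> borel_measurable borel"
    unfolding cis_conv_exp by measurable
  thus ?thesis unfolding FT_def[abs_def] .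
qed

lemma cmod_FT_le: "cmod (FT f \<xi>) \<le> (LBINT x. cmod (f x))"
proof -
  have "cmod (FT f \<xi>) \<le> (LBINT x. cmod (f x * cis (- 2 * pi * (x \<bullet> \<xi>))))"
    unfolding FT_def by (rule integral_norm_bound)
  thus ?thesis by (simp add: norm_mult)
qed

lemma bounded_compact_support_integrable:
  fixes f :: "real \<Rightarrow> complex"
  assumes [measurable]: "f \<in> borel_measurable borel"
    and "\<And>x. cmod (f x) \<le> B" and "\<And>x. x \<notin> {-1<..<1} \<Longrightarrow> f x = 0"
  shows "integrable lborel f"
proof (rule Bochner_Integration.integrable_bound)
  show "integrable lborel (\<lambda>x::real. B * indicator {-1<..<1} x)" by simp
  have "norm (f x) \<le> norm (B * indicator {-1<..<1} x :: real)" for x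
    using assms(2)[of x] assms(3)[of x] norm_ge_zero[of "f x"] by (cases "x \<in> {-1<..<1}") (auto simp: abs_if)
  thus "AE x in lborel. norm (f x) \<le> norm (B * indicator {-1<..<1} x :: real)" by simp
qed simp

text \<open>The Gaussian factor makes the double integral absolutely convergent, so Fubini applies
  before anything is known about the integrability of \<open>FT f\<close>. The right-hand side
  averages f around x at scale e/(2 pi); letting e tend to 0 leads to inversion.\<close>

lemma FT_gaussian_regularization:
  fixes f :: "real \<Rightarrow> complex"
  assumes f: "integrable lborel f" and e: "0 < e"
  shows "(LBINT \<xi>. FT f \<xi> * cis (2 * pi * x * \<xi>) * complex_of_real (exp (- (e * \<xi>)\<^sup>2 / 2)))
    = (LBINT z. f (x + e / (2 * pi) * z) * complex_of_real (exp (- z\<^sup>2 / 2))) / complex_of_real (sqrt (2 * pi))" (is "?L = ?R")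
proof -
  let ?k = "\<lambda>\<xi> y. f y * (complex_of_real (exp (- (e * \<xi>)\<^sup>2 / 2)) * cis (2 * pi * (x - y) * \<xi>))"
  have [measurable]: "f \<in> borel_measurable borel" using f by (simp add: borel_measurable_integrable)
  have [measurable]: "(\<lambda>(\<xi>, y). ?k \<xi> y) \<in> borel_measurable (lborel \<Otimes>\<^sub>M lborel)"
    unfolding cis_conv_exp by measurable
  have int: "integrable (lborel \<Otimes>\<^sub>M lborel) (\<lambda>(\<xi>, y). ?k \<xi> y)"
  proof (rule Bochner_Integration.integrable_bound)
    show "integrable (lborel \<Otimes>\<^sub>M lborel) (\<lambda>(\<xi>::real, y). complex_of_real (exp (- (e * \<xi>)\<^sup>2 / 2)) * f y)"
      using gaussian_integrable[OF e] by (intro lborel_pair_integrable_times) (simp_all only: complex_of_real_integrable_eq f)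
  qed (auto simp: norm_mult)
  have "?L = (LBINT \<xi>. LBINT y. ?k \<xi> y)"
  proof (rule Bochner_Integration.integral_cong[OF refl])
    fix \<xi> :: real
    have "FT f \<xi> * cis (2 * pi * x * \<xi>) * complex_of_real (exp (- (e * \<xi>)\<^sup>2 / 2)) = (LBINT y. f y * cis (- 2 * pi * (y \<bullet> \<xi>)) * (cis (2 * pi * x * \<xi>) * complex_of_real (exp (- (e * \<xi>)\<^sup>2 / 2))))"
      by (simp add: FT_def)
    also have "\<dots> = (LBINT y. ?k \<xi> y)"
    proof (rule Bochner_Integration.integral_cong[OF refl])
      fix y :: real
      have "cis (- 2 * pi * (y \<bullet> \<xi>)) * cis (2 * pi * x * \<xi>) = cis (2 * pi * (x - y) * \<xi>)"
        by (simp add: cis_mult algebra_simps)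
      thus "f y * cis (- 2 * pi * (y \<bullet> \<xi>)) * (cis (2 * pi * x * \<xi>) * complex_of_real (exp (- (e * \<xi>)\<^sup>2 / 2))) = ?k \<xi> y"
        by (drule_tac sym) (simp only: mult_ac)
    qed
    finally show "FT f \<xi> * cis (2 * pi * x * \<xi>) * complex_of_real (exp (- (e * \<xi>)\<^sup>2 / 2)) = (LBINT y. ?k \<xi> y)" .
  qed
  also have "\<dots> = (LBINT y. LBINT \<xi>. ?k \<xi> y)"
    using lborel_pair.Fubini_integral[OF int] by simp
  also have "\<dots> = (LBINT y. f y * complex_of_real (sqrt (2 * pi) / e * exp (- (2 * pi * (x - y) / e)\<^sup>2 / 2)))"
    by (simp only: gaussian_fourier_integral[OF e] integral_mult_right_zero)
  also have "\<dots> = \<bar>e / (2 * pi)\<bar> *\<^sub>R (LBINT z. f (x + e / (2 * pi) * z) * complex_of_real (sqrt (2 * pi) / e * exp (- (2 * pi * (x - (x + e / (2 * pi) * z)) / e)\<^sup>2 / 2)))"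
    using e by (intro lborel_integral_real_affine) auto
  also have "\<dots> = (e / (2 * pi)) *\<^sub>R (LBINT z. (f (x + e / (2 * pi) * z) * complex_of_real (exp (- z\<^sup>2 / 2))) * complex_of_real (sqrt (2 * pi) / e))"
    using e by (intro arg_cong2[where f = scaleR] Bochner_Integration.integral_cong) (auto simp: field_simps)
  also have "\<dots> = ((e / (2 * pi)) * (sqrt (2 * pi) / e)) *\<^sub>R (LBINT z. f (x + e / (2 * pi) * z) * complex_of_real (exp (- z\<^sup>2 / 2)))"
    by (simp add: scaleR_conv_of_real)
  also have "(e / (2 * pi)) * (sqrt (2 * pi) / e) = 1 / sqrt (2 * pi)"
    using e sqrt_divide_self_eq[of "2 * pi"] by (simp add: inverse_eq_divide)
  finally show ?thesis by (simp only: scaleR_conv_of_real of_real_divide of_real_1 times_divide_eq_left mult_1_left)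
qed

text \<open>A Fatou argument bounds \<open>\<phi>\<close>, which then allows dominated convergence.\<close>
lemma FT_inversion_nonneg:
  fixes \<phi> :: "real \<Rightarrow> real"
  assumes cont: "\<And>x. isCont \<phi> x" and nonneg: "\<And>x. 0 \<le> \<phi> x" and int: "integrable lborel \<phi>"
    and FTint: "integrable lborel (FT (\<lambda>x. complex_of_real (\<phi> x)))"
  shows "\<phi> x \<le> (LBINT \<xi>. cmod (FT (\<lambda>x. complex_of_real (\<phi> x)) \<xi>))"
    and "(LBINT \<xi>. FT (\<lambda>x. complex_of_real (\<phi> x)) \<xi> * cis (2 * pi * x * \<xi>)) = complex_of_real (\<phi> x)"
proof -
  define \<psi> where "\<psi> = FT (\<lambda>x. complex_of_real (\<phi> x))"
  have [measurable]: "\<phi> \<in> borel_measurable borel" using int by (simp add: borel_measurable_integrable)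
  have [measurable]: "\<psi> \<in> borel_measurable borel" unfolding \<psi>_def by measurable
  have \<psi>i: "integrable lborel \<psi>" using FTint \<psi>_def by simp
  define g where "g z = exp (- z\<^sup>2 / 2)" for z :: real
  have gm[measurable]: "g \<in> borel_measurable borel" unfolding g_def by measurable
  have gi: "integrable lborel g" and ge: "(LBINT z. g z) = sqrt (2 * pi)"
    using gaussian_integral[of 1] by (simp_all add: g_def[abs_def])
  define e where "e n = 1 / real (Suc n)" for n
  have e0: "e \<longlonglongrightarrow> 0" unfolding e_def using LIMSEQ_inverse_real_of_nat by (simp add: inverse_eq_divide)
  have epos: "e n > 0" for n by (simp add: e_def)
  define L where "L n x = (LBINT \<xi>. \<psi> \<xi> * cis (2 * pi * x * \<xi>) * complex_of_real (exp (- (e n * \<xi>)\<^sup>2 / 2)))" for n x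
  have L: "L n x = complex_of_real (LBINT z. \<phi> (x + e n / (2 * pi) * z) * g z) / complex_of_real (sqrt (2 * pi))" for n x
  proof -
    have "L n x = (LBINT z. complex_of_real (\<phi> (x + e n / (2 * pi) * z)) * complex_of_real (exp (- z\<^sup>2 / 2))) / complex_of_real (sqrt (2 * pi))"
      unfolding L_def \<psi>_def
      by (rule FT_gaussian_regularization) (simp_all only: epos complex_of_real_integrable_eq int)
    also have "(\<lambda>z. complex_of_real (\<phi> (x + e n / (2 * pi) * z)) * complex_of_real (exp (- z\<^sup>2 / 2))) = (\<lambda>z. complex_of_real (\<phi> (x + e n / (2 * pi) * z) * g z))"
      by (simp add: g_def fun_eq_iff)
    finally show ?thesis by (simp only: integral_complex_of_real)
  qed
  have lim1: "(\<lambda>n. L n x) \<longlonglongrightarrow> (LBINT \<xi>. \<psi> \<xi> * cis (2 * pi * x * \<xi>))" for x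
    unfolding L_def
  proof (rule integral_dominated_convergence[where w = "\<lambda>\<xi>. cmod (\<psi> \<xi>)"])
    show "AE \<xi> in lborel. (\<lambda>n. \<psi> \<xi> * cis (2 * pi * x * \<xi>) * complex_of_real (exp (- (e n * \<xi>)\<^sup>2 / 2))) \<longlonglongrightarrow> \<psi> \<xi> * cis (2 * pi * x * \<xi>)"
    proof (rule AE_I2)
      fix \<xi> :: real
      have "(\<lambda>n. \<psi> \<xi> * cis (2 * pi * x * \<xi>) * complex_of_real (exp (- (e n * \<xi>)\<^sup>2 / 2))) \<longlonglongrightarrow> \<psi> \<xi> * cis (2 * pi * x * \<xi>) * complex_of_real (exp (- (0 * \<xi>)\<^sup>2 / 2))"
        by (intro tendsto_intros e0) auto
      thus "(\<lambda>n. \<psi> \<xi> * cis (2 * pi * x * \<xi>) * complex_of_real (exp (- (e n * \<xi>)\<^sup>2 / 2))) \<longlonglongrightarrow> \<psi> \<xi> * cis (2 * pi * x * \<xi>)" by simp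
    qed
  qed (use \<psi>i in \<open>auto simp: norm_mult mult_left_le cis_conv_exp\<close>)
  have Lb: "cmod (L n x) \<le> (LBINT \<xi>. cmod (\<psi> \<xi>))" for n x
  proof -
    have "cmod (L n x) \<le> (LBINT \<xi>. cmod (\<psi> \<xi> * cis (2 * pi * x * \<xi>) * complex_of_real (exp (- (e n * \<xi>)\<^sup>2 / 2))))"
      unfolding L_def by (rule integral_norm_bound)
    also have "\<dots> \<le> (LBINT \<xi>. cmod (\<psi> \<xi>))"
      using \<psi>i by (intro integral_mono' ) (auto simp: norm_mult mult_left_le)
    finally show ?thesis .
  qed
  have conv: "(\<lambda>n. \<phi> (x + e n / (2 * pi) * z) * g z) \<longlonglongrightarrow> \<phi> x * g z" for x z
  proof -
    have "(\<lambda>n. x + e n / (2 * pi) * z) \<longlonglongrightarrow> x + 0 / (2 * pi) * z" by (intro tendsto_intros e0) auto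
    hence "(\<lambda>n. \<phi> (x + e n / (2 * pi) * z)) \<longlonglongrightarrow> \<phi> x" using isCont_tendsto_compose[OF cont] by auto
    thus ?thesis by (intro tendsto_intros)
  qed
  show bound: "\<phi> x \<le> (LBINT \<xi>. cmod (FT (\<lambda>x. complex_of_real (\<phi> x)) \<xi>))" for x
  proof -
    define P where "P = (LBINT \<xi>. cmod (\<psi> \<xi>))"
    have "0 \<le> P" unfolding P_def by simp
    define S where "S n z = \<phi> (x + e n / (2 * pi) * z) * g z" for n z
    have Sm[measurable]: "S n \<in> borel_measurable borel" for n unfolding S_def by measurable
    have S0: "S n z \<ge> 0" for n z by (simp add: S_def nonneg g_def)
    \<comment> \<open>Nonnegativity turns the bound on the modulus of \<open>L n x\<close> into one
      on the integral of \<open>S n\<close>, uniform in \<open>n\<close>; this is what Fatou's lemma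
      passes to the limit.\<close>
    have Sint: "(\<integral>\<^sup>+z. ennreal (S n z) \<partial>lborel) \<le> ennreal (P * sqrt (2 * pi))" for n
    proof -
      have "integrable lborel (\<lambda>z. \<phi> (x + e n / (2 * pi) * z))"
        using lborel_integrable_real_affine[OF int, of "e n / (2 * pi)" x] epos[of n] by simp
      hence "integrable lborel (S n)"
        by (rule Bochner_Integration.integrable_bound) (auto simp: S_def g_def nonneg mult_left_le)
      hence "(\<integral>\<^sup>+z. ennreal (S n z) \<partial>lborel) = ennreal (LBINT z. S n z)"
        by (intro nn_integral_eq_integral) (auto simp: S0)
      also have "(LBINT z. S n z) \<le> P * sqrt (2 * pi)"
        using Lb[of n x] S0[of n] unfolding L P_def[symmetric] S_def[symmetric]
        by (simp add: norm_divide field_simps abs_if split: if_splits)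
      finally show ?thesis by (simp add: ennreal_leI)
    qed
    have "(\<integral>\<^sup>+z. liminf (\<lambda>n. ennreal (S n z)) \<partial>lborel) \<le> liminf (\<lambda>n. (\<integral>\<^sup>+z. ennreal (S n z) \<partial>lborel))"
      by (intro nn_integral_liminf) auto
    also have "\<dots> \<le> liminf (\<lambda>n. ennreal (P * sqrt (2 * pi)))"
      by (intro Liminf_mono always_eventually allI Sint)
    also have "\<dots> = ennreal (P * sqrt (2 * pi))" by (simp add: Liminf_const)
    also have "(\<lambda>z. liminf (\<lambda>n. ennreal (S n z))) = (\<lambda>z. ennreal (\<phi> x * g z))"
      unfolding S_def by (intro ext lim_imp_Liminf tendsto_ennrealI conv) simp
    also have "(\<integral>\<^sup>+z. ennreal (\<phi> x * g z) \<partial>lborel) = ennreal (\<phi> x * sqrt (2 * pi))"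
    proof -
      have "0 \<le> \<phi> x * g z" for z by (simp add: g_def nonneg)
      thus ?thesis using gi by (subst nn_integral_eq_integral) (auto simp: ge)
    qed
    finally have "\<phi> x * sqrt (2 * pi) \<le> P * sqrt (2 * pi)"
      using \<open>0 \<le> P\<close> by (simp add: ennreal_le_iff)
    thus ?thesis by (simp add: P_def \<psi>_def)
  qed
  have lim2: "(\<lambda>n. L n x) \<longlonglongrightarrow> complex_of_real (\<phi> x)" for x
  proof -
    have "(\<lambda>n. (LBINT z. \<phi> (x + e n / (2 * pi) * z) * g z)) \<longlonglongrightarrow> (LBINT z. \<phi> x * g z)"
    proof (rule integral_dominated_convergence[where w = "\<lambda>z. (LBINT \<xi>. cmod (\<psi> \<xi>)) * g z"])
      show "AE z in lborel. norm (\<phi> (x + e n / (2 * pi) * z) * g z) \<le> (LBINT \<xi>. cmod (\<psi> \<xi>)) * g z" for n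
        using bound nonneg by (auto simp: g_def \<psi>_def abs_mult intro!: AE_I2)
    qed (use gi conv in auto)
    hence "(\<lambda>n. L n x) \<longlonglongrightarrow> complex_of_real (\<phi> x * sqrt (2 * pi)) / complex_of_real (sqrt (2 * pi))"
      unfolding L by (intro tendsto_intros) (simp_all add: ge)
    thus ?thesis by simp
  qed
  show "(LBINT \<xi>. FT (\<lambda>x. complex_of_real (\<phi> x)) \<xi> * cis (2 * pi * x * \<xi>)) = complex_of_real (\<phi> x)"
    using LIMSEQ_unique[OF lim1 lim2] unfolding \<psi>_def .
qed

section \<open>Products of functions of one coordinate\<close>

lemma
  fixes f :: "'a::euclidean_space \<Rightarrow> real \<Rightarrow> complex"
  assumes f: "\<And>b. b \<in> Basis \<Longrightarrow> integrable lborel (f b)"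
  shows integrable_prod_Basis: "integrable lborel (\<lambda>x::'a. \<Prod>b\<in>Basis. f b (x \<bullet> b))"
    and integral_prod_Basis_eq: "(\<integral>x. (\<Prod>b\<in>Basis. f b (x \<bullet> b)) \<partial>(lborel :: 'a measure)) = (\<Prod>b\<in>Basis. LBINT x. f b x)"
proof -
  interpret product_sigma_finite "\<lambda>_::'a. lborel :: real measure"
    by standard
  have [measurable]: "\<And>b. b \<in> Basis \<Longrightarrow> f b \<in> borel_measurable borel"
    using f by (simp add: borel_measurable_integrable)
  have T[measurable]: "(\<lambda>g. \<Sum>b\<in>Basis. g b *\<^sub>R b) \<in> (\<Pi>\<^sub>M b\<in>(Basis :: 'a set). lborel) \<rightarrow>\<^sub>M (borel :: 'a measure)"
    by measurable
  have m: "(\<lambda>x::'a. \<Prod>b\<in>Basis. f b (x \<bullet> b)) \<in> borel_measurable borel"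
    by measurable
  have e: "(\<Prod>b\<in>Basis. f b ((\<Sum>c\<in>Basis. g c *\<^sub>R c) \<bullet> b)) = (\<Prod>b\<in>Basis. f b (g b))" for g :: "'a \<Rightarrow> real"
    by (intro prod.cong refl) simp
  have i: "integrable (\<Pi>\<^sub>M b\<in>(Basis :: 'a set). lborel) (\<lambda>g. \<Prod>b\<in>Basis. f b (g b))"
    using f by (intro product_integrable_prod) auto
  show "integrable lborel (\<lambda>x::'a. \<Prod>b\<in>Basis. f b (x \<bullet> b))"
    by (subst lborel_eq, subst integrable_distr_eq[OF T m]) (simp only: e i)
  show "(\<integral>x. (\<Prod>b\<in>Basis. f b (x \<bullet> b)) \<partial>(lborel :: 'a measure)) = (\<Prod>b\<in>Basis. LBINT x. f b x)"
    using f by (subst lborel_eq, subst integral_distr[OF T m], unfold e, intro product_integral_prod) auto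
qed

text \<open>For constant functions \<open>h b\<close> the identity also splits a product of numbers
  indexed by \<open>Basis\<close>. Products of integrals are evaluated in this way below, at the
  arbitrary point \<open>undefined\<close>.\<close>

lemma prod_Basis_real_vec:
  fixes x :: "real \<times> (real^'m::finite)" and h :: "(real \<times> (real^'m)) \<Rightarrow> real \<Rightarrow> complex"
  shows "(\<Prod>b\<in>Basis. h b (x \<bullet> b)) = h (1, 0) (fst x) * (\<Prod>j\<in>UNIV. h (0, axis j 1) (snd x $ j))"
proof -
  have B: "(Basis :: (real \<times> (real^'m)) set) = insert (1, 0) ((\<lambda>j. (0, axis j 1)) ` UNIV)"
    by (auto simp: Basis_prod_def Basis_vec_def)
  have inj: "inj (\<lambda>j::'m. (0::real, axis j (1::real)))"
    by (auto simp: inj_on_def axis_eq_axis)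
  have "(\<Prod>b\<in>Basis. h b (x \<bullet> b)) = h (1, 0) (x \<bullet> (1, 0)) * (\<Prod>b\<in>(\<lambda>j. (0, axis j 1)) ` UNIV. h b (x \<bullet> b))"
    unfolding B by (rule prod.insert) auto
  thus ?thesis
    by (simp add: prod.reindex[OF inj] inner_prod_def inner_axis o_def)
qed

lemma integral_prod_real_vec:
  fixes f g :: "real \<Rightarrow> complex"
  assumes "integrable lborel f" and "integrable lborel g"
  shows "(\<integral>x. f (fst x) * (\<Prod>j\<in>UNIV. g (snd x $ j)) \<partial>(lborel :: (real \<times> (real^'m::finite)) measure))
      = (LBINT x. f x) * (LBINT x. g x) ^ CARD('m)"
proof -
  define h where "h b = (if b = (1, 0) then f else g)" for b :: "real \<times> (real^'m)"
  have h: "integrable lborel (h b)" for b using assms by (simp add: h_def)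
  have e: "(\<lambda>x. \<Prod>b\<in>Basis. h b (x \<bullet> b)) = (\<lambda>x. f (fst x) * (\<Prod>j\<in>UNIV. g (snd x $ j)))"
    by (simp add: fun_eq_iff prod_Basis_real_vec) (simp add: h_def)
  have "(\<Prod>b\<in>Basis. LBINT x. h b x) = (LBINT x. f x) * (\<Prod>j\<in>(UNIV::'m set). LBINT x. g x)"
    using prod_Basis_real_vec[of "\<lambda>b _. LBINT x. h b x" undefined] by (simp add: h_def)
  thus "(\<integral>x. f (fst x) * (\<Prod>j\<in>UNIV. g (snd x $ j)) \<partial>(lborel :: (real \<times> (real^'m::finite)) measure))
      = (LBINT x. f x) * (LBINT x. g x) ^ CARD('m)"
    using integral_prod_Basis_eq[of h, OF h] unfolding e by simp
qed

section \<open>Fourier transform and L2 norm of the initial packets\<close>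

lemma cis_sum: "cis (\<Sum>i\<in>A. f i) = (\<Prod>i\<in>A. cis (f i))"
  by (induction A rule: infinite_finite_induct) (simp_all flip: cis_mult)

definition freqs :: "real \<Rightarrow> real \<Rightarrow> int set" where
  "freqs R D = {l. R / (2 * D) < of_int l \<and> of_int l < R / D}"

lemma freqs_bounds:
  assumes "l \<in> freqs R D" "0 < D"
  shows "R / 2 < D * of_int l" "D * of_int l < R"
  using assms by (auto simp: freqs_def field_simps)

lemma finite_freqs: "finite (freqs R D)"
proof (rule finite_subset)
  show "freqs R D \<subseteq> {\<lfloor>R / (2 * D)\<rfloor>..\<lceil>R / D\<rceil>}"
    by (auto simp: freqs_def) linarith+
qed simp

text \<open>For \<open>\<psi>\<close> the transform of \<open>\<phi>\<close>, this is the factor of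
  the transform of \<open>fD\<close> in the first coordinate: a bump of width sqrt R at the
  frequency R.\<close>

definition FD1 :: "(real \<Rightarrow> complex) \<Rightarrow> real \<Rightarrow> real \<Rightarrow> complex" where
  "FD1 \<psi> R \<xi> = \<psi> ((\<xi> - R) / sqrt R) / sqrt R"

text \<open>The factor for each remaining coordinate, one unit bump per lattice point. The index set
  is a parameter because truncating the frequency domain later splits
  \<open>freqs R D\<close>.\<close>

definition FD2 :: "(real \<Rightarrow> complex) \<Rightarrow> int set \<Rightarrow> real \<Rightarrow> real \<Rightarrow> complex" where
  "FD2 \<psi> L D \<xi> = (\<Sum>l\<in>L. \<psi> (\<xi> - D * of_int l))"

text \<open>The function \<open>fD\<close> is a product of functions of one coordinate; modulation
  translates the transform of each factor, and the dilation by sqrt R stretches it in the first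
  coordinate.\<close>

lemma FT_fD:
  fixes \<phi> :: "real \<Rightarrow> real" and \<xi> :: "real \<times> (real^'m::finite)"
  assumes int: "integrable lborel \<phi>" and R: "0 < R"
  defines "\<psi> \<equiv> FT (\<lambda>x. complex_of_real (\<phi> x))"
  shows "FT (fD \<phi> R D) \<xi> = FD1 \<psi> R (fst \<xi>) * (\<Prod>j\<in>UNIV. FD2 \<psi> (freqs R D) D (snd \<xi> $ j))"
proof -
  have ic: "integrable lborel (\<lambda>x. complex_of_real (\<phi> x))" using int by simp
  have im: "integrable lborel (\<lambda>x. complex_of_real (\<phi> x) * cis (y * x))" for y
    by (rule Bochner_Integration.integrable_bound[OF ic]) (use int in \<open>auto simp: norm_mult borel_measurable_integrable\<close>)
  have FTm: "(LBINT x. complex_of_real (\<phi> x) * cis (- 2 * pi * \<eta> * x)) = \<psi> \<eta>" for \<eta>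
    by (simp add: \<psi>_def FT_def mult_ac)
  define u where "u = (\<lambda>x. cis (2 * pi * R * x) * complex_of_real (\<phi> (sqrt R * x)) * cis (- 2 * pi * (x * fst \<xi>)))"
  define v where "v \<eta> = (\<lambda>x. complex_of_real (\<phi> x) * (\<Sum>l\<in>freqs R D. cis (2 * pi * D * of_int l * x)) * cis (- 2 * pi * (x * \<eta>)))" for \<eta>
  have ue: "u x = complex_of_real (\<phi> (0 + sqrt R * x)) * cis ((- 2 * pi * ((fst \<xi> - R) / sqrt R)) * (0 + sqrt R * x))" for x
  proof -
    have "2 * pi * R * x + (- 2 * pi * (x * fst \<xi>)) = (- 2 * pi * ((fst \<xi> - R) / sqrt R)) * (0 + sqrt R * x)"
      using R by (simp add: field_simps)
    moreover have "u x = complex_of_real (\<phi> (0 + sqrt R * x)) * cis (2 * pi * R * x + (- 2 * pi * (x * fst \<xi>)))"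
      unfolding u_def cis_mult[symmetric] add_0 by (simp only: mult_ac)
    ultimately show ?thesis by (simp only:)
  qed
  have ve: "v \<eta> x = (\<Sum>l\<in>freqs R D. complex_of_real (\<phi> x) * cis ((- 2 * pi * (\<eta> - D * of_int l)) * x))" for \<eta> x
    by (simp add: v_def sum_distrib_left sum_distrib_right mult.assoc cis_mult) (simp add: algebra_simps)
  have ui: "integrable lborel u"
    unfolding ue[abs_def] by (rule lborel_integrable_real_affine[OF im]) (use R in simp)
  have uI: "(LBINT x. u x) = FD1 \<psi> R (fst \<xi>)"
  proof -
    have "\<psi> ((fst \<xi> - R) / sqrt R) = \<bar>sqrt R\<bar> *\<^sub>R (LBINT x. u x)"
      unfolding ue FTm[symmetric] using R by (intro lborel_integral_real_affine) auto
    thus ?thesis using R by (simp add: FD1_def scaleR_conv_of_real)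
  qed
  have vi: "integrable lborel (v \<eta>)" for \<eta>
    unfolding ve[abs_def] by (intro Bochner_Integration.integrable_sum im)
  have vI: "(LBINT x. v \<eta> x) = FD2 \<psi> (freqs R D) D \<eta>" for \<eta>
    unfolding ve FD2_def by (subst Bochner_Integration.integral_sum) (simp_all only: im FTm)
  define h where "h b = (if b = (1, 0) then u else v (\<xi> \<bullet> b))" for b :: "real \<times> (real^'m)"
  have hi: "integrable lborel (h b)" for b by (simp add: h_def ui vi)
  have e: "fD \<phi> R D x * cis (- 2 * pi * (x \<bullet> \<xi>)) = (\<Prod>b\<in>Basis. h b (x \<bullet> b))" for x
  proof -
    have c: "cis (- 2 * pi * (x \<bullet> \<xi>)) = cis (- 2 * pi * (fst x * fst \<xi>)) * (\<Prod>j\<in>UNIV. cis (- 2 * pi * (snd x $ j * snd \<xi> $ j)))"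
      by (simp add: inner_prod_def inner_vec_def cis_mult distrib_left sum_distrib_left sum_negf flip: cis_sum)
    show ?thesis
      unfolding prod_Basis_real_vec c fD_def freqs_def[symmetric]
      by (simp add: h_def u_def v_def inner_prod_def inner_axis prod.distrib mult_ac)
  qed
  have "FT (fD \<phi> R D) \<xi> = (\<Prod>b\<in>Basis. LBINT x. h b x)"
    unfolding FT_def e by (rule integral_prod_Basis_eq[OF hi])
  also have "\<dots> = (LBINT x. u x) * (\<Prod>j\<in>UNIV. LBINT x. v (snd \<xi> $ j) x)"
    using prod_Basis_real_vec[of "\<lambda>b _. LBINT x. h b x" undefined]
    by (simp add: h_def inner_prod_def inner_axis)
  finally show ?thesis by (simp only: uI vI)
qed

lemma cmod_sum_sq:
  "complex_of_real ((cmod (\<Sum>i\<in>A. f i))\<^sup>2) = (\<Sum>i\<in>A. \<Sum>j\<in>A. f i * cnj (f j))"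
  unfolding complex_norm_square by (simp add: sum_product)

text \<open>The spectra of the summands of the lattice sum are disjoint, which makes them orthogonal
  with respect to the weight \<open>\<phi>\<^sup>2\<close>.\<close>
lemma L2norm_fD:
  fixes \<phi> :: "real \<Rightarrow> real"
  assumes int: "integrable lborel \<phi>" and R: "0 < R" and D: "2 \<le> D"
    and bound: "\<And>x. \<bar>\<phi> x\<bar> \<le> P"
    and \<psi>_def: "\<psi> = FT (\<lambda>x. complex_of_real (\<phi> x))"
    and \<psi>_int: "integrable lborel \<psi>"
    and inv: "\<And>x. (LBINT \<xi>. \<psi> \<xi> * cis (2 * pi * x * \<xi>)) = complex_of_real (\<phi> x)"
    and supp: "\<And>\<xi>. \<bar>\<xi>\<bar> \<ge> 1 \<Longrightarrow> \<psi> \<xi> = 0"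
  shows "L2norm (fD \<phi> R D :: real \<times> (real^'m::finite) \<Rightarrow> complex) =
     sqrt ((LBINT x. (\<phi> x)\<^sup>2) / sqrt R * (of_nat (card (freqs R D)) * (LBINT x. (\<phi> x)\<^sup>2)) ^ CARD('m))"
proof -
  have [measurable]: "\<phi> \<in> borel_measurable borel" using int by (simp add: borel_measurable_integrable)
  have [measurable]: "\<psi> \<in> borel_measurable borel" using \<psi>_int by (simp add: borel_measurable_integrable)
  have i2: "integrable lborel (\<lambda>x. (\<phi> x)\<^sup>2)"
  proof (rule Bochner_Integration.integrable_bound)
    show "integrable lborel (\<lambda>x. P * \<phi> x)" using int by simp
    have "(\<phi> x)\<^sup>2 \<le> \<bar>P * \<phi> x\<bar>" for x
      using mult_mono[OF bound[of x] order_refl, of "\<bar>\<phi> x\<bar>"] bound[of x] by (simp add: power2_eq_square abs_mult)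
    thus "AE x in lborel. norm ((\<phi> x)\<^sup>2) \<le> norm (P * \<phi> x)" by simp
  qed simp
  have ic: "integrable lborel (\<lambda>x. complex_of_real ((\<phi> x)\<^sup>2))" using i2 by (simp only: complex_of_real_integrable_eq)
  have im: "integrable lborel (\<lambda>x. complex_of_real ((\<phi> x)\<^sup>2) * cis (y * x))" for y
    by (rule Bochner_Integration.integrable_bound[OF ic]) (auto simp: norm_mult)
  \<comment> \<open>Inserting the inversion formula for one factor \<open>\<phi>\<close> turns the
    integral into that of \<open>\<psi> \<eta> * \<psi> (- d - \<eta>)\<close>, and both arguments
    can lie in (-1, 1) only if |d| < 2. Distinct lattice frequencies are at least D apart, which is
    at least 2.\<close>
  have orth: "(LBINT x. complex_of_real ((\<phi> x)\<^sup>2) * cis (2 * pi * d * x)) = 0" if d: "\<bar>d\<bar> \<ge> 2" for d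
  proof -
    have intp: "integrable (lborel \<Otimes>\<^sub>M lborel) (\<lambda>(x, \<eta>). (complex_of_real (\<phi> x) * cis (2 * pi * d * x)) * \<psi> \<eta> * cis (2 * pi * x * \<eta>))"
    proof (rule Bochner_Integration.integrable_bound[OF lborel_pair_integrable_times])
      show "integrable lborel (\<lambda>x. complex_of_real (\<phi> x))" "integrable lborel \<psi>" using int \<psi>_int by simp_all
    qed (auto simp: norm_mult)
    have "(LBINT x. complex_of_real ((\<phi> x)\<^sup>2) * cis (2 * pi * d * x))
       = (LBINT x. (LBINT \<eta>. (complex_of_real (\<phi> x) * cis (2 * pi * d * x)) * \<psi> \<eta> * cis (2 * pi * x * \<eta>)))"
    proof (rule Bochner_Integration.integral_cong[OF refl])
      fix x :: real
      have "(LBINT \<eta>. (complex_of_real (\<phi> x) * cis (2 * pi * d * x)) * \<psi> \<eta> * cis (2 * pi * x * \<eta>)) = (complex_of_real (\<phi> x) * cis (2 * pi * d * x)) * complex_of_real (\<phi> x)"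
        unfolding inv[symmetric] integral_mult_right_zero[symmetric] by (simp only: mult.assoc)
      thus "complex_of_real ((\<phi> x)\<^sup>2) * cis (2 * pi * d * x) = (LBINT \<eta>. (complex_of_real (\<phi> x) * cis (2 * pi * d * x)) * \<psi> \<eta> * cis (2 * pi * x * \<eta>))"
        by (simp only: power2_eq_square of_real_mult mult_ac)
    qed
    also have "\<dots> = (LBINT \<eta>. (LBINT x. (complex_of_real (\<phi> x) * cis (2 * pi * d * x)) * \<psi> \<eta> * cis (2 * pi * x * \<eta>)))"
      using lborel_pair.Fubini_integral[OF intp] by simp
    also have "\<dots> = (LBINT \<eta>. \<psi> \<eta> * \<psi> (- d - \<eta>))"
    proof (rule Bochner_Integration.integral_cong[OF refl])
      fix \<eta> :: real
      have "(LBINT x. (complex_of_real (\<phi> x) * cis (2 * pi * d * x)) * \<psi> \<eta> * cis (2 * pi * x * \<eta>))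
        = (LBINT x. \<psi> \<eta> * (complex_of_real (\<phi> x) * cis (- 2 * pi * (x \<bullet> (- d - \<eta>)))))"
      proof (rule Bochner_Integration.integral_cong[OF refl])
        fix x :: real
        have "cis (2 * pi * d * x) * cis (2 * pi * x * \<eta>) = cis (- 2 * pi * (x \<bullet> (- d - \<eta>)))"
          by (simp add: cis_mult algebra_simps)
        thus "(complex_of_real (\<phi> x) * cis (2 * pi * d * x)) * \<psi> \<eta> * cis (2 * pi * x * \<eta>) = \<psi> \<eta> * (complex_of_real (\<phi> x) * cis (- 2 * pi * (x \<bullet> (- d - \<eta>))))"
          by (drule_tac sym) (simp only: mult_ac)
      qed
      also have "\<dots> = \<psi> \<eta> * \<psi> (- d - \<eta>)" by (simp only: integral_mult_right_zero FT_def \<psi>_def)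
      finally show "(LBINT x. (complex_of_real (\<phi> x) * cis (2 * pi * d * x)) * \<psi> \<eta> * cis (2 * pi * x * \<eta>)) = \<psi> \<eta> * \<psi> (- d - \<eta>)" .
    qed
    also have "(\<lambda>\<eta>. \<psi> \<eta> * \<psi> (- d - \<eta>)) = (\<lambda>_. 0)"
    proof
      fix \<eta> show "\<psi> \<eta> * \<psi> (- d - \<eta>) = 0"
        using supp[of \<eta>] supp[of "- d - \<eta>"] d by (cases "\<bar>\<eta>\<bar> \<ge> 1") auto
    qed
    finally show ?thesis by simp
  qed
  define I where "I = (LBINT x. (\<phi> x)\<^sup>2)"
  define u where "u x = complex_of_real ((\<phi> (0 + sqrt R * x))\<^sup>2)" for x
  define v where "v x = complex_of_real ((cmod (complex_of_real (\<phi> x) * (\<Sum>l\<in>freqs R D. cis (2 * pi * D * of_int l * x))))\<^sup>2)" for x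
  have ui: "integrable lborel u" unfolding u_def using lborel_integrable_real_affine[OF ic, of "sqrt R" 0] R by simp
  have uI: "(LBINT x. u x) = complex_of_real (I / sqrt R)"
  proof -
    have "complex_of_real I = \<bar>sqrt R\<bar> *\<^sub>R (LBINT x. u x)"
      unfolding u_def I_def integral_complex_of_real[symmetric] using R by (intro lborel_integral_real_affine) auto
    thus ?thesis using R by (simp add: scaleR_conv_of_real)
  qed
  have ve: "v x = (\<Sum>l\<in>freqs R D. \<Sum>l'\<in>freqs R D. complex_of_real ((\<phi> x)\<^sup>2) * cis ((2 * pi * (D * of_int (l - l'))) * x))" for x
  proof -
    have "cis (2 * pi * D * of_int l * x) * cnj (cis (2 * pi * D * of_int l' * x)) = cis ((2 * pi * (D * of_int (l - l'))) * x)" for l l'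
      by (simp add: cis_cnj cis_mult algebra_simps)
    thus ?thesis unfolding v_def norm_mult power_mult_distrib of_real_mult cmod_sum_sq
      by (simp add: sum_distrib_left)
  qed
  have vi: "integrable lborel v"
    unfolding ve[abs_def] by (intro Bochner_Integration.integrable_sum im)
  have "(LBINT x. v x) = (\<Sum>l\<in>freqs R D. \<Sum>l'\<in>freqs R D. (LBINT x. complex_of_real ((\<phi> x)\<^sup>2) * cis ((2 * pi * (D * of_int (l - l'))) * x)))"
    unfolding ve by (subst Bochner_Integration.integral_sum, intro Bochner_Integration.integrable_sum im, intro sum.cong refl Bochner_Integration.integral_sum im)
  also have "\<dots> = (\<Sum>l\<in>freqs R D. \<Sum>l'\<in>freqs R D. if l' = l then complex_of_real I else 0)"
  proof (intro sum.cong refl)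
    fix l l'
    show "(LBINT x. complex_of_real ((\<phi> x)\<^sup>2) * cis ((2 * pi * (D * of_int (l - l'))) * x)) = (if l' = l then complex_of_real I else 0)"
    proof (cases "l' = l")
      case False
      hence "\<bar>of_int (l - l') :: real\<bar> \<ge> 1" by linarith
      hence "\<bar>D * of_int (l - l')\<bar> \<ge> 2 * 1" using D unfolding abs_mult by (intro mult_mono) auto
      thus ?thesis using False by (simp only: orth if_False)
    next
      case True
      thus ?thesis by (simp add: I_def integral_complex_of_real[symmetric] del: integral_complex_of_real of_real_power)
    qed
  qed
  also have "\<dots> = complex_of_real (of_nat (card (freqs R D)) * I)"
    by (simp add: sum.delta finite_freqs)
  finally have vI: "(LBINT x. v x) = complex_of_real (of_nat (card (freqs R D)) * I)" .
  have e: "complex_of_real ((cmod (fD \<phi> R D x))\<^sup>2) = u (fst x) * (\<Prod>j\<in>UNIV. v (snd x $ j))" for x :: "real \<times> (real^'m)"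
    unfolding fD_def freqs_def[symmetric] u_def v_def
    by (simp add: norm_mult power_mult_distrib norm_power prod.distrib prod_norm[symmetric] prod_power_distrib)
  have "complex_of_real (\<integral>x. (cmod (fD \<phi> R D x))\<^sup>2 \<partial>(lborel :: (real \<times> (real^'m)) measure)) = complex_of_real (I / sqrt R * (of_nat (card (freqs R D)) * I) ^ CARD('m))"
    unfolding integral_complex_of_real[symmetric] e
    by (subst integral_prod_real_vec[OF ui vi]) (simp only: uI vI of_real_mult of_real_power)
  hence "(\<integral>x. (cmod (fD \<phi> R D x))\<^sup>2 \<partial>(lborel :: (real \<times> (real^'m)) measure)) = I / sqrt R * (of_nat (card (freqs R D)) * I) ^ CARD('m)"
    using of_real_eq_iff by blast
  thus ?thesis unfolding L2norm_def I_def by simp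
qed

section \<open>A frequency filter\<close>

text \<open>One half of the exponent is estimated by its value at v, the other half is kept for
  integrability; this is why a 4 replaces the 2.\<close>

lemma gaussian_tail:
  fixes l v :: real
  assumes l: "0 < l" and v: "0 \<le> v" and A: "\<And>s. s \<in> A \<Longrightarrow> v \<le> \<bar>s\<bar>" and [measurable]: "A \<in> sets borel"
  shows "(LBINT s. indicator A s * exp (- (l * s)\<^sup>2 / 2)) \<le> exp (- (l * v)\<^sup>2 / 4) * (2 * sqrt (2 * pi) / l)"
proof -
  have l2: "0 < l / sqrt 2" using l by simp
  have eq: "(l / sqrt 2 * s)\<^sup>2 / 2 = (l * s)\<^sup>2 / 4" for s by (simp add: power_mult_distrib power_divide)
  have i: "integrable lborel (\<lambda>s. exp (- (l * s)\<^sup>2 / 4))"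
    and I: "(LBINT s. exp (- (l * s)\<^sup>2 / 4)) = sqrt (2 * pi) / (l / sqrt 2)"
    using gaussian_integrable[OF l2] gaussian_integral_eq[OF l2] by (simp_all only: eq minus_divide_left[symmetric])
  have "(LBINT s. indicator A s * exp (- (l * s)\<^sup>2 / 2)) \<le> (LBINT s. exp (- (l * v)\<^sup>2 / 4) * exp (- (l * s)\<^sup>2 / 4))"
  proof (rule integral_mono')
    show "integrable lborel (\<lambda>s. exp (- (l * v)\<^sup>2 / 4) * exp (- (l * s)\<^sup>2 / 4))" using i by simp
    fix s :: real
    show "indicator A s * exp (- (l * s)\<^sup>2 / 2) \<le> exp (- (l * v)\<^sup>2 / 4) * exp (- (l * s)\<^sup>2 / 4)"
    proof (cases "s \<in> A")
      case True
      have "(l * v)\<^sup>2 \<le> (l * s)\<^sup>2" unfolding abs_le_square_iff[symmetric] using A[OF True] v l by (simp add: abs_mult)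
      thus ?thesis using True by (simp flip: exp_add)
    qed simp
  qed simp
  also have "\<dots> = exp (- (l * v)\<^sup>2 / 4) * (sqrt (2 * pi) / (l / sqrt 2))" by (simp only: integral_mult_right_zero I)
  also have "\<dots> \<le> exp (- (l * v)\<^sup>2 / 4) * (2 * sqrt (2 * pi) / l)"
  proof (intro mult_left_mono)
    have "sqrt (2 * pi) * sqrt 2 \<le> sqrt (2 * pi) * 2" using real_sqrt_le_mono[of 2 4] by (intro mult_left_mono) auto
    thus "sqrt (2 * pi) / (l / sqrt 2) \<le> 2 * sqrt (2 * pi) / l" using l by (simp add: field_simps)
  qed simp
  finally show ?thesis .
qed

text \<open>The filter kernel is a modulated Gaussian, averaged over the modulation frequencies in
  \<open>{\<alpha>..\<beta>}\<close>; its Fourier transform is almost \<open>1\<close> inside and almost \<open>0\<close> outside this interval.\<close>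
lemma frequency_filter:
  fixes f g :: "'a::euclidean_space \<Rightarrow> complex" and w :: "'a \<Rightarrow> real"
  assumes f: "integrable lborel f" and g: "integrable lborel g" and [measurable]: "w \<in> borel_measurable borel"
    and l: "0 < l" and v: "0 \<le> v" and h: "0 \<le> h" and ab: "\<alpha> \<le> \<beta>"
    and fw: "\<And>\<xi>. f \<xi> \<noteq> 0 \<Longrightarrow> \<alpha> + v \<le> w \<xi> \<and> w \<xi> \<le> \<beta> - v"
    and gw: "\<And>\<xi>. g \<xi> \<noteq> 0 \<Longrightarrow> w \<xi> \<le> \<alpha> - v \<or> \<beta> + v \<le> w \<xi>"
    and M: "\<And>s. \<bar>s\<bar> \<le> h \<Longrightarrow> cmod (LBINT \<xi>. (f \<xi> + g \<xi>) * cis (- (t + s) * w \<xi>)) \<le> M"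
  shows "cmod (LBINT \<xi>. f \<xi> * cis (- t * w \<xi>)) \<le> (\<beta> - \<alpha>) / (sqrt (2 * pi) * l) * M
    + (2 * exp (- (v / l)\<^sup>2 / 4) + (\<beta> - \<alpha>) / l * exp (- (l * h)\<^sup>2 / 4)) * ((LBINT \<xi>. cmod (f \<xi>)) + (LBINT \<xi>. cmod (g \<xi>)))"
proof -
  let ?F = "LBINT \<xi>. f \<xi> * cis (- t * w \<xi>)" and ?T = "\<lambda>A. LBINT s. indicator A s * exp (- ((1 / l) * s)\<^sup>2 / 2)"
  have [measurable]: "f \<in> borel_measurable borel" "g \<in> borel_measurable borel"
    using f g by (simp_all add: borel_measurable_integrable)
  \<comment> \<open>A time window of width 1/l, which blurs frequencies by about l.\<close>
  define E where "E s = exp (- (l * s)\<^sup>2 / 2)" for s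
  have E: "integrable lborel E" "(LBINT s. E s) = sqrt (2 * pi) / l"
    unfolding E_def using gaussian_integrable[OF l] gaussian_integral_eq[OF l] by auto
  have [measurable]: "E \<in> borel_measurable borel" unfolding E_def by measurable
  have E0: "0 \<le> E s" for s by (simp add: E_def)
  define J where "J \<sigma> = (indicator {\<alpha>..\<beta>} \<sigma> :: real)" for \<sigma>
  have J: "integrable lborel J" "(LBINT \<sigma>. J \<sigma>) = \<beta> - \<alpha>" unfolding J_def using ab by auto
  have [measurable]: "J \<in> borel_measurable borel" unfolding J_def by measurable
  have J0: "0 \<le> J s" for s by (simp add: J_def)
  define K where "K s = (LBINT \<sigma>. complex_of_real (E s * J \<sigma> / (2 * pi)) * cis (\<sigma> * s))" for s
  have [measurable]: "K \<in> borel_measurable borel" unfolding K_def by measurable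
  \<comment> \<open>The oscillation of the averaged modulation is given away here. The L1 norm of
    \<open>K\<close> becomes at most (\<beta> - \<alpha>)/(sqrt (2 pi) l), the factor in front of
    \<open>M\<close>.\<close>
  have Kb: "cmod (K s) \<le> (\<beta> - \<alpha>) / (2 * pi) * E s" for s
  proof -
    have "cmod (K s) \<le> (LBINT \<sigma>. cmod (complex_of_real (E s * J \<sigma> / (2 * pi)) * cis (\<sigma> * s)))"
      unfolding K_def by (rule integral_norm_bound)
    also have "\<dots> = (LBINT \<sigma>. (E s / (2 * pi)) * J \<sigma>)"
      by (intro Bochner_Integration.integral_cong refl) (simp add: norm_mult norm_divide E0 J0 abs_mult)
    also have "\<dots> = (\<beta> - \<alpha>) / (2 * pi) * E s" by (simp add: J)
    finally show ?thesis .
  qed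
  have Ki: "integrable lborel K"
  proof (rule Bochner_Integration.integrable_bound)
    show "integrable lborel (\<lambda>s. (\<beta> - \<alpha>) / (2 * pi) * E s)" using E by simp
    show "AE s in lborel. norm (K s) \<le> norm ((\<beta> - \<alpha>) / (2 * pi) * E s)"
      using Kb by (intro AE_I2) (metis abs_ge_self order_trans real_norm_def)
  qed simp
  \<comment> \<open>The probability that a centered normal variable with standard deviation l falls
    into the interval between \<alpha> - \<tau> and \<beta> - \<tau>. It is close to 1 or 0 if
    \<tau> lies inside or outside the band by the margin v.\<close>
  define G where "G \<tau> = (?T {\<alpha> - \<tau>..\<beta> - \<tau>}) / (sqrt (2 * pi) * l)" for \<tau>
  have Khat: "(LBINT s. K s * cis (- \<tau> * s)) = complex_of_real (G \<tau>)" for \<tau>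
  proof -
    have int: "integrable (lborel \<Otimes>\<^sub>M lborel) (\<lambda>(s, \<sigma>). complex_of_real (E s * J \<sigma> / (2 * pi)) * cis (\<sigma> * s) * cis (- \<tau> * s))"
    proof (rule Bochner_Integration.integrable_bound[OF lborel_pair_integrable_times])
      show "integrable lborel (\<lambda>s. complex_of_real (E s / (2 * pi)))" "integrable lborel (\<lambda>\<sigma>. complex_of_real (J \<sigma>))"
        using E J by simp_all
    qed (auto simp: norm_mult norm_divide)
    have "(LBINT s. K s * cis (- \<tau> * s)) = (LBINT s. LBINT \<sigma>. complex_of_real (E s * J \<sigma> / (2 * pi)) * cis (\<sigma> * s) * cis (- \<tau> * s))"
      unfolding K_def by (simp only: integral_mult_left_zero)
    also have "\<dots> = (LBINT \<sigma>. LBINT s. complex_of_real (E s * J \<sigma> / (2 * pi)) * cis (\<sigma> * s) * cis (- \<tau> * s))"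
      using lborel_pair.Fubini_integral[OF int] by simp
    also have "\<dots> = (LBINT \<sigma>. complex_of_real (J \<sigma> * exp (- ((1 / l) * (\<sigma> - \<tau>))\<^sup>2 / 2) / (sqrt (2 * pi) * l)))"
    proof (rule Bochner_Integration.integral_cong[OF refl])
      fix \<sigma> :: real
      have "(LBINT s. complex_of_real (E s * J \<sigma> / (2 * pi)) * cis (\<sigma> * s) * cis (- \<tau> * s))
        = (LBINT s. complex_of_real (J \<sigma> / (2 * pi)) * (complex_of_real (exp (- (l * s)\<^sup>2 / 2)) * cis ((\<sigma> - \<tau>) * s)))"
      proof (rule Bochner_Integration.integral_cong[OF refl])
        fix s :: real
        have "cis (\<sigma> * s) * cis (- \<tau> * s) = cis ((\<sigma> - \<tau>) * s)" by (simp add: cis_mult left_diff_distrib)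
        thus "complex_of_real (E s * J \<sigma> / (2 * pi)) * cis (\<sigma> * s) * cis (- \<tau> * s) = complex_of_real (J \<sigma> / (2 * pi)) * (complex_of_real (exp (- (l * s)\<^sup>2 / 2)) * cis ((\<sigma> - \<tau>) * s))"
          unfolding E_def by (drule_tac sym) simp
      qed
      also have "\<dots> = complex_of_real (J \<sigma> / (2 * pi) * (sqrt (2 * pi) / l * exp (- ((\<sigma> - \<tau>) / l)\<^sup>2 / 2)))"
        by (simp only: integral_mult_right_zero gaussian_fourier_integral[OF l] of_real_mult)
      also have "J \<sigma> / (2 * pi) * (sqrt (2 * pi) / l * exp (- ((\<sigma> - \<tau>) / l)\<^sup>2 / 2)) = (sqrt (2 * pi) / (2 * pi)) * (J \<sigma> * exp (- ((1 / l) * (\<sigma> - \<tau>))\<^sup>2 / 2) / l)"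
        by simp
      also have "sqrt (2 * pi) / (2 * pi) = 1 / sqrt (2 * pi)" by (simp only: sqrt_divide_self_eq pi_ge_zero mult_nonneg_nonneg inverse_eq_divide zero_le_numeral)
      finally show "(LBINT s. complex_of_real (E s * J \<sigma> / (2 * pi)) * cis (\<sigma> * s) * cis (- \<tau> * s)) = complex_of_real (J \<sigma> * exp (- ((1 / l) * (\<sigma> - \<tau>))\<^sup>2 / 2) / (sqrt (2 * pi) * l))"
        by (simp only: times_divide_times_eq mult_1_left)
    qed
    also have "\<dots> = complex_of_real ((LBINT \<sigma>. J \<sigma> * exp (- ((1 / l) * (\<sigma> - \<tau>))\<^sup>2 / 2)) / (sqrt (2 * pi) * l))"
      by (simp only: integral_complex_of_real integral_divide_zero)
    also have "(LBINT \<sigma>. J \<sigma> * exp (- ((1 / l) * (\<sigma> - \<tau>))\<^sup>2 / 2)) = \<bar>1\<bar> *\<^sub>R (LBINT s. J (\<tau> + 1 * s) * exp (- ((1 / l) * (\<tau> + 1 * s - \<tau>))\<^sup>2 / 2))"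
      by (intro lborel_integral_real_affine) simp
    also have "\<dots> = (?T {\<alpha> - \<tau>..\<beta> - \<tau>})"
      unfolding abs_one scaleR_one J_def by (intro Bochner_Integration.integral_cong refl) (auto simp: indicator_def)
    finally show ?thesis unfolding G_def .
  qed
  define e where "e = 2 * exp (- (v / l)\<^sup>2 / 4)"
  have e0: "0 \<le> e" by (simp add: e_def)
  have l': "0 < 1 / l" using l by simp
  have tail: "\<bar>(?T A) / (sqrt (2 * pi) * l)\<bar> \<le> e"
    if "\<And>s. s \<in> A \<Longrightarrow> v \<le> \<bar>s\<bar>" "A \<in> sets borel" for A
  proof -
    have "(?T A) / (sqrt (2 * pi) * l) \<le> exp (- ((1 / l) * v)\<^sup>2 / 4) * (2 * sqrt (2 * pi) / (1 / l)) / (sqrt (2 * pi) * l)"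
      using l by (intro divide_right_mono gaussian_tail[OF l' v that]) auto
    also have "\<dots> = e" using l by (simp add: e_def)
    finally have "(?T A) / (sqrt (2 * pi) * l) \<le> e" .
    moreover have "0 \<le> (?T A) / (sqrt (2 * pi) * l)"
      using l by (intro divide_nonneg_pos Bochner_Integration.integral_nonneg) auto
    ultimately show ?thesis by (simp only: abs_of_nonneg)
  qed
  have Gout: "\<bar>G \<tau>\<bar> \<le> e" if "\<tau> \<le> \<alpha> - v \<or> \<beta> + v \<le> \<tau>" for \<tau>
    unfolding G_def using that v by (intro tail) auto
  \<comment> \<open>The total mass is 1, so the defect \<open>1 - G \<tau>\<close> is the mass of
    the complement and again a Gaussian tail.\<close>
  have Gin: "\<bar>G \<tau> - 1\<bar> \<le> e" if "\<alpha> + v \<le> \<tau>" "\<tau> \<le> \<beta> - v" for \<tau>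
  proof -
    have i: "integrable lborel (\<lambda>s. exp (- ((1 / l) * s)\<^sup>2 / 2))" and I: "(LBINT s. exp (- ((1 / l) * s)\<^sup>2 / 2)) = sqrt (2 * pi) * l"
      using gaussian_integrable[OF l'] gaussian_integral_eq[OF l'] by (simp_all only: divide_divide_eq_right div_by_1)
    have ii: "integrable lborel (\<lambda>s. indicator {\<alpha> - \<tau>..\<beta> - \<tau>} s * exp (- ((1 / l) * s)\<^sup>2 / 2))"
      by (rule Bochner_Integration.integrable_bound[OF i]) (auto simp: indicator_def)
    have "(?T (- {\<alpha> - \<tau>..\<beta> - \<tau>})) = (LBINT s. exp (- ((1 / l) * s)\<^sup>2 / 2) - indicator {\<alpha> - \<tau>..\<beta> - \<tau>} s * exp (- ((1 / l) * s)\<^sup>2 / 2))"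
      by (intro Bochner_Integration.integral_cong refl) (auto simp: indicator_def)
    also have "\<dots> = sqrt (2 * pi) * l - (?T {\<alpha> - \<tau>..\<beta> - \<tau>})"
      using i ii by (subst Bochner_Integration.integral_diff) (simp_all only: I)
    finally have "(?T (- {\<alpha> - \<tau>..\<beta> - \<tau>})) / (sqrt (2 * pi) * l) = 1 - G \<tau>"
      using l unfolding G_def by (simp only: diff_divide_distrib) simp
    moreover have "\<bar>(?T (- {\<alpha> - \<tau>..\<beta> - \<tau>})) / (sqrt (2 * pi) * l)\<bar> \<le> e"
      using that v by (intro tail) auto
    ultimately show ?thesis by linarith
  qed
  define u where "u s = (LBINT \<xi>. (f \<xi> + g \<xi>) * cis (- (t + s) * w \<xi>))" for s
  have [measurable]: "u \<in> borel_measurable borel" unfolding u_def by measurable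
  define P where "P = (LBINT \<xi>. cmod (f \<xi>)) + (LBINT \<xi>. cmod (g \<xi>))"
  have P0: "0 \<le> P" unfolding P_def by simp
  have ub: "cmod (u s) \<le> P" for s
  proof -
    have "cmod (u s) \<le> (LBINT \<xi>. cmod ((f \<xi> + g \<xi>) * cis (- (t + s) * w \<xi>)))"
      unfolding u_def by (rule integral_norm_bound)
    also have "\<dots> \<le> (LBINT \<xi>. cmod (f \<xi>) + cmod (g \<xi>))"
      using f g by (intro integral_mono') (auto simp: norm_mult norm_triangle_ineq)
    also have "\<dots> = P" using f g by (simp add: P_def)
    finally show ?thesis .
  qed
  \<comment> \<open>This average is evaluated twice: by Fubini it multiplies the spectrum by
    \<open>G (w \<xi>)\<close>, which nearly reproduces the integral of f; in the time variable it
    is controlled by \<open>M\<close>.\<close>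
  define Ku where "Ku = (LBINT s. K s * u s)"
  have Ku: "Ku = (LBINT \<xi>. (f \<xi> + g \<xi>) * cis (- t * w \<xi>) * complex_of_real (G (w \<xi>)))"
  proof -
    have int: "integrable (lborel \<Otimes>\<^sub>M lborel) (\<lambda>(s, \<xi>). K s * ((f \<xi> + g \<xi>) * cis (- (t + s) * w \<xi>)))"
    proof (rule Bochner_Integration.integrable_bound[OF lborel_pair_integrable_times])
      show "integrable lborel K" "integrable lborel (\<lambda>\<xi>. f \<xi> + g \<xi>)" using Ki f g by simp_all
    qed (auto simp: norm_mult)
    have "Ku = (LBINT s. LBINT \<xi>. K s * ((f \<xi> + g \<xi>) * cis (- (t + s) * w \<xi>)))"
      unfolding Ku_def u_def by (simp only: integral_mult_right_zero)
    also have "\<dots> = (LBINT \<xi>. LBINT s. K s * ((f \<xi> + g \<xi>) * cis (- (t + s) * w \<xi>)))"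
      using lborel_pair.Fubini_integral[OF int] by simp
    also have "\<dots> = (LBINT \<xi>. (f \<xi> + g \<xi>) * cis (- t * w \<xi>) * complex_of_real (G (w \<xi>)))"
    proof (rule Bochner_Integration.integral_cong[OF refl])
      fix \<xi>
      have "(LBINT s. K s * ((f \<xi> + g \<xi>) * cis (- (t + s) * w \<xi>))) = (LBINT s. ((f \<xi> + g \<xi>) * cis (- t * w \<xi>)) * (K s * cis (- w \<xi> * s)))"
      proof (rule Bochner_Integration.integral_cong[OF refl])
        fix s :: real
        have "cis (- (t + s) * w \<xi>) = cis (- t * w \<xi>) * cis (- w \<xi> * s)" by (simp add: cis_mult algebra_simps)
        thus "K s * ((f \<xi> + g \<xi>) * cis (- (t + s) * w \<xi>)) = ((f \<xi> + g \<xi>) * cis (- t * w \<xi>)) * (K s * cis (- w \<xi> * s))"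
          by (simp only: mult_ac)
      qed
      thus "(LBINT s. K s * ((f \<xi> + g \<xi>) * cis (- (t + s) * w \<xi>))) = (f \<xi> + g \<xi>) * cis (- t * w \<xi>) * complex_of_real (G (w \<xi>))"
        by (simp only: integral_mult_right_zero Khat)
    qed
    finally show ?thesis .
  qed
  have GM[measurable]: "G \<in> borel_measurable borel"
  proof -
    have "(\<lambda>\<tau>. Re (LBINT s. K s * cis (- \<tau> * s))) \<in> borel_measurable borel" by measurable
    thus ?thesis unfolding Khat by simp
  qed
  let ?d = "\<lambda>\<xi>. (f \<xi> + g \<xi>) * cis (- t * w \<xi>) * complex_of_real (G (w \<xi>)) - f \<xi> * cis (- t * w \<xi>)"
  have pw: "cmod (?d \<xi>) \<le> e * (cmod (f \<xi>) + cmod (g \<xi>))" for \<xi>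
  proof -
    have "?d \<xi> = cis (- t * w \<xi>) * (f \<xi> * complex_of_real (G (w \<xi>) - 1) + g \<xi> * complex_of_real (G (w \<xi>)))"
      by (simp add: algebra_simps)
    hence "cmod (?d \<xi>) = cmod (f \<xi> * complex_of_real (G (w \<xi>) - 1) + g \<xi> * complex_of_real (G (w \<xi>)))"
      by (simp only: norm_mult norm_cis mult_1_left)
    also have "\<dots> \<le> cmod (f \<xi>) * \<bar>G (w \<xi>) - 1\<bar> + cmod (g \<xi>) * \<bar>G (w \<xi>)\<bar>"
      by (rule norm_triangle_le) (simp only: norm_mult norm_of_real order_refl)
    also have "\<dots> \<le> cmod (f \<xi>) * e + cmod (g \<xi>) * e"
    proof (rule add_mono)
      show "cmod (f \<xi>) * \<bar>G (w \<xi>) - 1\<bar> \<le> cmod (f \<xi>) * e"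
        using Gin[of "w \<xi>"] fw[of \<xi>] by (cases "f \<xi> = 0") (auto intro!: mult_left_mono)
      show "cmod (g \<xi>) * \<bar>G (w \<xi>)\<bar> \<le> cmod (g \<xi>) * e"
        using Gout[of "w \<xi>"] gw[of \<xi>] by (cases "g \<xi> = 0") (auto intro!: mult_left_mono)
    qed
    finally show ?thesis by (simp add: algebra_simps)
  qed
  have fi: "integrable lborel (\<lambda>\<xi>. f \<xi> * cis (- t * w \<xi>))"
    by (rule Bochner_Integration.integrable_bound[OF f]) (auto simp: norm_mult)
  have fgi: "integrable lborel (\<lambda>\<xi>. e * (cmod (f \<xi>) + cmod (g \<xi>)))" using f g by simp
  have di: "integrable lborel (\<lambda>\<xi>. ?d \<xi>)"
    by (rule Bochner_Integration.integrable_bound[OF fgi]) (measurable, intro AE_I2, unfold real_norm_def, rule order_trans[OF pw abs_ge_self])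
  have "(LBINT \<xi>. ?d \<xi>) = Ku - ?F"
  proof -
    have "integrable lborel (\<lambda>\<xi>. (?d \<xi>) + f \<xi> * cis (- t * w \<xi>))"
      by (rule Bochner_Integration.integrable_add[OF di fi])
    thus ?thesis unfolding Ku using fi by (intro Bochner_Integration.integral_diff) simp_all
  qed
  moreover have "cmod (LBINT \<xi>. ?d \<xi>) \<le> (LBINT \<xi>. e * (cmod (f \<xi>) + cmod (g \<xi>)))"
    by (rule order_trans[OF integral_norm_bound integral_mono[OF _ fgi pw]]) (use di in simp)
  moreover have "(LBINT \<xi>. e * (cmod (f \<xi>) + cmod (g \<xi>))) = e * P" using f g by (simp add: P_def)
  ultimately have 1: "cmod (Ku - ?F) \<le> e * P" by (simp only:)
  have M0: "0 \<le> M" using order_trans[OF norm_ge_zero M[of 0]] h by simp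
  \<comment> \<open>The bound \<open>M\<close> holds only for |s| at most h. Outside, the trivial
    bound \<open>P\<close> has to be compensated by the tail of the window.\<close>
  have 2: "cmod Ku \<le> (\<beta> - \<alpha>) / (sqrt (2 * pi) * l) * M + (\<beta> - \<alpha>) / l * exp (- (l * h)\<^sup>2 / 4) * P"
  proof -
    define A where "A = {s. h < \<bar>s\<bar>}"
    have [measurable]: "A \<in> sets borel" unfolding A_def by measurable
    have Ai: "integrable lborel (\<lambda>s. indicator A s * E s)"
      by (rule Bochner_Integration.integrable_bound[OF E(1)]) (auto simp: indicator_def)
    have pt: "cmod (K s * u s) \<le> (\<beta> - \<alpha>) / (2 * pi) * (M * E s + P * (indicator A s * E s))" for s
    proof -
      have "cmod (u s) \<le> M + P * indicator A s"
        using M[of s] ub[of s] M0 unfolding u_def A_def by (cases "h < \<bar>s\<bar>") auto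
      hence "cmod (K s * u s) \<le> ((\<beta> - \<alpha>) / (2 * pi) * E s) * (M + P * indicator A s)"
        unfolding norm_mult using Kb[of s] ab E0[of s] by (intro mult_mono) auto
      moreover have "(C * E s) * (M + P * indicator A s) = C * (M * E s + P * (indicator A s * E s))" for C
        by (simp add: algebra_simps)
      ultimately show ?thesis by (simp only:)
    qed
    have bi: "integrable lborel (\<lambda>s. (\<beta> - \<alpha>) / (2 * pi) * (M * E s + P * (indicator A s * E s)))"
      using E Ai by simp
    have "cmod Ku \<le> (LBINT s. cmod (K s * u s))" unfolding Ku_def by (rule integral_norm_bound)
    also have "\<dots> \<le> (LBINT s. (\<beta> - \<alpha>) / (2 * pi) * (M * E s + P * (indicator A s * E s)))"
      by (rule integral_mono'[OF bi pt]) (rule order_trans[OF norm_ge_zero pt])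
    also have "\<dots> = (\<beta> - \<alpha>) / (2 * pi) * (M * (sqrt (2 * pi) / l) + P * (LBINT s. indicator A s * E s))"
      using E Ai by simp
    also have "\<dots> \<le> (\<beta> - \<alpha>) / (2 * pi) * (M * (sqrt (2 * pi) / l) + P * (exp (- (l * h)\<^sup>2 / 4) * (2 * sqrt (2 * pi) / l)))"
      unfolding E_def using ab P0 by (intro mult_left_mono add_mono order_refl gaussian_tail l h) (auto simp: A_def)
    also have "\<dots> = (sqrt (2 * pi) / (2 * pi)) * ((\<beta> - \<alpha>) * M / l) + (2 * (sqrt (2 * pi) / (2 * pi))) * ((\<beta> - \<alpha>) / l * exp (- (l * h)\<^sup>2 / 4) * P)"
    proof -
      have "c / p * (M * (r / l) + P * (X * (2 * r / l))) = (r / p) * (c * M / l) + (2 * (r / p)) * (c / l * X * P)" for c p r X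
        by (simp add: distrib_left mult_ac)
      thus ?thesis .
    qed
    also have "sqrt (2 * pi) / (2 * pi) = 1 / sqrt (2 * pi)" by (simp only: sqrt_divide_self_eq pi_ge_zero mult_nonneg_nonneg inverse_eq_divide zero_le_numeral)
    also have "(1 / sqrt (2 * pi)) * ((\<beta> - \<alpha>) * M / l) + (2 * (1 / sqrt (2 * pi))) * ((\<beta> - \<alpha>) / l * exp (- (l * h)\<^sup>2 / 4) * P)
       \<le> (\<beta> - \<alpha>) / (sqrt (2 * pi) * l) * M + 1 * ((\<beta> - \<alpha>) / l * exp (- (l * h)\<^sup>2 / 4) * P)"
    proof (intro add_mono mult_right_mono)
      have "2 \<le> sqrt (2 * pi)" using pi_gt3 by (intro real_le_rsqrt) simp
      thus "2 * (1 / sqrt (2 * pi)) \<le> 1" by simp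
    qed (use ab l P0 in auto)
    finally show ?thesis by simp
  qed
  have "cmod ?F \<le> cmod Ku + cmod (Ku - ?F)"
    using norm_triangle_ineq4[of Ku "Ku - ?F"] by simp
  also have "\<dots> \<le> (\<beta> - \<alpha>) / (sqrt (2 * pi) * l) * M + (e + (\<beta> - \<alpha>) / l * exp (- (l * h)\<^sup>2 / 4)) * P"
    using 1 2 by (simp add: algebra_simps)
  finally show ?thesis unfolding e_def P_def .
qed

section \<open>Gauss sums\<close>

lemma cis_2pi_of_int: "cis (2 * pi * of_int k) = 1"
  by (metis cis_2pi cis_power_int mult.commute power_int_1_left)

definition qphase :: "int \<Rightarrow> int \<Rightarrow> nat \<Rightarrow> nat \<Rightarrow> complex" where
  "qphase a b q i = cis (2 * pi * of_int (a * (int i)\<^sup>2 + b * int i) / of_nat q)"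

lemma norm_qphase [simp]: "cmod (qphase a b q i) = 1"
  by (simp add: qphase_def)

lemma cis_int_frac_periodic:
  assumes "0 < q" "[u = v] (mod int q)"
  shows "cis (2 * pi * of_int u / of_nat q) = cis (2 * pi * of_int v / of_nat q)"
proof -
  obtain k where k: "u = v + int q * k" using assms(2) by (metis cong_iff_lin cong_sym)
  have "2 * pi * of_int u / of_nat q = 2 * pi * of_int v / of_nat q + 2 * pi * of_int k"
    unfolding k using assms(1) by (simp add: field_simps)
  thus ?thesis by (simp add: cis_mult[symmetric] cis_2pi_of_int)
qed

lemma qphase_periodic:
  assumes "0 < q" "[i = j] (mod q)"
  shows "qphase a b q i = qphase a b q j"
  unfolding qphase_def using assms
  by (intro cis_int_frac_periodic cong_add cong_mult cong_pow cong_refl) (simp_all add: cong_int_iff)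

text \<open>The square of i cancels in the difference of the phases at i + h and i, so for fixed h
  the correlations form a geometric progression in i.\<close>

lemma qphase_correlation:
  "qphase a b q (i + h) * cnj (qphase a b q i) = qphase a b q h * cis (2 * pi * of_int (2 * a * int h) / of_nat q) ^ i"
proof -
  have "2 * pi * of_int (a * (int (i + h))\<^sup>2 + b * int (i + h)) / of_nat q - 2 * pi * of_int (a * (int i)\<^sup>2 + b * int i) / of_nat q
     = 2 * pi * of_int (a * (int h)\<^sup>2 + b * int h) / of_nat q + real i * (2 * pi * of_int (2 * a * int h) / of_nat q)"
    by (simp add: field_simps add_divide_distrib[symmetric] diff_divide_distrib[symmetric] power2_eq_square)
  thus ?thesis unfolding qphase_def cis_cnj Complex.DeMoivre cis_mult
    by (simp only: diff_conv_add_uminus)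
qed

text \<open>Pairs of indices are grouped by their distance h; pairs in the opposite order contribute
  the conjugates, hence twice the real part.\<close>

lemma cmod_sum_sq_diagonals:
  fixes z :: "nat \<Rightarrow> complex"
  assumes "\<And>i. cmod (z i) = 1"
  shows "(cmod (\<Sum>i<r. z i))\<^sup>2 = real r + 2 * Re (\<Sum>h\<in>{1..<r}. \<Sum>i<r - h. z (i + h) * cnj (z i))"
proof -
  have 1: "(cmod (\<Sum>i<r. z i))\<^sup>2 = real r + 2 * Re (\<Sum>j<r. \<Sum>i<j. z j * cnj (z i))"
  proof (induction r)
    case (Suc r)
    have "(cmod (w + z r))\<^sup>2 = (cmod w)\<^sup>2 + 1 + 2 * Re (z r * cnj w)" for w
    proof -
      have "(cmod (w + z r))\<^sup>2 = (cmod w)\<^sup>2 + (cmod (z r))\<^sup>2 + 2 * Re (z r * cnj w)"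
        by (simp only: cmod_power2) (simp add: power2_eq_square algebra_simps)
      thus ?thesis by (simp add: assms)
    qed
    from this[of "\<Sum>i<r. z i"] Suc show ?case
      by (simp add: sum_distrib_left)
  qed simp
  have 2: "(\<Sum>j<r. \<Sum>i<j. z j * cnj (z i)) = (\<Sum>h\<in>{1..<r}. \<Sum>i<r - h. z (i + h) * cnj (z i))"
  proof -
    have "(\<Sum>j<r. \<Sum>i<j. z j * cnj (z i)) = (\<Sum>(j, i)\<in>(SIGMA j:{..<r}. {..<j}). z j * cnj (z i))"
      by (subst sum.Sigma) auto
    also have "\<dots> = (\<Sum>(h, i)\<in>(SIGMA h:{1..<r}. {..<r - h}). z (i + h) * cnj (z i))"
      by (rule sum.reindex_bij_witness[where i = "\<lambda>(h, i). (i + h, i)" and j = "\<lambda>(j, i). (j - i, i)"]) auto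
    also have "\<dots> = (\<Sum>h\<in>{1..<r}. \<Sum>i<r - h. z (i + h) * cnj (z i))"
      by (subst sum.Sigma) auto
    finally show ?thesis .
  qed
  show ?thesis using 1 2 by simp
qed

text \<open>A weak form of Jordan's inequality. With slope 1/4, monotonicity settles the range up to
  pi/3, and sin (pi/3) alone the rest.\<close>

lemma sin_ge_quarter:
  fixes x :: real
  assumes "0 \<le> x" "x \<le> pi / 2"
  shows "x / 4 \<le> sin x"
proof (cases "x \<le> pi / 3")
  case True
  have "sin 0 - 0 / 4 \<le> sin x - x / 4"
  proof (rule DERIV_nonneg_imp_nondecreasing[OF assms(1)])
    fix y assume y: "0 \<le> y" "y \<le> x"
    have "cos (pi / 3) \<le> cos y" using y True by (intro cos_monotone_0_pi_le) auto
    hence "0 \<le> cos y - 1 / 4" by (simp add: cos_60)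
    moreover have "((\<lambda>y. sin y - y / 4) has_real_derivative cos y - 1 / 4) (at y)"
      by (auto intro!: derivative_eq_intros)
    ultimately show "\<exists>d. ((\<lambda>y. sin y - y / 4) has_real_derivative d) (at y) \<and> 0 \<le> d" by blast
  qed
  thus ?thesis by simp
next
  case False
  hence "sin (pi / 3) \<le> sin x" using assms by (intro sin_monotone_2pi_le) auto
  moreover have "1 \<le> sqrt 3" by simp
  ultimately show ?thesis using assms pi_less_4 unfolding sin_60 by linarith
qed

lemma sum_lessThan_add_nat:
  fixes f :: "nat \<Rightarrow> 'a::comm_monoid_add"
  shows "(\<Sum>i<m + n. f i) = (\<Sum>i<m. f i) + (\<Sum>i<n. f (m + i))"
  by (induction n) (simp_all add: add.assoc)

text \<open>Meant as a bound for sums of at most q powers of exp(2 pi i v / q). The sum of the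
  reciprocal distances to 0 and to q dominates the reciprocal of the smaller one and is easy to add
  up over v.\<close>

definition geom_bound :: "nat \<Rightarrow> nat \<Rightarrow> real" where
  "geom_bound q v = (if v = 0 then real q else 2 * real q / real v + 2 * real q / real (q - v))"

text \<open>For a ratio \<open>\<omega>\<close> other than 1, |1 - \<omega>| = 2 |sin (pi v / q)| is
  at least k/q, where k is the distance from v to the nearest multiple of q.\<close>

lemma geometric_cis_bound:
  assumes "0 < q" "n \<le> q"
  shows "cmod (\<Sum>i<n. cis (2 * pi * of_int m / of_nat q) ^ i) \<le> geom_bound q (nat (m mod int q))"
proof -
  define v where "v = nat (m mod int q)"
  have v: "v < q" "int v = m mod int q" using assms by (auto simp: v_def nat_less_iff)
  define \<omega> where "\<omega> = cis (2 * pi * real v / real q)"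
  have \<omega>: "cis (2 * pi * of_int m / of_nat q) = \<omega>"
  proof -
    have "[m = int v] (mod int q)" by (simp add: v(2) cong_def)
    from cis_int_frac_periodic[OF assms(1) this] show ?thesis by (simp add: \<omega>_def)
  qed
  have nw: "cmod \<omega> = 1" by (simp add: \<omega>_def)
  show ?thesis
  proof (cases "v = 0")
    case True
    thus ?thesis using assms unfolding \<omega> v_def[symmetric] by (simp add: \<omega>_def geom_bound_def)
  next
    case False
    define \<theta> where "\<theta> = pi * real v / real q"
    define k where "k = min v (q - v)"
    have k: "0 < k" "2 * k \<le> q" using False v(1) by (auto simp: k_def)
    have s: "sin \<theta> = sin (pi * real k / real q)"
    proof (cases "v \<le> q - v")
      case False
      hence "pi * real k / real q = pi - \<theta>" using v(1) assms by (simp add: k_def \<theta>_def field_simps of_nat_diff)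
      thus ?thesis by simp
    qed (simp add: k_def \<theta>_def min_def)
    have "pi * real k / real q / 4 \<le> sin (pi * real k / real q)"
    proof (rule sin_ge_quarter)
      have "2 * real k \<le> real q" using k by linarith
      thus "pi * real k / real q \<le> pi / 2" using assms by (simp add: field_simps)
    qed simp
    moreover have "real k / 2 \<le> pi * real k / 4" using pi_gt3 mult_right_mono[of 2 pi "real k"] by simp
    hence "real k / 2 / real q \<le> pi * real k / 4 / real q" by (rule divide_right_mono) simp
    ultimately have sk: "real k / real q \<le> 2 * sin \<theta>" using s by simp
    have "(cmod (1 - \<omega>))\<^sup>2 = (2 * sin \<theta>)\<^sup>2"
    proof -
      have w: "\<omega> = cis (2 * \<theta>)" by (simp add: \<omega>_def \<theta>_def mult.assoc)
      have "(cmod (1 - \<omega>))\<^sup>2 = 2 - 2 * cos (2 * \<theta>)"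
        unfolding w cmod_power2 using sin_cos_squared_add[of "2 * \<theta>"] by (simp add: power2_eq_square algebra_simps)
      also have "\<dots> = (2 * sin \<theta>)\<^sup>2" unfolding cos_double_sin by (simp add: power2_eq_square)
      finally show ?thesis .
    qed
    hence "cmod (1 - \<omega>) = 2 * sin \<theta> \<or> cmod (1 - \<omega>) = - (2 * sin \<theta>)" by (simp only: power2_eq_iff)
    hence "cmod (1 - \<omega>) = \<bar>2 * sin \<theta>\<bar>" using norm_ge_zero[of "1 - \<omega>"] by linarith
    hence lower: "real k / real q \<le> cmod (1 - \<omega>)" using sk by linarith
    have kq: "0 < real k / real q" using k assms by simp
    have ne: "\<omega> \<noteq> 1" using lower kq by auto
    have "cmod (\<Sum>i<n. \<omega> ^ i) = cmod (1 - \<omega> ^ n) / cmod (1 - \<omega>)"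
      using ne by (simp add: sum_gp_strict norm_divide)
    also have "\<dots> \<le> 2 / (real k / real q)"
      using lower kq norm_triangle_ineq4[of 1 "\<omega> ^ n"] by (intro frac_le) (auto simp: norm_power nw)
    also have "\<dots> = 2 * real q / real k" by simp
    also have "\<dots> \<le> 2 * real q / real v + 2 * real q / real (q - v)"
      by (cases "v \<le> q - v") (auto simp: k_def min_def)
    finally show ?thesis using False unfolding \<omega> v_def[symmetric] by (simp add: geom_bound_def)
  qed
qed

text \<open>The entry v = 0 contributes q, and each of the two reciprocals contributes 2 q times a
  harmonic sum.\<close>

lemma sum_geom_bound:
  assumes "0 < q"
  shows "(\<Sum>v<q. geom_bound q v) \<le> real q * (5 + 4 * ln (real q))"
proof -
  have h: "(\<Sum>v\<in>{1..<q}. 1 / real v) \<le> 1 + ln (real q)"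
  proof -
    have "(\<Sum>v\<in>{1..<q}. 1 / real v) \<le> (\<Sum>v\<in>{1..q}. 1 / real v)" by (intro sum_mono2) auto
    also have "\<dots> = harm q" by (simp add: harm_def inverse_eq_divide)
    also have "\<dots> \<le> 1 + ln (real q)"
      using decseqD[OF decseq_harm_diff_ln, of 0 "q - 1"] assms by (simp add: harm_Suc harm_expand)
    finally show ?thesis .
  qed
  have r: "(\<Sum>v\<in>{1..<q}. 1 / real (q - v)) = (\<Sum>v\<in>{1..<q}. 1 / real v)"
    by (rule sum.reindex_bij_witness[where i = "\<lambda>v. q - v" and j = "\<lambda>v. q - v"]) auto
  have "{..<q} = insert 0 {1..<q}" using assms by auto
  hence "(\<Sum>v<q. geom_bound q v) = real q + (\<Sum>v\<in>{1..<q}. 2 * real q * (1 / real v) + 2 * real q * (1 / real (q - v)))"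
    by (simp add: geom_bound_def)
  also have "\<dots> = real q + real q * (4 * (\<Sum>v\<in>{1..<q}. 1 / real v))"
    by (simp only: sum.distrib sum_distrib_left[symmetric] r)
  also have "\<dots> \<le> real q + real q * (4 * (1 + ln (real q)))"
    using h by (intro add_left_mono mult_left_mono) auto
  finally show ?thesis by (simp add: algebra_simps)
qed

lemma geom_bound_nonneg: "0 \<le> geom_bound q v" by (simp add: geom_bound_def)

text \<open>Multiplication by a permutes the residues, and doubling modulo q is injective on the
  residues below q/2 and on the others; so each value is taken at most twice.\<close>

lemma sum_geom_bound_dilated:
  assumes q: "0 < q" and a: "coprime a (int q)"
  shows "(\<Sum>h<q. geom_bound q (nat ((2 * a * int h) mod int q))) \<le> 2 * (\<Sum>v<q. geom_bound q v)"
proof -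
  define \<tau> where "\<tau> h = nat ((a * int h) mod int q)" for h
  have \<tau>q: "\<tau> h < q" for h using q by (simp add: \<tau>_def nat_less_iff)
  have inj: "inj_on \<tau> {..<q}"
  proof (rule inj_onI)
    fix h h' assume h: "h \<in> {..<q}" "h' \<in> {..<q}" and "\<tau> h = \<tau> h'"
    hence "(a * int h) mod int q = (a * int h') mod int q"
      using q by (simp add: \<tau>_def eq_nat_nat_iff)
    hence "[int h = int h'] (mod int q)"
      using a cong_mult_lcancel[of a "int q" "int h" "int h'"] by (simp add: cong_def)
    thus "h = h'" using h by (simp add: cong_int_iff cong_less_modulus_unique_nat)
  qed
  have im: "\<tau> ` {..<q} = {..<q}"
    by (rule endo_inj_surj) (use inj \<tau>q in auto)
  have e: "nat ((2 * a * int h) mod int q) = (2 * \<tau> h) mod q" for h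
  proof -
    have "(2 * a * int h) mod int q = (2 * ((a * int h) mod int q)) mod int q"
      by (simp add: mod_mult_right_eq mult.assoc)
    also have "\<dots> = int ((2 * \<tau> h) mod q)" using q by (simp add: \<tau>_def zmod_int)
    finally show ?thesis by simp
  qed
  have "(\<Sum>h<q. geom_bound q (nat ((2 * a * int h) mod int q))) = (\<Sum>h<q. geom_bound q ((2 * \<tau> h) mod q))"
    by (simp add: e)
  also have "\<dots> = (\<Sum>u\<in>\<tau> ` {..<q}. geom_bound q ((2 * u) mod q))"
    by (simp add: sum.reindex[OF inj])
  also have "\<dots> = (\<Sum>u\<in>{u. u < q \<and> 2 * u < q}. geom_bound q ((2 * u) mod q)) + (\<Sum>u\<in>{u. u < q \<and> \<not> 2 * u < q}. geom_bound q ((2 * u) mod q))"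
    unfolding im by (subst sum.union_disjoint[symmetric]) (auto intro!: sum.cong)
  also have "(\<Sum>u\<in>{u. u < q \<and> 2 * u < q}. geom_bound q ((2 * u) mod q)) = (\<Sum>v\<in>(\<lambda>u. 2 * u) ` {u. u < q \<and> 2 * u < q}. geom_bound q v)"
    by (subst sum.reindex) (auto simp: inj_on_def intro!: sum.cong)
  also have "\<dots> \<le> (\<Sum>v<q. geom_bound q v)"
    by (rule sum_mono2) (auto simp: geom_bound_nonneg)
  also have "(\<Sum>u\<in>{u. u < q \<and> \<not> 2 * u < q}. geom_bound q ((2 * u) mod q)) = (\<Sum>v\<in>(\<lambda>u. 2 * u - q) ` {u. u < q \<and> \<not> 2 * u < q}. geom_bound q v)"
    by (subst sum.reindex) (auto simp: inj_on_def le_mod_geq intro!: sum.cong)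
  also have "\<dots> \<le> (\<Sum>v<q. geom_bound q v)"
    by (rule sum_mono2) (auto simp: geom_bound_nonneg)
  finally show ?thesis by simp
qed

text \<open>Weyl differencing.\<close>
lemma incomplete_gauss_sum:
  assumes q: "0 < q" and a: "coprime a (int q)" and r: "r \<le> q"
  shows "cmod (\<Sum>i<r. qphase a b q i) \<le> sqrt (real q * (21 + 16 * ln (real q)))"
proof -
  let ?z = "qphase a b q"
  have "(cmod (\<Sum>i<r. ?z i))\<^sup>2 = real r + 2 * Re (\<Sum>h\<in>{1..<r}. \<Sum>i<r - h. ?z (i + h) * cnj (?z i))"
    by (rule cmod_sum_sq_diagonals) simp
  \<comment> \<open>One factor 2 stems from the conjugate pairs, the other from the residues
    \<open>2 * a * int h\<close>, which repeat at most twice.\<close>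
  also have "\<dots> \<le> real q + 2 * (2 * (real q * (5 + 4 * ln (real q))))"
  proof (intro add_mono mult_left_mono)
    have "Re (\<Sum>h\<in>{1..<r}. \<Sum>i<r - h. ?z (i + h) * cnj (?z i)) \<le> cmod (\<Sum>h\<in>{1..<r}. \<Sum>i<r - h. ?z (i + h) * cnj (?z i))"
      by (rule complex_Re_le_cmod)
    also have "\<dots> \<le> (\<Sum>h\<in>{1..<r}. geom_bound q (nat ((2 * a * int h) mod int q)))"
    proof (rule sum_norm_le)
      fix h
      have "cmod (\<Sum>i<r - h. ?z (i + h) * cnj (?z i)) = cmod (\<Sum>i<r - h. cis (2 * pi * of_int (2 * a * int h) / of_nat q) ^ i)"
        by (simp only: qphase_correlation sum_distrib_left[symmetric] norm_mult norm_qphase mult_1_left)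
      also have "\<dots> \<le> geom_bound q (nat ((2 * a * int h) mod int q))"
        using r by (intro geometric_cis_bound q) simp
      finally show "cmod (\<Sum>i<r - h. ?z (i + h) * cnj (?z i)) \<le> geom_bound q (nat ((2 * a * int h) mod int q))" .
    qed
    also have "\<dots> \<le> (\<Sum>h<q. geom_bound q (nat ((2 * a * int h) mod int q)))"
      using r by (intro sum_mono2) (auto simp: geom_bound_nonneg)
    also have "\<dots> \<le> 2 * (real q * (5 + 4 * ln (real q)))"
      using sum_geom_bound_dilated[OF q a] sum_geom_bound[OF q] by linarith
    finally show "Re (\<Sum>h\<in>{1..<r}. \<Sum>i<r - h. ?z (i + h) * cnj (?z i)) \<le> 2 * (real q * (5 + 4 * ln (real q)))" .
  qed (use r in auto)
  also have "\<dots> = real q * (21 + 16 * ln (real q))" by (simp add: algebra_simps)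
  finally show ?thesis by (rule real_le_rsqrt)
qed

text \<open>Expanding the square and summing over i leaves only the differences h with q dividing 2
  h, that is h = 0 and, for even q, h = q/2. The parity condition is that of admissible fractions:
  it makes the phase at q/2 equal to 1, so that the two terms add up instead of cancelling.\<close>

lemma gauss_sum_lower:
  assumes q: "0 < q" and a: "coprime a (int q)"
    and par: "odd q \<or> q mod 4 = 0 \<and> even b \<or> q mod 4 = 2 \<and> odd b"
  shows "sqrt (real q) \<le> cmod (\<Sum>i<q. qphase a b q i)"
proof -
  let ?z = "qphase a b q"
  define \<omega> where "\<omega> h = cis (2 * pi * of_int (2 * a * int h) / of_nat q)" for h
  have \<omega>q: "\<omega> h ^ q = 1" for h
  proof -
    have "real q * (2 * pi * of_int (2 * a * int h) / of_nat q) = 2 * pi * of_int (2 * a * int h)" using q by simp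
    thus ?thesis unfolding \<omega>_def Complex.DeMoivre by (simp only: cis_2pi_of_int)
  qed
  have \<omega>1: "\<omega> h = 1 \<longleftrightarrow> q dvd 2 * h" for h
  proof
    assume "\<omega> h = 1"
    then obtain k :: int where "2 * pi * of_int (2 * a * int h) / of_nat q = of_int k * 2 * pi"
      unfolding \<omega>_def by (auto simp: complex_eq_iff cos_one_2pi_int)
    hence "of_int (2 * a * int h) = (of_int (k * int q) :: real)" using q by (simp add: field_simps)
    hence "2 * a * int h = k * int q" by (simp only: of_int_eq_iff)
    hence "int q dvd a * int (2 * h)" by (metis dvd_triv_right mult.assoc mult.commute of_nat_mult of_nat_numeral)
    hence "int q dvd int (2 * h)" using a by (metis coprime_commute coprime_dvd_mult_right_iff)
    thus "q dvd 2 * h" by (simp only: int_dvd_int_iff)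
  next
    assume "q dvd 2 * h"
    hence "[2 * a * int h = 0] (mod int q)"
      by (metis cong_0_iff dvd_mult int_dvd_int_iff mult.assoc mult.commute of_nat_mult of_nat_numeral)
    thus "\<omega> h = 1" unfolding \<omega>_def using cis_int_frac_periodic[OF q] by fastforce
  qed
  have "complex_of_real ((cmod (\<Sum>i<q. ?z i))\<^sup>2) = (\<Sum>i<q. \<Sum>j<q. ?z j * cnj (?z i))"
    unfolding complex_norm_square by (simp add: sum_product mult.commute) (rule sum.swap)
  also have "\<dots> = (\<Sum>i<q. \<Sum>h<q. ?z (i + h) * cnj (?z i))"
  proof (rule sum.cong[OF refl])
    fix i
    define \<tau> where "\<tau> h = (i + h) mod q" for h
    have inj: "inj_on \<tau> {..<q}"
    proof (rule inj_onI)
      fix h h' assume h: "h \<in> {..<q}" "h' \<in> {..<q}" and "\<tau> h = \<tau> h'"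
      hence "[i + h = i + h'] (mod q)" by (simp add: \<tau>_def cong_def)
      hence "[h = h'] (mod q)" by (simp add: cong_add_lcancel_nat)
      thus "h = h'" using h by (simp add: cong_less_modulus_unique_nat)
    qed
    have im: "\<tau> ` {..<q} = {..<q}" by (rule endo_inj_surj) (use inj q in \<open>auto simp: \<tau>_def\<close>)
    have "(\<Sum>j<q. ?z j * cnj (?z i)) = (\<Sum>j\<in>\<tau> ` {..<q}. ?z j * cnj (?z i))" by (simp only: im)
    also have "\<dots> = (\<Sum>h<q. ?z (\<tau> h) * cnj (?z i))" by (simp add: sum.reindex[OF inj])
    also have "\<dots> = (\<Sum>h<q. ?z (i + h) * cnj (?z i))"
    proof (rule sum.cong[OF refl])
      fix h
      have "?z (\<tau> h) = ?z (i + h)" by (rule qphase_periodic[OF q]) (simp add: \<tau>_def cong_def)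
      thus "?z (\<tau> h) * cnj (?z i) = ?z (i + h) * cnj (?z i)" by simp
    qed
    finally show "(\<Sum>j<q. ?z j * cnj (?z i)) = (\<Sum>h<q. ?z (i + h) * cnj (?z i))" .
  qed
  also have "\<dots> = (\<Sum>h<q. ?z h * (\<Sum>i<q. \<omega> h ^ i))"
    unfolding qphase_correlation \<omega>_def[symmetric] sum_distrib_left by (rule sum.swap)
  also have "\<dots> = (\<Sum>h<q. if q dvd 2 * h then ?z h * of_nat q else 0)"
  proof (rule sum.cong[OF refl])
    fix h
    show "?z h * (\<Sum>i<q. \<omega> h ^ i) = (if q dvd 2 * h then ?z h * of_nat q else 0)"
      using \<omega>1[of h] \<omega>q[of h] by (auto simp: sum_gp_strict)
  qed
  also have "\<dots> = of_nat q * (\<Sum>h | h < q \<and> q dvd 2 * h. ?z h)"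
    by (simp add: sum.If_cases sum_distrib_left mult.commute Int_def)
  also have "(\<Sum>h | h < q \<and> q dvd 2 * h. ?z h) = of_nat (card {h. h < q \<and> q dvd 2 * h})"
  proof -
    have "?z h = 1" if h: "h < q" "q dvd 2 * h" for h
    proof (cases "h = 0")
      case False
      obtain k where k: "2 * h = q * k" using h(2) by (auto elim: dvdE)
      have "k \<noteq> 0"
      proof
        assume "k = 0"
        thus False using k False by simp
      qed
      moreover have "k < 2"
      proof (rule ccontr)
        assume "\<not> k < 2"
        hence "q * 2 \<le> q * k" by simp
        thus False using k h(1) by linarith
      qed
      ultimately have "k = 1" by linarith
      hence q2: "q = 2 * h" using k by simp
      have e: "int q dvd a * (int h)\<^sup>2 + b * int h"
      proof -
        \<comment> \<open>Since q = 2 h, the phase at h is a multiple of 2 pi once a h + b is even.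
          For odd h this needs that a is odd, being coprime to the even q.\<close>
        have "2 dvd a * int h + b"
        proof (cases "even h")
          case True
          hence "q mod 4 = 0" using q2 by presburger
          thus ?thesis using par q2 True by auto
        next
          case False
          hence "q mod 4 = 2" using q2 by presburger
          moreover have "odd a" using a q2 by (metis coprime_right_2_iff_odd coprime_mult_right_iff of_nat_mult of_nat_numeral)
          ultimately show ?thesis using par q2 False by auto
        qed
        hence "2 * int h dvd (a * int h + b) * int h" by (intro mult_dvd_mono) auto
        thus ?thesis unfolding q2 by (simp add: algebra_simps power2_eq_square)
      qed
      hence "[a * (int h)\<^sup>2 + b * int h = 0] (mod int q)" by (simp add: cong_0_iff)
      from cis_int_frac_periodic[OF q this] show ?thesis by (simp add: qphase_def)
    qed (simp add: qphase_def)
    thus ?thesis by simp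
  qed
  finally have "complex_of_real ((cmod (\<Sum>i<q. ?z i))\<^sup>2) = complex_of_real (real q * real (card {h. h < q \<and> q dvd 2 * h}))"
    by simp
  hence e: "(cmod (\<Sum>i<q. ?z i))\<^sup>2 = real q * real (card {h. h < q \<and> q dvd 2 * h})"
    using of_real_eq_iff by blast
  have "card {0::nat} \<le> card {h. h < q \<and> q dvd 2 * h}"
    using q by (intro card_mono) auto
  hence "1 \<le> real (card {h. h < q \<and> q dvd 2 * h})" by simp
  hence "real q * 1 \<le> (cmod (\<Sum>i<q. ?z i))\<^sup>2" unfolding e by (intro mult_left_mono) auto
  thus ?thesis by (intro real_le_lsqrt) auto
qed

text \<open>Summation by parts: each of the fewer than n increments of \<beta> is at most V/n, so
  the total variation of \<beta> is at most V.\<close>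

lemma abel_summation_bound:
  fixes y \<beta> :: "nat \<Rightarrow> complex"
  assumes Z: "\<And>m. m \<le> n \<Longrightarrow> cmod (\<Sum>i<m. y i) \<le> Z"
    and B: "\<And>i. i < n \<Longrightarrow> cmod (\<beta> i) \<le> B"
    and V: "\<And>i. Suc i < n \<Longrightarrow> cmod (\<beta> (Suc i) - \<beta> i) \<le> V / real n" and B0: "0 \<le> B" and V0: "0 \<le> V"
  shows "cmod (\<Sum>i<n. y i * \<beta> i) \<le> Z * (B + V)"
proof (cases n)
  case 0
  have "0 \<le> Z" using order_trans[OF norm_ge_zero Z[of 0]] by simp
  thus ?thesis using B0 V0 0 by simp
next
  case (Suc k)
  have abel: "(\<Sum>i<Suc k. y i * \<beta> i) = (\<Sum>i<Suc k. y i) * \<beta> k - (\<Sum>i<k. (\<Sum>j<Suc i. y j) * (\<beta> (Suc i) - \<beta> i))" for k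
    by (induction k) (simp_all add: algebra_simps)
  have Z0: "0 \<le> Z" using order_trans[OF norm_ge_zero Z[of 0]] by simp
  have "cmod (\<Sum>i<n. y i * \<beta> i) \<le> cmod ((\<Sum>i<n. y i) * \<beta> k) + cmod (\<Sum>i<k. (\<Sum>j<Suc i. y j) * (\<beta> (Suc i) - \<beta> i))"
    unfolding Suc abel by (rule norm_triangle_ineq4)
  also have "\<dots> \<le> Z * B + real (card {..<k}) * (Z * (V / real n))"
  proof (intro add_mono sum_norm_bound)
    show "cmod ((\<Sum>i<n. y i) * \<beta> k) \<le> Z * B"
      unfolding norm_mult using Z[of n] B[of k] Suc Z0 by (intro mult_mono) auto
    fix i assume "i \<in> {..<k}"
    thus "cmod ((\<Sum>j<Suc i. y j) * (\<beta> (Suc i) - \<beta> i)) \<le> Z * (V / real n)"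
      unfolding norm_mult using Z[of "Suc i"] V[of i] Suc Z0 by (intro mult_mono) auto
  qed
  also have "real (card {..<k}) * (Z * (V / real n)) = Z * (V * (real k / real n))" by simp
  also have "\<dots> \<le> Z * (V * 1)" using Suc V0 Z0 by (intro mult_left_mono) auto
  finally show ?thesis by (simp add: algebra_simps)
qed

text \<open>The phases are replaced by their mean \<open>G / of_nat q\<close> over a period. The
  deviations have partial sums at most 2 W, because complete periods cancel, and summation by parts
  costs at most the factor 2 + 1 more; this is the error 6 W. The mean is at least 1/sqrt q in
  modulus and is multiplied by a sum of \<beta> with real part at least n/2.\<close>

lemma modulated_gauss_sum_lower:
  fixes \<beta> :: "nat \<Rightarrow> complex"
  assumes q: "0 < q" and a: "coprime a (int q)"
    and par: "odd q \<or> q mod 4 = 0 \<and> even b \<or> q mod 4 = 2 \<and> odd b"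
    and \<beta>: "\<And>i. i < n \<Longrightarrow> cmod (\<beta> i - 1) \<le> 1 / 2"
    and var: "\<And>i. Suc i < n \<Longrightarrow> cmod (\<beta> (Suc i) - \<beta> i) \<le> 1 / real n"
  shows "real n / (2 * sqrt (real q)) - 6 * sqrt (real q * (21 + 16 * ln (real q))) \<le> cmod (\<Sum>i<n. qphase a b q i * \<beta> i)"
proof -
  let ?z = "qphase a b q"
  define G where "G = (\<Sum>i<q. ?z i)"
  define W where "W = sqrt (real q * (21 + 16 * ln (real q)))"
  have Wr: "cmod (\<Sum>i<r. ?z i) \<le> W" if "r \<le> q" for r
    unfolding W_def by (rule incomplete_gauss_sum[OF q a that])
  have GW: "cmod G \<le> W" unfolding G_def by (rule Wr) simp
  have block: "(\<Sum>i<q * d + r. ?z i) = of_nat d * G + (\<Sum>i<r. ?z i)" for d r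
  proof (induction d)
    case (Suc d)
    have "(\<Sum>i<q * Suc d + r. ?z i) = (\<Sum>i<q + (q * d + r). ?z i)" by (simp add: algebra_simps)
    also have "\<dots> = (\<Sum>i<q. ?z i) + (\<Sum>i<q * d + r. ?z (q + i))" by (simp add: sum_lessThan_add_nat)
    also have "(\<Sum>i<q * d + r. ?z (q + i)) = (\<Sum>i<q * d + r. ?z i)"
      by (intro sum.cong refl qphase_periodic[OF q]) (simp add: cong_def)
    finally show ?case using Suc by (simp add: G_def algebra_simps)
  qed simp
  have Z: "cmod (\<Sum>i<m. ?z i - G / of_nat q) \<le> 2 * W" for m
  proof -
    define d r where "d = m div q" and "r = m mod q"
    have m: "m = q * d + r" and r: "r < q" using q by (auto simp: d_def r_def)
    have "(\<Sum>i<m. ?z i - G / of_nat q) = (\<Sum>i<r. ?z i) - of_nat r / of_nat q * G"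
      unfolding sum_subtractf m block using q by (simp add: field_simps)
    hence "cmod (\<Sum>i<m. ?z i - G / of_nat q) \<le> cmod (\<Sum>i<r. ?z i) + real r / real q * cmod G"
      using norm_triangle_ineq4[of "\<Sum>i<r. ?z i" "of_nat r / of_nat q * G"] by (simp add: norm_mult norm_divide)
    also have "\<dots> \<le> W + 1 * W"
      using r q GW by (intro add_mono Wr mult_mono) auto
    finally show ?thesis by simp
  qed
  have \<beta>b: "cmod (\<beta> i) \<le> 2" if "i < n" for i
    using \<beta>[OF that] norm_triangle_ineq2[of "\<beta> i" 1] by simp
  have "cmod (\<Sum>i<n. (?z i - G / of_nat q) * \<beta> i) \<le> (2 * W) * (2 + 1)"
    by (rule abel_summation_bound) (use Z \<beta>b var in auto)
  moreover have "(\<Sum>i<n. (?z i - G / of_nat q) * \<beta> i) = (\<Sum>i<n. ?z i * \<beta> i) - G / of_nat q * (\<Sum>i<n. \<beta> i)"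
    by (simp only: left_diff_distrib sum_subtractf sum_distrib_left)
  ultimately have 1: "cmod (G / of_nat q * (\<Sum>i<n. \<beta> i)) - 6 * W \<le> cmod (\<Sum>i<n. ?z i * \<beta> i)"
    using norm_triangle_ineq2[of "G / of_nat q * (\<Sum>i<n. \<beta> i)" "\<Sum>i<n. ?z i * \<beta> i"] by (simp add: norm_minus_commute)
  have "real n / 2 \<le> Re (\<Sum>i<n. \<beta> i)"
  proof -
    have "1 / 2 \<le> Re (\<beta> i)" if "i < n" for i
      using \<beta>[OF that] abs_Re_le_cmod[of "\<beta> i - 1"] by simp
    hence "(\<Sum>i<n. 1 / 2) \<le> (\<Sum>i<n. Re (\<beta> i))" by (intro sum_mono) auto
    thus ?thesis by simp
  qed
  hence "real n / 2 \<le> cmod (\<Sum>i<n. \<beta> i)" using complex_Re_le_cmod order_trans by blast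
  hence "sqrt (real q) / real q * (real n / 2) \<le> cmod G / real q * cmod (\<Sum>i<n. \<beta> i)"
    using gauss_sum_lower[OF q a par] by (intro mult_mono divide_right_mono) (auto simp: G_def)
  hence "real n / (2 * sqrt (real q)) \<le> cmod (G / of_nat q * (\<Sum>i<n. \<beta> i))"
    using q by (simp add: norm_mult norm_divide sqrt_divide_self_eq field_simps)
  thus ?thesis using 1 unfolding W_def by linarith
qed

section \<open>One-dimensional oscillatory integrals\<close>

abbreviation chirp :: "real \<Rightarrow> real \<Rightarrow> real \<Rightarrow> complex" where
  "chirp t x \<xi> \<equiv> cis (- pi * t * \<xi>\<^sup>2 + 2 * pi * (x * \<xi>))"

abbreviation wave :: "real \<Rightarrow> 'a::real_inner \<Rightarrow> 'a \<Rightarrow> complex" where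
  "wave t x \<xi> \<equiv> cis (- pi * t * (norm \<xi>)\<^sup>2 + 2 * pi * (x \<bullet> \<xi>))"

locale band_limited =
  fixes \<phi> :: "real \<Rightarrow> real"
  assumes cont: "\<And>x. isCont \<phi> x"
    and pos: "\<And>x. 0 < \<phi> x"
    and int: "integrable lborel \<phi>"
    and supp: "\<And>\<xi>. 1 \<le> \<bar>\<xi>\<bar> \<Longrightarrow> FT (\<lambda>x. complex_of_real (\<phi> x)) \<xi> = 0"
    and at_0: "\<phi> 0 = 1"
begin

definition \<psi> :: "real \<Rightarrow> complex" where
  "\<psi> = FT (\<lambda>x. complex_of_real (\<phi> x))"

definition \<psi>_L1 :: real where "\<psi>_L1 = (LBINT \<xi>. cmod (\<psi> \<xi>))"

text \<open>As \<phi> is positive, its integral is the value of \<psi> at 0 and bounds |\<psi>|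
  everywhere.\<close>

definition \<psi>_sup :: real where "\<psi>_sup = (LBINT x. \<phi> x)"

definition \<phi>_sq :: real where "\<phi>_sq = (LBINT x. (\<phi> x)\<^sup>2)"

lemma \<phi>_measurable[measurable]: "\<phi> \<in> borel_measurable borel"
  using int by (simp add: borel_measurable_integrable)

lemma \<psi>_measurable[measurable]: "\<psi> \<in> borel_measurable borel"
  unfolding \<psi>_def by measurable

lemma \<psi>_le: "cmod (\<psi> \<xi>) \<le> \<psi>_sup"
  using cmod_FT_le[of "\<lambda>x. complex_of_real (\<phi> x)" \<xi>] pos unfolding \<psi>_def \<psi>_sup_def
  by (simp add: less_imp_le)

lemma \<psi>_zero: "1 \<le> \<bar>\<xi>\<bar> \<Longrightarrow> \<psi> \<xi> = 0"
  unfolding \<psi>_def by (rule supp)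

lemma \<psi>_integrable: "integrable lborel \<psi>"
  by (rule bounded_compact_support_integrable[OF \<psi>_measurable \<psi>_le]) (auto intro!: \<psi>_zero)

lemma \<psi>_inversion: "(LBINT \<xi>. \<psi> \<xi> * cis (2 * pi * x * \<xi>)) = complex_of_real (\<phi> x)"
  unfolding \<psi>_def by (rule FT_inversion_nonneg(2)) (use cont pos int \<psi>_integrable in \<open>auto simp: less_imp_le \<psi>_def\<close>)

lemma \<phi>_le: "\<bar>\<phi> x\<bar> \<le> \<psi>_L1"
  using FT_inversion_nonneg(1)[of \<phi> x] cont pos int \<psi>_integrable
  unfolding \<psi>_L1_def \<psi>_def by (auto simp: less_imp_le)

lemma \<psi>_integral: "(LBINT \<xi>. \<psi> \<xi>) = 1"
  using \<psi>_inversion[of 0] at_0 by simp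

lemma \<psi>_L1_ge_1: "1 \<le> \<psi>_L1"
  using \<phi>_le[of 0] at_0 by simp

lemma \<psi>_sup_nonneg: "0 \<le> \<psi>_sup"
  using order_trans[OF norm_ge_zero \<psi>_le[of 0]] .

lemma \<phi>_sq_pos: "0 < \<phi>_sq"
proof -
  have i: "integrable lborel (\<lambda>x. (\<phi> x)\<^sup>2)"
  proof (rule Bochner_Integration.integrable_bound)
    show "integrable lborel (\<lambda>x. \<psi>_L1 * \<phi> x)" using int by simp
    have "(\<phi> x)\<^sup>2 \<le> \<bar>\<psi>_L1 * \<phi> x\<bar>" for x
      using mult_mono[OF \<phi>_le[of x] order_refl, of "\<bar>\<phi> x\<bar>"] \<psi>_L1_ge_1 by (simp add: power2_eq_square abs_mult)
    thus "AE x in lborel. norm ((\<phi> x)\<^sup>2) \<le> norm (\<psi>_L1 * \<phi> x)" by simp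
  qed simp
  have "\<phi>_sq \<noteq> 0"
  proof
    assume "\<phi>_sq = 0"
    hence "AE x in lborel. (\<phi> x)\<^sup>2 = 0"
      unfolding \<phi>_sq_def using integral_nonneg_eq_0_iff_AE[OF i] by simp
    hence "AE x in (lborel :: real measure). False"
      by (rule AE_mp) (use pos in \<open>auto intro!: AE_I2 simp: less_imp_neq[symmetric]\<close>)
    thus False by (simp add: AE_iff_measurable[of UNIV])
  qed
  moreover have "0 \<le> \<phi>_sq" unfolding \<phi>_sq_def by simp
  ultimately show ?thesis by simp
qed

lemma \<psi>_shift_integrable:
  assumes "c \<noteq> 0"
  shows "integrable lborel (\<lambda>\<xi>. \<psi> ((\<xi> - d) / c))"
  using lborel_integrable_real_affine[OF \<psi>_integrable, of "1 / c" "- d / c"] assms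
  by (simp add: diff_divide_distrib)

lemma FD1_integrable: "0 < R \<Longrightarrow> integrable lborel (FD1 \<psi> R)"
  unfolding FD1_def[abs_def] by (intro integrable_divide \<psi>_shift_integrable) simp

lemma FD2_integrable: "integrable lborel (FD2 \<psi> L D)"
  unfolding FD2_def[abs_def] using \<psi>_shift_integrable[of 1] by (intro Bochner_Integration.integrable_sum) simp

text \<open>The factor of an evolved packet in the first coordinate, with \<open>osc2\<close> for
  each of the others. The set \<open>S\<close> truncates the frequency: an interval for the cubes in
  the definition of the solution, \<open>UNIV\<close> for the full packet.\<close>

definition osc1 :: "real \<Rightarrow> real set \<Rightarrow> real \<Rightarrow> real \<Rightarrow> complex" where
  "osc1 R S t x = (LBINT \<xi>. indicator S \<xi> *\<^sub>R (FD1 \<psi> R \<xi> * chirp t x \<xi>))"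

definition osc2 :: "int set \<Rightarrow> real \<Rightarrow> real set \<Rightarrow> real \<Rightarrow> real \<Rightarrow> complex" where
  "osc2 L D S t x = (LBINT \<xi>. indicator S \<xi> *\<^sub>R (FD2 \<psi> L D \<xi> * chirp t x \<xi>))"

definition coord_box :: "real set \<Rightarrow> (real \<times> (real^'m::finite)) set" where
  "coord_box S = {\<xi>. fst \<xi> \<in> S \<and> (\<forall>j. snd \<xi> $ j \<in> S)}"

lemma cubeQ_eq_box: "cubeQ N = coord_box {-N/2..N/2}"
proof -
  have "\<bar>y\<bar> \<le> N / 2 \<longleftrightarrow> y \<in> {-N/2..N/2}" for y :: real by auto
  thus ?thesis unfolding cubeQ_def coord_box_def by (simp only:)
qed

text \<open>The squared norm in the phase is additive over the coordinates and the cutoff is a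
  product of indicators, so the evolved and truncated packet still factorizes.\<close>

lemma
  fixes x :: "real \<times> (real^'m::finite)"
  assumes R: "0 < R" and [measurable]: "S \<in> sets borel"
  shows schro_packet_integrable: "integrable lborel (\<lambda>\<xi>. indicator (coord_box S) \<xi> *\<^sub>R (FT (fD \<phi> R D) \<xi> * wave t x \<xi>))"
    and schro_packet: "(LBINT \<xi>. indicator (coord_box S) \<xi> *\<^sub>R (FT (fD \<phi> R D) \<xi> * wave t x \<xi>))
      = osc1 R S t (fst x) * (\<Prod>j\<in>UNIV. osc2 (freqs R D) D S t (snd x $ j))"
proof -
  define u where "u \<xi> = indicator S \<xi> *\<^sub>R (FD1 \<psi> R \<xi> * chirp t (fst x) \<xi>)" for \<xi>
  define v where "v y \<xi> = indicator S \<xi> *\<^sub>R (FD2 \<psi> (freqs R D) D \<xi> * chirp t y \<xi>)" for y \<xi>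
  define h where "h b = (if b = (1, 0) then u else v (x \<bullet> b))" for b :: "real \<times> (real^'m)"
  have [measurable]: "FD1 \<psi> R \<in> borel_measurable borel" "FD2 \<psi> (freqs R D) D \<in> borel_measurable borel"
    using FD1_integrable[OF R] FD2_integrable by (simp_all add: borel_measurable_integrable)
  have ui: "integrable lborel u"
    unfolding u_def by (rule Bochner_Integration.integrable_bound[OF FD1_integrable[OF R]]) (auto simp: norm_mult indicator_def)
  have vi: "integrable lborel (v y)" for y
    unfolding v_def by (rule Bochner_Integration.integrable_bound[OF FD2_integrable]) (auto simp: norm_mult indicator_def)
  have hi: "integrable lborel (h b)" for b by (simp add: h_def ui vi)
  have e: "indicator (coord_box S) \<xi> *\<^sub>R (FT (fD \<phi> R D) \<xi> * wave t x \<xi>) = (\<Prod>b\<in>Basis. h b (\<xi> \<bullet> b))" for \<xi>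
  proof -
    have n: "(norm \<xi>)\<^sup>2 = (fst \<xi>)\<^sup>2 + (\<Sum>j\<in>UNIV. (snd \<xi> $ j)\<^sup>2)"
      by (subst power2_norm_eq_inner) (simp add: inner_prod_def inner_vec_def power2_eq_square)
    have i: "x \<bullet> \<xi> = fst x * fst \<xi> + (\<Sum>j\<in>UNIV. snd x $ j * snd \<xi> $ j)"
      by (simp add: inner_prod_def inner_vec_def)
    have "- pi * t * (norm \<xi>)\<^sup>2 + 2 * pi * (x \<bullet> \<xi>) = (- pi * t * (fst \<xi>)\<^sup>2 + 2 * pi * (fst x * fst \<xi>)) + (\<Sum>j\<in>UNIV. - pi * t * (snd \<xi> $ j)\<^sup>2 + 2 * pi * (snd x $ j * snd \<xi> $ j))"
      unfolding n i distrib_left sum.distrib sum_distrib_left by simp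
    hence c: "wave t x \<xi> = chirp t (fst x) (fst \<xi>) * (\<Prod>j\<in>UNIV. chirp t (snd x $ j) (snd \<xi> $ j))"
      by (simp only: cis_mult[symmetric] cis_sum)
    have ind: "complex_of_real (indicator (coord_box S) \<xi>) = complex_of_real (indicator S (fst \<xi>)) * (\<Prod>j\<in>UNIV. complex_of_real (indicator S (snd \<xi> $ j)))"
    proof (cases "\<forall>j. snd \<xi> $ j \<in> S")
      case False
      then obtain j where "snd \<xi> $ j \<notin> S" by auto
      hence "(\<Prod>j\<in>UNIV. complex_of_real (indicator S (snd \<xi> $ j))) = 0" by (intro prod_zero) (auto intro!: exI[of _ j])
      thus ?thesis using False by (simp add: coord_box_def)
    qed (simp add: coord_box_def indicator_def)
    show ?thesis
      unfolding prod_Basis_real_vec scaleR_conv_of_real ind c FT_fD[OF int R, folded \<psi>_def]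
      by (simp add: h_def u_def v_def inner_prod_def inner_axis prod.distrib scaleR_conv_of_real mult_ac)
  qed
  show "integrable lborel (\<lambda>\<xi>. indicator (coord_box S) \<xi> *\<^sub>R (FT (fD \<phi> R D) \<xi> * wave t x \<xi>))"
    unfolding e by (rule integrable_prod_Basis[OF hi])
  have "(LBINT \<xi>. indicator (coord_box S) \<xi> *\<^sub>R (FT (fD \<phi> R D) \<xi> * wave t x \<xi>)) = (\<Prod>b\<in>Basis. LBINT \<xi>. h b \<xi>)"
    unfolding e by (rule integral_prod_Basis_eq[OF hi])
  also have "\<dots> = (LBINT \<xi>. u \<xi>) * (\<Prod>j\<in>UNIV. LBINT \<xi>. v (snd x $ j) \<xi>)"
    using prod_Basis_real_vec[of "\<lambda>b _. LBINT \<xi>. h b \<xi>" undefined]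
    by (simp add: h_def inner_prod_def inner_axis)
  finally show "(LBINT \<xi>. indicator (coord_box S) \<xi> *\<^sub>R (FT (fD \<phi> R D) \<xi> * wave t x \<xi>))
      = osc1 R S t (fst x) * (\<Prod>j\<in>UNIV. osc2 (freqs R D) D S t (snd x $ j))"
    unfolding osc1_def osc2_def u_def v_def .
qed

lemma FD1_L1: "0 < R \<Longrightarrow> (LBINT \<xi>. cmod (FD1 \<psi> R \<xi>)) = \<psi>_L1"
proof -
  assume R: "0 < R"
  have "(LBINT \<xi>. cmod (FD1 \<psi> R \<xi>)) = \<bar>sqrt R\<bar> *\<^sub>R (LBINT \<eta>. cmod (FD1 \<psi> R (R + sqrt R * \<eta>)))"
    using R by (intro lborel_integral_real_affine) simp
  also have "\<dots> = \<psi>_L1" using R by (simp add: FD1_def norm_divide \<psi>_L1_def)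
  finally show ?thesis .
qed

lemma \<psi>_shift_L1: "(LBINT \<xi>. cmod (\<psi> (\<xi> - d))) = \<psi>_L1"
  using lborel_integral_real_affine[of 1 "\<lambda>\<xi>. cmod (\<psi> (\<xi> - d))" d] by (simp add: \<psi>_L1_def)

lemma FD2_L1: "(LBINT \<xi>. cmod (FD2 \<psi> L D \<xi>)) \<le> real (card L) * \<psi>_L1"
proof -
  have i: "integrable lborel (\<lambda>\<xi>. cmod (\<psi> (\<xi> - D * of_int l)))" for l
    using \<psi>_shift_integrable[of 1] by simp
  have "(LBINT \<xi>. cmod (FD2 \<psi> L D \<xi>)) \<le> (LBINT \<xi>. (\<Sum>l\<in>L. cmod (\<psi> (\<xi> - D * of_int l))))"
    unfolding FD2_def by (intro integral_mono' Bochner_Integration.integrable_sum i norm_sum) (auto intro: sum_nonneg)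
  also have "\<dots> = (\<Sum>l\<in>L. \<psi>_L1)"
    by (subst Bochner_Integration.integral_sum) (simp_all add: i \<psi>_shift_L1)
  finally show ?thesis by simp
qed

lemma cmod_indicator_integral_le:
  fixes f :: "real \<Rightarrow> complex"
  assumes "integrable lborel f"
  shows "cmod (LBINT \<xi>. indicator S \<xi> *\<^sub>R (f \<xi> * cis (g \<xi>))) \<le> (LBINT \<xi>. cmod (f \<xi>))"
proof -
  have "cmod (LBINT \<xi>. indicator S \<xi> *\<^sub>R (f \<xi> * cis (g \<xi>))) \<le> (LBINT \<xi>. cmod (indicator S \<xi> *\<^sub>R (f \<xi> * cis (g \<xi>))))"
    by (rule integral_norm_bound)
  also have "\<dots> \<le> (LBINT \<xi>. cmod (f \<xi>))"
    using assms by (intro integral_mono') (auto simp: norm_mult indicator_def)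
  finally show ?thesis .
qed

lemma osc1_le: "0 < R \<Longrightarrow> cmod (osc1 R S t x) \<le> \<psi>_L1"
  unfolding osc1_def using cmod_indicator_integral_le[OF FD1_integrable] FD1_L1 by simp

lemma osc2_le: "cmod (osc2 L D S t x) \<le> real (card L) * \<psi>_L1"
  unfolding osc2_def using order_trans[OF cmod_indicator_integral_le[OF FD2_integrable] FD2_L1] .

text \<open>Almost orthogonality with respect to a Gaussian weight: each off-diagonal term carries a
  factor at most exp(-\<delta>^2/2), and by the smallness assumption all of them together cost no
  more than the diagonal. The weighted mean square is therefore at most 3 * 2 n, and the step from
  L2 to L1 yields sqrt n + 6 sqrt n.\<close>

lemma exponential_sum_L1:
  fixes c :: "int \<Rightarrow> complex"
  assumes L: "finite L" and c: "\<And>l. l \<in> L \<Longrightarrow> cmod (c l) = 1"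
    and small: "real (card L) * exp (- \<delta>\<^sup>2 / 2) \<le> 1"
  shows "(LBINT \<eta>. indicator {-1<..<1} \<eta> * cmod (\<Sum>l\<in>L. c l * cis (\<delta> * of_int l * \<eta>))) \<le> 7 * sqrt (real (card L))"
proof (cases "L = {}")
  case False
  define n where "n = real (card L)"
  have n: "1 \<le> n" using False L by (simp add: n_def card_gt_0_iff Suc_le_eq)
  define S where "S \<eta> = (\<Sum>l\<in>L. c l * cis (\<delta> * of_int l * \<eta>))" for \<eta>
  have [measurable]: "S \<in> borel_measurable borel" unfolding S_def by measurable
  define g where "g \<eta> = exp (- \<eta>\<^sup>2 / 2)" for \<eta> :: real
  have gi: "integrable lborel (\<lambda>\<eta>. complex_of_real (g \<eta>) * cis (y * \<eta>))" for y
    using gaussian_fourier_integrable[of 1 y] by (simp add: g_def)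
  have gI: "(LBINT \<eta>. complex_of_real (g \<eta>) * cis (y * \<eta>)) = complex_of_real (sqrt (2 * pi) * exp (- y\<^sup>2 / 2))" for y
    using gaussian_fourier_integral[of 1 y] by (simp add: g_def)
  have e: "complex_of_real (g \<eta> * (cmod (S \<eta>))\<^sup>2) = (\<Sum>l\<in>L. \<Sum>l'\<in>L. (c l * cnj (c l')) * (complex_of_real (g \<eta>) * cis ((\<delta> * of_int (l - l')) * \<eta>)))" for \<eta>
  proof -
    have 1: "(c l * cis (\<delta> * of_int l * \<eta>)) * cnj (c l' * cis (\<delta> * of_int l' * \<eta>)) = (c l * cnj (c l')) * cis ((\<delta> * of_int (l - l')) * \<eta>)" for l l'
    proof -
      have "cis (\<delta> * of_int l * \<eta>) * cis (- (\<delta> * of_int l' * \<eta>)) = cis ((\<delta> * of_int (l - l')) * \<eta>)"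
        by (simp add: cis_mult algebra_simps)
      thus ?thesis unfolding complex_cnj_mult cis_cnj by (drule_tac sym) (simp only: mult_ac)
    qed
    show ?thesis unfolding of_real_mult S_def cmod_sum_sq 1 sum_distrib_left
      by (intro sum.cong refl) (simp only: mult_ac)
  qed
  have i2c: "integrable lborel (\<lambda>\<eta>. complex_of_real (g \<eta> * (cmod (S \<eta>))\<^sup>2))"
    unfolding e by (intro Bochner_Integration.integrable_sum integrable_mult_right gi)
  hence i2: "integrable lborel (\<lambda>\<eta>. g \<eta> * (cmod (S \<eta>))\<^sup>2)" by (simp only: complex_of_real_integrable_eq)
  have "complex_of_real (LBINT \<eta>. g \<eta> * (cmod (S \<eta>))\<^sup>2) = (\<Sum>l\<in>L. \<Sum>l'\<in>L. (c l * cnj (c l')) * complex_of_real (sqrt (2 * pi) * exp (- (\<delta> * of_int (l - l'))\<^sup>2 / 2)))"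
    unfolding integral_complex_of_real[symmetric] e
    by (subst Bochner_Integration.integral_sum, intro Bochner_Integration.integrable_sum integrable_mult_right gi)
       (intro sum.cong refl, subst Bochner_Integration.integral_sum, intro integrable_mult_right gi, simp only: integral_mult_right_zero gI)
  hence "cmod (complex_of_real (LBINT \<eta>. g \<eta> * (cmod (S \<eta>))\<^sup>2)) \<le> (\<Sum>l\<in>L. \<Sum>l'\<in>L. sqrt (2 * pi) * exp (- (\<delta> * of_int (l - l'))\<^sup>2 / 2))"
    using c by (simp only:) (intro sum_norm_le, simp add: norm_mult)
  also have "\<dots> \<le> (\<Sum>l\<in>L. \<Sum>l'\<in>L. sqrt (2 * pi) * ((if l' = l then 1 else 0) + exp (- \<delta>\<^sup>2 / 2)))"
  proof (intro sum_mono mult_left_mono)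
    fix l l'
    show "exp (- (\<delta> * of_int (l - l'))\<^sup>2 / 2) \<le> (if l' = l then 1 else 0) + exp (- \<delta>\<^sup>2 / 2)"
    proof (cases "l' = l")
      case False
      hence "1 \<le> \<bar>of_int (l - l') :: real\<bar>" by linarith
      hence "1 \<le> \<bar>of_int (l - l') :: real\<bar>\<^sup>2" by (rule one_le_power)
      hence "1 \<le> (of_int (l - l') :: real)\<^sup>2" by (simp only: power2_abs)
      hence "\<delta>\<^sup>2 * 1 \<le> (\<delta> * of_int (l - l'))\<^sup>2" unfolding power_mult_distrib by (intro mult_left_mono) auto
      thus ?thesis using False by simp
    qed simp
  qed simp
  also have "\<dots> = sqrt (2 * pi) * (n * (1 + n * exp (- \<delta>\<^sup>2 / 2)))"
  proof -
    have "(\<Sum>l'\<in>L. (if l' = l then 1 else 0) + exp (- \<delta>\<^sup>2 / 2)) = 1 + n * exp (- \<delta>\<^sup>2 / 2)" if "l \<in> L" for l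
      using that L by (simp add: sum.distrib sum.delta n_def)
    thus ?thesis by (simp add: sum_distrib_left[symmetric] n_def)
  qed
  also have "\<dots> \<le> 3 * (n * 2)"
  proof (intro mult_mono)
    have "2 * pi \<le> 9" using pi_less_4 by simp
    thus "sqrt (2 * pi) \<le> 3" using real_sqrt_le_mono[of "2 * pi" 9] by simp
  qed (use n small in \<open>auto simp: n_def\<close>)
  finally have I: "(LBINT \<eta>. g \<eta> * (cmod (S \<eta>))\<^sup>2) \<le> 6 * n" by simp
  \<comment> \<open>The arithmetic-geometric inequality plays the role of Cauchy-Schwarz; the weight
    is at least exp(-1/2), hence at least 1/2, on (-1, 1).\<close>
  have pt: "indicator {-1<..<1} \<eta> * cmod (S \<eta>) \<le> indicator {-1<..<1} \<eta> * (sqrt n / 2) + (1 / sqrt n) * (g \<eta> * (cmod (S \<eta>))\<^sup>2)" for \<eta>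
  proof (cases "\<eta> \<in> {-1<..<1}")
    case True
    hence "\<bar>\<eta>\<bar> \<le> 1" by auto
    hence "\<eta>\<^sup>2 \<le> 1" by (simp add: abs_square_le_1)
    hence "exp (- 1 / 2) \<le> g \<eta>" by (simp add: g_def)
    moreover have "1 / 2 \<le> exp (- 1 / 2 :: real)" using exp_ge_add_one_self[of "- 1 / 2"] by simp
    ultimately have g: "1 / 2 \<le> g \<eta>" by linarith
    have "0 \<le> (sqrt n - cmod (S \<eta>))\<^sup>2" by simp
    hence "2 * sqrt n * cmod (S \<eta>) \<le> n + (cmod (S \<eta>))\<^sup>2" using n by (simp add: power2_diff)
    hence "2 * sqrt n * cmod (S \<eta>) / (2 * sqrt n) \<le> (n + (cmod (S \<eta>))\<^sup>2) / (2 * sqrt n)" using n by (intro divide_right_mono) auto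
    hence "cmod (S \<eta>) \<le> n / (2 * sqrt n) + (1 / sqrt n) * (1 / 2 * (cmod (S \<eta>))\<^sup>2)" using n by (simp add: add_divide_distrib)
    also have "n / (2 * sqrt n) = sqrt n / 2" using n real_div_sqrt[of n] by (simp add: field_simps)
    also have "(1 / sqrt n) * (1 / 2 * (cmod (S \<eta>))\<^sup>2) \<le> (1 / sqrt n) * (g \<eta> * (cmod (S \<eta>))\<^sup>2)"
      using g n by (intro mult_left_mono mult_right_mono) auto
    finally show ?thesis using True by simp
  next
    case False
    have "0 \<le> (1 / sqrt n) * (g \<eta> * (cmod (S \<eta>))\<^sup>2)" using n by (simp add: g_def)
    thus ?thesis using False by simp
  qed
  have "(LBINT \<eta>. indicator {-1<..<1} \<eta> * cmod (S \<eta>)) \<le> (LBINT \<eta>. indicator {-1<..<1} \<eta> * (sqrt n / 2) + (1 / sqrt n) * (g \<eta> * (cmod (S \<eta>))\<^sup>2))"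
    using i2 n by (intro integral_mono' pt) (auto simp: g_def)
  also have "\<dots> = sqrt n + (1 / sqrt n) * (LBINT \<eta>. g \<eta> * (cmod (S \<eta>))\<^sup>2)"
    using i2 by (subst Bochner_Integration.integral_add) auto
  also have "\<dots> \<le> sqrt n + (1 / sqrt n) * (6 * n)" using I n by (intro add_left_mono mult_left_mono) auto
  also have "\<dots> = 7 * sqrt n" using n real_div_sqrt[of n] by simp
  finally show ?thesis unfolding S_def n_def .
qed simp

text \<open>Each bump is recentered by \<xi> = D l + \<eta>. The quadratic term in l leaves the
  integral, and inside l survives only through the linear phase -2 pi t D l \<eta>.\<close>

lemma osc2_UNIV_expand:
  "osc2 L D UNIV t x = (\<Sum>l\<in>L. chirp t x (D * of_int l)
     * (LBINT \<eta>. \<psi> \<eta> * cis (2 * pi * (x - t * (D * of_int l)) * \<eta> - pi * t * \<eta>\<^sup>2)))"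
proof -
  have si: "integrable lborel (\<lambda>\<xi>. \<psi> (\<xi> - D * of_int l) * chirp t x \<xi>)" for l
    by (rule Bochner_Integration.integrable_bound[of _ "\<lambda>\<xi>. \<psi> (\<xi> - D * of_int l)"]) (use \<psi>_shift_integrable[of 1] in \<open>auto simp: norm_mult\<close>)
  have "osc2 L D UNIV t x = (\<Sum>l\<in>L. LBINT \<xi>. \<psi> (\<xi> - D * of_int l) * chirp t x \<xi>)"
    unfolding osc2_def FD2_def indicator_UNIV scaleR_one sum_distrib_right by (rule Bochner_Integration.integral_sum) (rule si)
  also have "\<dots> = (\<Sum>l\<in>L. chirp t x (D * of_int l)
     * (LBINT \<eta>. \<psi> \<eta> * cis (2 * pi * (x - t * (D * of_int l)) * \<eta> - pi * t * \<eta>\<^sup>2)))"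
  proof (rule sum.cong[OF refl])
    fix l
    have "(LBINT \<xi>. \<psi> (\<xi> - D * of_int l) * chirp t x \<xi>) = (LBINT \<eta>. \<psi> \<eta> * chirp t x (D * of_int l + \<eta>))"
      using lborel_integral_real_affine[of 1 "\<lambda>\<xi>. \<psi> (\<xi> - D * of_int l) * chirp t x \<xi>" "D * of_int l"] by simp
    also have "\<dots> = (LBINT \<eta>. chirp t x (D * of_int l) * (\<psi> \<eta> * cis (2 * pi * (x - t * (D * of_int l)) * \<eta> - pi * t * \<eta>\<^sup>2)))"
    proof (rule Bochner_Integration.integral_cong[OF refl])
      fix \<eta> :: real
      have "- pi * t * (D * of_int l + \<eta>)\<^sup>2 + 2 * pi * (x * (D * of_int l + \<eta>)) = (- pi * t * (D * of_int l)\<^sup>2 + 2 * pi * (x * (D * of_int l))) + (2 * pi * (x - t * (D * of_int l)) * \<eta> - pi * t * \<eta>\<^sup>2)"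
        by (simp add: power2_eq_square algebra_simps)
      thus "\<psi> \<eta> * chirp t x (D * of_int l + \<eta>) = chirp t x (D * of_int l) * (\<psi> \<eta> * cis (2 * pi * (x - t * (D * of_int l)) * \<eta> - pi * t * \<eta>\<^sup>2))"
        by (simp only: cis_mult[symmetric] mult_ac)
    qed
    also have "\<dots> = chirp t x (D * of_int l) * (LBINT \<eta>. \<psi> \<eta> * cis (2 * pi * (x - t * (D * of_int l)) * \<eta> - pi * t * \<eta>\<^sup>2))"
      by (rule integral_mult_right_zero)
    finally show "(LBINT \<xi>. \<psi> (\<xi> - D * of_int l) * chirp t x \<xi>) = \<dots>" .
  qed
  finally show ?thesis .
qed

text \<open>For fixed \<eta> the sum over l is an exponential sum with frequency spacing 2 pi t D.
  Once this spacing is large, the L1 estimate replaces the trivial bound \<open>card L\<close> by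
  its square root. The factor \<open>chirp t x \<eta>\<close> is common to all l, which makes the
  bound uniform in x.\<close>

lemma osc2_UNIV_bound:
  assumes L: "finite L" and small: "real (card L) * exp (- (2 * pi * t * D)\<^sup>2 / 2) \<le> 1"
  shows "cmod (osc2 L D UNIV t x) \<le> 7 * \<psi>_sup * sqrt (real (card L))"
proof -
  define c where "c l = chirp t x (D * of_int l)" for l
  have ph: "cis (2 * pi * (x - t * (D * of_int l)) * \<eta> - pi * t * \<eta>\<^sup>2) = chirp t x \<eta> * cis (- (2 * pi * t * D) * of_int l * \<eta>)" for l \<eta>
    by (simp add: cis_mult algebra_simps)
  have "osc2 L D UNIV t x = (\<Sum>l\<in>L. LBINT \<eta>. \<psi> \<eta> * chirp t x \<eta> * (c l * cis (- (2 * pi * t * D) * of_int l * \<eta>)))"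
    unfolding osc2_UNIV_expand c_def[symmetric] ph integral_mult_right_zero[symmetric] by (simp only: mult_ac)
  also have "\<dots> = (LBINT \<eta>. (\<Sum>l\<in>L. \<psi> \<eta> * chirp t x \<eta> * (c l * cis (- (2 * pi * t * D) * of_int l * \<eta>))))"
  proof (rule Bochner_Integration.integral_sum[symmetric])
    show "integrable lborel (\<lambda>\<eta>. \<psi> \<eta> * chirp t x \<eta> * (c l * cis (- (2 * pi * t * D) * of_int l * \<eta>)))" for l
      by (rule Bochner_Integration.integrable_bound[OF \<psi>_integrable]) (auto simp: norm_mult c_def)
  qed
  finally have eq: "osc2 L D UNIV t x = (LBINT \<eta>. (\<Sum>l\<in>L. \<psi> \<eta> * chirp t x \<eta> * (c l * cis (- (2 * pi * t * D) * of_int l * \<eta>))))" .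
  define S where "S \<eta> = cmod (\<Sum>l\<in>L. c l * cis (- (2 * pi * t * D) * of_int l * \<eta>))" for \<eta>
  have Sm[measurable]: "S \<in> borel_measurable borel" unfolding S_def by measurable
  have Sb: "S \<eta> \<le> real (card L)" for \<eta>
    unfolding S_def by (rule order_trans[OF norm_sum]) (simp add: norm_mult c_def)
  have Si: "integrable lborel (\<lambda>\<eta>. \<psi>_sup * (indicator {-1<..<1} \<eta> * S \<eta>))"
  proof (rule Bochner_Integration.integrable_bound)
    show "integrable lborel (\<lambda>\<eta>::real. \<psi>_sup * (indicator {-1<..<1} \<eta> * real (card L)))" by simp
    have "\<bar>\<psi>_sup * (indicator {-1<..<1} \<eta> * S \<eta>)\<bar> \<le> \<bar>\<psi>_sup * (indicator {-1<..<1} \<eta> * real (card L))\<bar>" for \<eta>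
      using Sb[of \<eta>] by (simp add: abs_mult S_def mult_left_mono)
    thus "AE \<eta> in lborel. norm (\<psi>_sup * (indicator {-1<..<1} \<eta> * S \<eta>)) \<le> norm (\<psi>_sup * (indicator {-1<..<1} \<eta> * real (card L)))" by simp
  qed simp
  have "cmod (osc2 L D UNIV t x) \<le> (LBINT \<eta>. cmod (\<Sum>l\<in>L. \<psi> \<eta> * chirp t x \<eta> * (c l * cis (- (2 * pi * t * D) * of_int l * \<eta>))))"
    unfolding eq by (rule integral_norm_bound)
  also have "\<dots> \<le> (LBINT \<eta>. \<psi>_sup * (indicator {-1<..<1} \<eta> * S \<eta>))"
  proof (rule integral_mono'[OF Si])
    fix \<eta> :: real
    have "cmod (\<Sum>l\<in>L. \<psi> \<eta> * chirp t x \<eta> * (c l * cis (- (2 * pi * t * D) * of_int l * \<eta>))) = cmod (\<psi> \<eta>) * S \<eta>"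
      unfolding sum_distrib_left[symmetric] norm_mult S_def norm_cis by simp
    also have "\<dots> \<le> \<psi>_sup * (indicator {-1<..<1} \<eta> * S \<eta>)"
    proof (cases "\<eta> \<in> {-1<..<1}")
      case True
      thus ?thesis using \<psi>_le[of \<eta>] by (simp add: S_def mult_right_mono)
    next
      case False
      hence "\<psi> \<eta> = 0" by (intro \<psi>_zero) auto
      thus ?thesis using False by simp
    qed
    finally show "cmod (\<Sum>l\<in>L. \<psi> \<eta> * chirp t x \<eta> * (c l * cis (- (2 * pi * t * D) * of_int l * \<eta>))) \<le> \<psi>_sup * (indicator {-1<..<1} \<eta> * S \<eta>)" .
  qed (simp add: \<psi>_sup_nonneg S_def)
  also have "\<dots> = \<psi>_sup * (LBINT \<eta>. indicator {-1<..<1} \<eta> * S \<eta>)" by simp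
  also have "\<dots> \<le> \<psi>_sup * (7 * sqrt (real (card L)))"
    unfolding S_def using small by (intro mult_left_mono exponential_sum_L1 L \<psi>_sup_nonneg) (auto simp: c_def)
  finally show ?thesis by simp
qed

text \<open>A truncation of the frequency domain cuts through at most one of the bumps.\<close>
lemma osc2_truncated_bound:
  assumes R: "2 \<le> R" and D: "2 \<le> D"
    and small: "real (card (freqs R D)) * exp (- (2 * pi * t * D)\<^sup>2 / 2) \<le> 1"
  shows "cmod (osc2 (freqs R D) D {-M..M} t x) \<le> (7 * \<psi>_sup + \<psi>_L1) * sqrt (real (card (freqs R D)))"
proof -
  define L where "L = freqs R D"
  have L: "finite L" unfolding L_def by (rule finite_freqs)
  have L1: "1 < D * of_int l" if "l \<in> L" for l
    using freqs_bounds(1)[of l R D] that R D unfolding L_def by simp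
  \<comment> \<open>All bumps sit at frequencies above 1, so only the right end M of the window
    matters: \<open>A\<close> collects the bumps entirely to its left and \<open>E\<close> those it
    can cut. The set \<open>E\<close> lies in an open interval of length 2, and the spacing D is at
    least 2.\<close>
  define A where "A = {l\<in>L. D * of_int l \<le> M - 1}"
  define E where "E = {l\<in>L. M - 1 < D * of_int l \<and> D * of_int l < M + 1}"
  have fin: "finite A" "finite E" using L by (auto simp: A_def E_def)
  have AE: "A \<inter> E = {}" by (auto simp: A_def E_def)
  have E1: "card E \<le> 1"
  proof -
    have "l = l'" if "l \<in> E" "l' \<in> E" for l l'
    proof (rule ccontr)
      assume "l \<noteq> l'"
      hence "1 \<le> \<bar>of_int (l - l') :: real\<bar>" by linarith
      hence "2 * 1 \<le> \<bar>D * of_int (l - l')\<bar>" using D unfolding abs_mult by (intro mult_mono) auto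
      thus False using that by (auto simp: E_def algebra_simps)
    qed
    thus ?thesis using fin by (simp add: card_le_Suc0_iff_eq)
  qed
  have pt: "indicator {-M..M} \<xi> *\<^sub>R (FD2 \<psi> L D \<xi> * z) = FD2 \<psi> A D \<xi> * z + indicator {-M..M} \<xi> *\<^sub>R (FD2 \<psi> E D \<xi> * z)" for \<xi> z
  proof -
    have 1: "indicator {-M..M} \<xi> *\<^sub>R \<psi> (\<xi> - D * of_int l) = (if l \<in> A then \<psi> (\<xi> - D * of_int l) else 0) + (if l \<in> E then indicator {-M..M} \<xi> *\<^sub>R \<psi> (\<xi> - D * of_int l) else 0)" if l: "l \<in> L" for l
    proof (cases "\<psi> (\<xi> - D * of_int l) = 0")
      case False
      hence b: "\<bar>\<xi> - D * of_int l\<bar> < 1" using \<psi>_zero[of "\<xi> - D * of_int l"] by linarith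
      consider "l \<in> A" | "l \<in> E" | "M + 1 \<le> D * of_int l" using l unfolding A_def E_def by fastforce
      thus ?thesis
      proof cases
        case 1
        hence "l \<notin> E" "\<xi> \<in> {-M..M}" using AE b L1[OF l] by (auto simp: A_def)
        thus ?thesis using 1 by simp
      next
        case 2
        hence "l \<notin> A" using AE by auto
        thus ?thesis using 2 by simp
      next
        case 3
        hence "l \<notin> A" "l \<notin> E" "\<xi> \<notin> {-M..M}" using b by (auto simp: A_def E_def)
        thus ?thesis by simp
      qed
    qed simp
    have "indicator {-M..M} \<xi> *\<^sub>R FD2 \<psi> L D \<xi> = (\<Sum>l\<in>L. indicator {-M..M} \<xi> *\<^sub>R \<psi> (\<xi> - D * of_int l))"
      by (simp add: FD2_def scaleR_sum_right)
    also have "\<dots> = (\<Sum>l\<in>L. (if l \<in> A then \<psi> (\<xi> - D * of_int l) else 0) + (if l \<in> E then indicator {-M..M} \<xi> *\<^sub>R \<psi> (\<xi> - D * of_int l) else 0))"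
      by (intro sum.cong refl 1)
    also have "\<dots> = (\<Sum>l\<in>L \<inter> A. \<psi> (\<xi> - D * of_int l)) + (\<Sum>l\<in>L \<inter> E. indicator {-M..M} \<xi> *\<^sub>R \<psi> (\<xi> - D * of_int l))"
      by (simp add: sum.distrib sum.inter_restrict[OF L])
    also have "L \<inter> A = A" by (auto simp: A_def)
    also have "L \<inter> E = E" by (auto simp: E_def)
    finally have "indicator {-M..M} \<xi> *\<^sub>R FD2 \<psi> L D \<xi> = FD2 \<psi> A D \<xi> + indicator {-M..M} \<xi> *\<^sub>R FD2 \<psi> E D \<xi>"
      by (simp add: FD2_def scaleR_sum_right)
    thus ?thesis unfolding mult_scaleR_left[symmetric] by (simp only: distrib_right)
  qed
  define e where "e \<xi> = chirp t x \<xi>" for \<xi>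
  have [measurable]: "e \<in> borel_measurable borel" unfolding e_def by measurable
  have [measurable]: "FD2 \<psi> L' D \<in> borel_measurable borel" for L'
    using FD2_integrable by (simp add: borel_measurable_integrable)
  have "osc2 L D {-M..M} t x = osc2 A D UNIV t x + osc2 E D {-M..M} t x"
    unfolding osc2_def e_def[symmetric] pt
  proof (subst Bochner_Integration.integral_add)
    show "integrable lborel (\<lambda>\<xi>. FD2 \<psi> A D \<xi> * e \<xi>)"
      by (rule Bochner_Integration.integrable_bound[OF FD2_integrable[of A D]]) (auto simp: norm_mult e_def)
    show "integrable lborel (\<lambda>\<xi>. indicator {-M..M} \<xi> *\<^sub>R (FD2 \<psi> E D \<xi> * e \<xi>))"
      by (rule Bochner_Integration.integrable_bound[OF FD2_integrable[of E D]]) (auto simp: norm_mult e_def indicator_def)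
  qed simp
  hence "cmod (osc2 L D {-M..M} t x) \<le> cmod (osc2 A D UNIV t x) + cmod (osc2 E D {-M..M} t x)"
    by (simp add: norm_triangle_ineq)
  also have "\<dots> \<le> 7 * \<psi>_sup * sqrt (real (card L)) + \<psi>_L1 * sqrt (real (card L))"
  proof (rule add_mono)
    have c: "card A \<le> card L" by (rule card_mono[OF L]) (auto simp: A_def)
    have "real (card A) * exp (- (2 * pi * t * D)\<^sup>2 / 2) \<le> real (card L) * exp (- (2 * pi * t * D)\<^sup>2 / 2)"
      using c by (intro mult_right_mono) auto
    also have "\<dots> \<le> 1" using small unfolding L_def .
    finally have "cmod (osc2 A D UNIV t x) \<le> 7 * \<psi>_sup * sqrt (real (card A))"
      by (rule osc2_UNIV_bound[OF fin(1)])
    also have "\<dots> \<le> 7 * \<psi>_sup * sqrt (real (card L))" using c \<psi>_sup_nonneg by (intro mult_left_mono) auto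
    finally show "cmod (osc2 A D UNIV t x) \<le> 7 * \<psi>_sup * sqrt (real (card L))" .
    have "real (card E) \<le> sqrt (real (card L))"
    proof (cases "E = {}")
      case False
      hence "L \<noteq> {}" by (auto simp: E_def)
      hence "1 \<le> card L" using L by (simp add: card_gt_0_iff Suc_le_eq)
      hence "1 \<le> sqrt (real (card L))" by simp
      moreover have "real (card E) \<le> 1" using E1 by simp
      ultimately show ?thesis by linarith
    qed simp
    hence "real (card E) * \<psi>_L1 \<le> sqrt (real (card L)) * \<psi>_L1" using \<psi>_L1_ge_1 by (intro mult_right_mono) auto
    thus "cmod (osc2 E D {-M..M} t x) \<le> \<psi>_L1 * sqrt (real (card L))" using osc2_le[of E D "{-M..M}" t x] by (simp add: mult.commute)
  qed
  finally show ?thesis unfolding L_def by (simp add: algebra_simps)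
qed

end

section \<open>Position of the frequencies\<close>

lemma freqs_interval:
  assumes R: "0 < R" and D: "0 < D" and RD: "2 \<le> R / D"
  obtains l0 :: int where "freqs R D = {l0..<l0 + int (card (freqs R D))}"
    and "R / (2 * D) - 1 \<le> real (card (freqs R D))" and "real (card (freqs R D)) \<le> R / (2 * D) + 1"
proof -
  define u where "u = R / (2 * D)"
  have v: "R / D = 2 * u" using D by (simp add: u_def)
  have u1: "1 \<le> u" using RD v by simp
  \<comment> \<open>Both inequalities in \<open>freqs\<close> are strict: \<open>l0\<close> is the
    least integer above u, and \<open>e\<close> is the first integer that is no longer below 2
    u.\<close>
  define l0 where "l0 = \<lfloor>u\<rfloor> + 1"
  define e where "e = \<lceil>2 * u\<rceil>"
  have le: "l0 \<le> e" using u1 unfolding l0_def e_def by linarith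
  have F: "freqs R D = {l0..<e}"
    unfolding freqs_def v u_def[symmetric] l0_def e_def by (auto simp: less_ceiling_iff floor_less_iff) linarith+
  have c: "int (card (freqs R D)) = e - l0" using le by (simp add: F)
  have r: "real (card (freqs R D)) = of_int (e - l0)" by (metis c of_int_of_nat_eq)
  have "u - 1 \<le> of_int (e - l0)" "of_int (e - l0) \<le> u + 1" unfolding e_def l0_def by linarith+
  moreover have "freqs R D = {l0..<l0 + int (card (freqs R D))}" unfolding c using F by simp
  ultimately show ?thesis using that[of l0] unfolding r u_def by blast
qed

lemma integral_indicator_superset:
  fixes f :: "real \<Rightarrow> complex"
  assumes "\<And>\<xi>. f \<xi> \<noteq> 0 \<Longrightarrow> \<xi> \<in> S"
  shows "(LBINT \<xi>. indicator S \<xi> *\<^sub>R (f \<xi> * g \<xi>)) = (LBINT \<xi>. indicator UNIV \<xi> *\<^sub>R (f \<xi> * g \<xi>))"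
proof (intro Bochner_Integration.integral_cong refl)
  fix \<xi>
  show "indicator S \<xi> *\<^sub>R (f \<xi> * g \<xi>) = indicator UNIV \<xi> *\<^sub>R (f \<xi> * g \<xi>)"
    using assms[of \<xi>] by (cases "f \<xi> = 0") (simp_all add: indicator_def)
qed

lemma (in band_limited) FD1_support: "0 < R \<Longrightarrow> FD1 \<psi> R \<xi> \<noteq> 0 \<Longrightarrow> \<bar>\<xi> - R\<bar> < sqrt R"
  using \<psi>_zero[of "(\<xi> - R) / sqrt R"] by (auto simp: FD1_def abs_divide not_le[symmetric])

lemma (in band_limited) FD2_support:
  assumes "FD2 \<psi> (freqs R D) D \<xi> \<noteq> 0" "0 < D"
  shows "R / 2 - 1 < \<xi>" "\<xi> < R + 1"
proof -
  obtain l where l: "l \<in> freqs R D" "\<psi> (\<xi> - D * of_int l) \<noteq> 0"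
    using assms(1) unfolding FD2_def by (meson sum.not_neutral_contains_not_neutral)
  hence "\<bar>\<xi> - D * of_int l\<bar> < 1" using \<psi>_zero[of "\<xi> - D * of_int l"] by linarith
  thus "R / 2 - 1 < \<xi>" "\<xi> < R + 1" using freqs_bounds[OF l(1) assms(2)] by auto
qed

lemma (in band_limited) osc1_UNIV:
  assumes "0 < R" "R + sqrt R \<le> M"
  shows "osc1 R {-M..M} t x = osc1 R UNIV t x"
  unfolding osc1_def
proof (rule integral_indicator_superset)
  fix \<xi> assume "FD1 \<psi> R \<xi> \<noteq> 0"
  hence "\<bar>\<xi> - R\<bar> < sqrt R" by (rule FD1_support[OF assms(1)])
  thus "\<xi> \<in> {-M..M}" using assms by auto
qed

lemma (in band_limited) osc2_UNIV:
  assumes "0 < R" "0 < D" "R + 1 \<le> M"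
  shows "osc2 (freqs R D) D {-M..M} t x = osc2 (freqs R D) D UNIV t x"
  unfolding osc2_def
proof (rule integral_indicator_superset)
  fix \<xi> assume "FD2 \<psi> (freqs R D) D \<xi> \<noteq> 0"
  from FD2_support[OF this assms(2)] show "\<xi> \<in> {-M..M}" using assms by auto
qed

section \<open>Convergence of the solution\<close>

locale divergence = band_limited +
  fixes a b :: real and m :: nat
  assumes a: "0 < a" "a \<le> 1" and b: "0 < b" "b \<le> 1 / 2" and ab: "1 + b \<le> 2 * a" and m: "1 \<le> m"
begin

definition "n = real m + 1"
definition "s = s_exp n a b"
definition "D k = Dk n a b k"
definition "\<beta> = (n - (n - 1) * a + n * b) / (n + 1)"
text \<open>The bracket in the exponent s. It is a positive multiple of s - 1/4 and reappears as the
  gap between the exponents of R/D and Q.\<close>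

definition "\<delta> = n - (n - 1) * a - b"
definition "q_exp = (n - 1) / (n + 1) * (2 * a - b - 1)"
definition "F k = freqs (Rk k) (D k)"
definition "N k = real (card (F k))"
text \<open>The weight of f^(k) in g with the L2 norm in closed form.\<close>

definition "coef k = Rk k powr (- s) * real k / sqrt (\<phi>_sq / sqrt (Rk k) * (N k * \<phi>_sq) ^ m)"
definition "c\<phi> = sqrt (\<phi>_sq ^ (m + 1))"

lemma n_gt_1: "2 \<le> n" using m by (simp add: n_def)

lemma \<delta>_pos: "1 / 2 \<le> \<delta>"
proof -
  have "(n - 1) * a \<le> (n - 1) * 1" using n_gt_1 a by (intro mult_left_mono) auto
  thus ?thesis using b by (simp add: \<delta>_def)
qed

lemma \<beta>_pos: "0 < \<beta>"
proof -
  have "(n - 1) * a \<le> n - 1" using mult_left_mono[OF a(2), of "n - 1"] n_gt_1 by simp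
  moreover have "0 < n * b" using n_gt_1 b by simp
  ultimately have "0 < n - (n - 1) * a + n * b" by linarith
  thus ?thesis using n_gt_1 by (simp add: \<beta>_def)
qed

lemma s_eq: "s - 1 / 4 = (n - 1) / (2 * (n + 1)) * \<delta>"
  by (simp add: s_def s_exp_def \<delta>_def)

lemma s_gt: "1 / 4 < s"
proof -
  have "0 < (n - 1) / (2 * (n + 1)) * \<delta>" using n_gt_1 \<delta>_pos by (intro mult_pos_pos divide_pos_pos) auto
  thus ?thesis using s_eq by linarith
qed

text \<open>The number of lattice frequencies is of order R^(1-\<beta>). Hence Q is smaller than it
  by the power R^(\<delta>/(n+1)), which leaves room for the logarithmic error of the Gauss
  sums.\<close>

lemma q_exp_eq: "q_exp = 1 - \<beta> - \<delta> / (n + 1)"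
proof -
  have "1 - \<beta> - \<delta> / (n + 1) = ((n + 1) - (n - (n - 1) * a + n * b) - \<delta>) / (n + 1)"
  proof -
    have "(n + 1) / (n + 1) = 1" using n_gt_1 by simp
    thus ?thesis unfolding \<beta>_def diff_divide_distrib by (simp only:)
  qed
  also have "(n + 1) - (n - (n - 1) * a + n * b) - \<delta> = (n - 1) * (2 * a - b - 1)"
    by (simp add: \<delta>_def algebra_simps)
  finally show ?thesis by (simp add: q_exp_def)
qed

lemma q_exp_nonneg: "0 \<le> q_exp"
  using n_gt_1 ab by (simp add: q_exp_def)

lemma \<beta>_less_1: "\<beta> < 1"
proof -
  have "0 < \<delta> / (n + 1)" using \<delta>_pos n_gt_1 by simp
  thus ?thesis using q_exp_eq q_exp_nonneg by linarith
qed

text \<open>On a slab with denominator about Q the packet has size k R^(1/4-s) (N/Q)^(m/2), with N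
  of order R^(1-\<beta>). The identity says that the powers of R cancel; this determines s.\<close>

lemma coef_exp_balance: "1 / 4 - s + (1 - \<beta>) * (real m / 2) = q_exp * (real m / 2)"
proof -
  have "1 / 4 - s = - (\<delta> / (n + 1)) * (real m / 2)" using s_eq n_gt_1 by (simp add: n_def field_simps)
  thus ?thesis unfolding q_exp_eq left_diff_distrib by simp
qed

lemma Rk_pos: "0 < Rk k" by (simp add: Rk_def)

lemma Rk_powr: "Rk k = 2 powr real k" by (simp add: Rk_def powr_realpow)

lemma Rk_powr_powr: "Rk k powr y = 2 powr (y * real k)"
  by (simp add: Rk_powr powr_powr mult.commute)

lemma D_eq: "D k = Rk k powr \<beta>" by (simp add: D_def Dk_def \<beta>_def)

lemma D_powr: "D k = 2 powr (\<beta> * real k)" by (simp add: D_eq Rk_powr_powr)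

lemma D_pos: "0 < D k" by (simp add: D_powr)

lemma RD_powr: "Rk k / D k = 2 powr ((1 - \<beta>) * real k)"
  by (simp add: D_powr Rk_powr powr_diff[symmetric] algebra_simps)

text \<open>The last two conditions keep the frequency bands of different packets apart.\<close>
definition large :: "nat \<Rightarrow> bool" where
  "large k \<longleftrightarrow> 4 \<le> D k \<and> real k \<le> D k \<and> 4 \<le> Rk k / D k \<and> 1 \<le> k
    \<and> 2 * Rk k * sqrt (Rk k) + real m * Rk k \<le> (Rk k)\<^sup>2 / 8
    \<and> 2 * Rk k * sqrt (Rk k) + Rk k + real m * (2 * Rk k + 1) \<le> (Rk k)\<^sup>2 / 8"

lemma eventually_large: "eventually large sequentially"
proof -
  have 1: "eventually (\<lambda>k. 4 \<le> D k) sequentially" unfolding D_powr using \<beta>_pos by real_asymp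
  have 2: "eventually (\<lambda>k. real k \<le> D k) sequentially" unfolding D_powr using \<beta>_pos by real_asymp
  have 3: "eventually (\<lambda>k. 4 \<le> Rk k / D k) sequentially" unfolding RD_powr using \<beta>_less_1 by real_asymp
  have 4: "eventually (\<lambda>k. 2 * Rk k * sqrt (Rk k) + real m * Rk k \<le> (Rk k)\<^sup>2 / 8) sequentially"
    unfolding Rk_def by real_asymp
  have 5: "eventually (\<lambda>k. 2 * Rk k * sqrt (Rk k) + Rk k + real m * (2 * Rk k + 1) \<le> (Rk k)\<^sup>2 / 8) sequentially"
    unfolding Rk_def by real_asymp
  show ?thesis using 1 2 3 4 5 eventually_ge_at_top[of 1] unfolding large_def by eventually_elim auto
qed

lemma large_bounds:
  assumes "large k"
  shows "4 \<le> D k" "4 \<le> Rk k / D k" "16 \<le> Rk k"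
proof -
  show D4: "4 \<le> D k" "4 \<le> Rk k / D k" using assms by (auto simp: large_def)
  have "D k * 4 \<le> Rk k" using D4 D_pos[of k] by (simp add: field_simps)
  thus "16 \<le> Rk k" using D4 by linarith
qed

lemma N_bounds:
  assumes "large k"
  shows "Rk k / (4 * D k) \<le> N k" "N k \<le> Rk k" "1 \<le> N k"
proof -
  note l = large_bounds[OF assms]
  obtain l0 where l0: "Rk k / (2 * D k) - 1 \<le> N k" "N k \<le> Rk k / (2 * D k) + 1"
    using freqs_interval[OF Rk_pos[of k] D_pos[of k]] l unfolding N_def F_def by auto
  have e: "Rk k / (2 * D k) = Rk k / D k / 2" "Rk k / (4 * D k) = Rk k / D k / 4" by simp_all
  have "Rk k / D k \<le> Rk k / 1" using l Rk_pos[of k] by (intro divide_left_mono) auto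
  with l0 l show "Rk k / (4 * D k) \<le> N k" "N k \<le> Rk k" "1 \<le> N k" unfolding e by auto
qed

lemma c\<phi>_pos: "0 < c\<phi>" using \<phi>_sq_pos by (simp add: c\<phi>_def)

lemma coef_eq: "coef k = real k * Rk k powr (1 / 4 - s) / (c\<phi> * sqrt (N k) ^ m)"
proof -
  have N: "0 \<le> N k" by (simp add: N_def)
  have "\<phi>_sq / sqrt (Rk k) * (N k * \<phi>_sq) ^ m = (\<phi>_sq ^ (m + 1) * N k ^ m) / sqrt (Rk k)"
    by (simp add: power_mult_distrib)
  hence "sqrt (\<phi>_sq / sqrt (Rk k) * (N k * \<phi>_sq) ^ m) = c\<phi> * sqrt (N k) ^ m / sqrt (sqrt (Rk k))"
    by (simp only: real_sqrt_divide real_sqrt_mult c\<phi>_def real_sqrt_power)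
  also have "sqrt (sqrt (Rk k)) = Rk k powr (1 / 4)"
    using Rk_pos[of k] by (simp add: powr_half_sqrt[symmetric] powr_powr)
  finally have "coef k = Rk k powr (- s) * real k / (c\<phi> * sqrt (N k) ^ m / Rk k powr (1 / 4))"
    by (simp add: coef_def)
  also have "\<dots> = (Rk k powr (1 / 4) * Rk k powr (- s)) * real k / (c\<phi> * sqrt (N k) ^ m)" by (simp add: mult_ac)
  also have "Rk k powr (1 / 4) * Rk k powr (- s) = Rk k powr (1 / 4 - s)" by (simp add: powr_add[symmetric])
  finally show ?thesis by (simp add: mult.commute)
qed

lemma coef_nonneg: "0 \<le> coef k" using c\<phi>_pos by (simp add: coef_eq N_def)

lemma Rk_powr_le_1: "Rk k powr (1 / 4 - s) \<le> 1"
proof -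
  have "2 powr ((1 / 4 - s) * real k) \<le> 2 powr 0"
    using s_gt by (intro powr_mono mult_nonpos_nonneg) auto
  thus ?thesis by (simp add: Rk_powr_powr)
qed

definition packet :: "nat \<Rightarrow> real set \<Rightarrow> real \<Rightarrow> (real \<times> (real^'m::finite)) \<Rightarrow> complex" where
  "packet k S t x = complex_of_real (coef k) * (osc1 (Rk k) S t (fst x) * (\<Prod>j\<in>UNIV. osc2 (F k) (D k) S t (snd x $ j)))"

text \<open>Square-root cancellation in each of the m lattice sums exactly compensates the factor
  N^(m/2) in the L2 norm.\<close>

lemma packet_norm_le:
  fixes x :: "real \<times> (real^'m::finite)"
  assumes dim: "CARD('m) = m" and N: "0 < N k"
    and B: "\<And>j. cmod (osc2 (F k) (D k) S t (snd x $ j)) \<le> B * sqrt (N k)"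
  shows "cmod (packet k S t x) \<le> \<psi>_L1 * B ^ m / c\<phi> * (real k * Rk k powr (1 / 4 - s))"
proof -
  have "cmod (packet k S t x) = coef k * (cmod (osc1 (Rk k) S t (fst x)) * (\<Prod>j\<in>UNIV. cmod (osc2 (F k) (D k) S t (snd x $ j))))"
    by (simp add: packet_def norm_mult prod_norm coef_nonneg)
  also have "\<dots> \<le> coef k * (\<psi>_L1 * (\<Prod>j\<in>(UNIV::'m set). B * sqrt (N k)))"
    using \<psi>_L1_ge_1 B by (intro mult_left_mono mult_mono osc1_le Rk_pos prod_mono prod_nonneg coef_nonneg) auto
  also have "\<dots> = coef k * (\<psi>_L1 * (B ^ m * sqrt (N k) ^ m))" by (simp add: dim power_mult_distrib)
  also have "\<dots> = \<psi>_L1 * B ^ m / c\<phi> * (real k * Rk k powr (1 / 4 - s))"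
    using N c\<phi>_pos by (simp add: coef_eq)
  finally show ?thesis .
qed

definition "C\<^sub>2 = \<psi>_L1 * (7 * \<psi>_sup + \<psi>_L1) ^ m / c\<phi>"

text \<open>The threshold t^(-2) for D makes (t D)^2 at least D, and D is at least k for large k, so
  the exponential outweighs N, which is at most 2^k.\<close>

lemma small_exponential:
  assumes k: "large k" and t: "0 < t" and D: "1 / t\<^sup>2 \<le> D k"
  shows "N k * exp (- (2 * pi * t * D k)\<^sup>2 / 2) \<le> 1"
proof -
  have "1 \<le> t\<^sup>2 * D k" using D t by (simp add: field_simps)
  hence "1 * D k \<le> t\<^sup>2 * D k * D k" using D_pos[of k] by (intro mult_right_mono) auto
  also have "\<dots> = 1 * (t\<^sup>2 * (D k)\<^sup>2)" by (simp add: power2_eq_square)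
  also have "\<dots> \<le> (2 * pi\<^sup>2) * (t\<^sup>2 * (D k)\<^sup>2)"
  proof (intro mult_right_mono)
    have "1\<^sup>2 \<le> pi\<^sup>2" using pi_gt3 by (intro power_mono) auto
    thus "1 \<le> 2 * pi\<^sup>2" by simp
  qed simp
  also have "\<dots> = (2 * pi * t * D k)\<^sup>2 / 2" by (simp add: power_mult_distrib)
  finally have 1: "D k \<le> (2 * pi * t * D k)\<^sup>2 / 2" by simp
  have "N k \<le> Rk k" using N_bounds[OF k] by simp
  also have "Rk k = exp (real k * ln 2)" by (simp add: Rk_powr powr_def)
  also have "\<dots> \<le> exp (real k)" using ln_le_minus_one[of 2] by (simp add: mult_left_le)
  also have "\<dots> \<le> exp (D k)" using k by (simp add: large_def)
  also have "\<dots> \<le> exp ((2 * pi * t * D k)\<^sup>2 / 2)" using 1 by simp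
  finally have "N k * exp (- (2 * pi * t * D k)\<^sup>2 / 2) \<le> exp ((2 * pi * t * D k)\<^sup>2 / 2) * exp (- (2 * pi * t * D k)\<^sup>2 / 2)"
    by (intro mult_right_mono) auto
  thus ?thesis by (simp flip: exp_add)
qed

text \<open>The majorant depends neither on x nor on the truncation M; it is what justifies
  exchanging the sum over the packets with the limit over the cubes.\<close>

lemma packet_tail_bound:
  fixes x :: "real \<times> (real^'m::finite)"
  assumes dim: "CARD('m) = m" and k: "large k" and t: "0 < t" and D: "1 / t\<^sup>2 \<le> D k"
  shows "cmod (packet k {-M..M} t x) \<le> C\<^sub>2 * (real k * Rk k powr (1 / 4 - s))"
  unfolding C\<^sub>2_def
proof (rule packet_norm_le[OF dim])
  show "0 < N k" using N_bounds[OF k] by simp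
  note D4 = large_bounds[OF k]
  hence "2 \<le> Rk k" by simp
  thus "cmod (osc2 (F k) (D k) {-M..M} t (snd x $ j)) \<le> (7 * \<psi>_sup + \<psi>_L1) * sqrt (N k)" for j
    using small_exponential[OF k t D] D4 unfolding N_def F_def by (intro osc2_truncated_bound) auto
qed

lemma packet_UNIV:
  assumes "large k" "2 * Rk k \<le> M"
  shows "packet k {-M..M} t x = packet k UNIV t x"
proof -
  have R: "1 \<le> Rk k" by (simp add: Rk_def)
  have "sqrt (Rk k) \<le> Rk k" using R by (intro real_le_lsqrt) (auto simp: power2_eq_square mult_left_le)
  thus ?thesis using assms R D_pos[of k] unfolding packet_def F_def by (simp add: osc1_UNIV osc2_UNIV)
qed

text \<open>A differentiated geometric series of ratio 2^(1/4-s). Its sum \<open>C\<^sub>3\<close>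
  later bounds all dispersed packets together, uniformly in t and x.\<close>

lemma tail_summable: "summable (\<lambda>k. C\<^sub>2 * (real k * Rk k powr (1 / 4 - s)))"
proof -
  define r where "r = 2 powr (1 / 4 - s)"
  have r: "norm r < 1" using s_gt by (simp add: r_def powr_less_one)
  have "summable (\<lambda>k. real (Suc k) * r ^ k)" using geometric_deriv_sums[OF r] by (simp add: sums_iff)
  hence "summable (\<lambda>k. real (Suc k) * r ^ k * r)" by (rule summable_mult2)
  hence "summable (\<lambda>k. real (Suc k) * r ^ Suc k)" by (simp add: mult_ac)
  hence "summable (\<lambda>k. real k * r ^ k)" by (subst (asm) summable_Suc_iff)
  moreover have "Rk k powr (1 / 4 - s) = r ^ k" for k
    by (simp add: Rk_powr_powr r_def powr_powr[symmetric] powr_realpow)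
  ultimately show ?thesis by (intro summable_mult) simp
qed

definition C\<^sub>3 :: real where "C\<^sub>3 = (\<Sum>k. C\<^sub>2 * (real k * Rk k powr (1 / 4 - s)))"

lemma coef_L2norm:
  assumes dim: "CARD('m::finite) = m" and k: "large k"
  shows "Rk k powr (- s_exp (real CARD('m) + 1) a b) * real k / L2norm (fk \<phi> a b k :: real \<times> (real^'m) \<Rightarrow> complex) = coef k"
proof -
  have "L2norm (fk \<phi> a b k :: real \<times> (real^'m) \<Rightarrow> complex) = sqrt (\<phi>_sq / sqrt (Rk k) * (N k * \<phi>_sq) ^ m)"
    unfolding fk_def dim n_def[symmetric] D_def[symmetric] N_def F_def \<phi>_sq_def
    using k by (subst L2norm_fD[OF int Rk_pos _ \<phi>_le \<psi>_def \<psi>_integrable \<psi>_inversion \<psi>_zero]) (auto simp: large_def dim)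
  thus ?thesis by (simp add: coef_def s_def n_def dim)
qed

lemma ghat_eq:
  fixes \<xi> :: "real \<times> (real^'m::finite)"
  assumes dim: "CARD('m) = m" and k0: "\<And>k. k0 \<le> k \<Longrightarrow> large k"
  shows "ghat \<phi> a b k0 \<xi> = (\<Sum>k. if k0 \<le> k then complex_of_real (coef k) * FT (fD \<phi> (Rk k) (D k)) \<xi> else 0)"
  unfolding ghat_def
proof (intro arg_cong[where f = suminf] ext if_cong refl)
  fix k assume "k0 \<le> k"
  thus "complex_of_real (Rk k powr (- s_exp (real CARD('m) + 1) a b) * real k / L2norm (fk \<phi> a b k :: real \<times> (real^'m) \<Rightarrow> complex)) * FT (fk \<phi> a b k) \<xi>
    = complex_of_real (coef k) * FT (fD \<phi> (Rk k) (D k)) \<xi>"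
    unfolding coef_L2norm[OF dim k0[OF \<open>k0 \<le> k\<close>]] by (simp add: fk_def dim D_def n_def)
qed

text \<open>A cube of side M reaches only to M/2, whereas the first frequency coordinate exceeds R -
  sqrt R, which is at least R/2. So the series of \<open>ghat\<close> is a finite sum on every
  cube.\<close>

lemma FT_fD_outside_cube:
  fixes \<xi> :: "real \<times> (real^'m::finite)"
  assumes "\<xi> \<in> cubeQ M" and "M \<le> Rk k" and "large k"
  shows "FT (fD \<phi> (Rk k) (D k)) \<xi> = 0"
proof (rule ccontr)
  assume "FT (fD \<phi> (Rk k) (D k)) \<xi> \<noteq> 0"
  hence "FD1 \<psi> (Rk k) (fst \<xi>) \<noteq> 0" unfolding FT_fD[OF int Rk_pos, folded \<psi>_def] by auto
  hence 1: "\<bar>fst \<xi> - Rk k\<bar> < sqrt (Rk k)" by (rule FD1_support[OF Rk_pos])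
  have R: "4 \<le> Rk k" using large_bounds(3)[OF assms(3)] by simp
  have "sqrt (Rk k) \<le> Rk k / 2"
  proof (rule real_le_lsqrt)
    have "4 * Rk k \<le> Rk k * Rk k" using R by (intro mult_right_mono) auto
    thus "Rk k \<le> (Rk k / 2)\<^sup>2" by (simp add: power2_eq_square)
  qed (use R in auto)
  thus False using 1 assms by (auto simp: cubeQ_def)
qed

text \<open>Tannery's theorem with the side of the cube as parameter: each packet is eventually
  unaffected by the cutoff, and from k1 on the dispersive bound is a summable majorant. Below k1
  only finitely many packets remain, and no bound on them is required.\<close>

lemma schro_conv_ghat:
  fixes x :: "real \<times> (real^'m::finite)"
  assumes dim: "CARD('m) = m" and k0: "\<And>k. k0 \<le> k \<Longrightarrow> large k" and t: "0 < t"
    and k1: "k0 \<le> k1" "\<And>k. k1 \<le> k \<Longrightarrow> 1 / t\<^sup>2 \<le> D k"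
  shows "\<exists>L. schro_conv (ghat \<phi> a b k0) t x L \<and> cmod (L - (\<Sum>k\<in>{k0..<k1}. packet k UNIV t x)) \<le> C\<^sub>3"
proof -
  define P where "P k M = (if k0 \<le> k then packet k {-M/2..M/2} t x else 0)" for k M
  define P' where "P' k = (if k0 \<le> k then packet k UNIV t x else 0)" for k
  define B where "B k = C\<^sub>2 * (real k * Rk k powr (1 / 4 - s))" for k
  have half: "{-M/2..M/2} = {-(M/2)..M/2}" for M :: real by simp
  have lim: "((\<lambda>M. P k M) \<longlongrightarrow> P' k) at_top" for k
  proof (rule tendsto_eventually)
    show "eventually (\<lambda>M. P k M = P' k) at_top"
      using eventually_ge_at_top[of "4 * Rk k"]
    proof eventually_elim
      case (elim M)
      thus ?case unfolding P_def P'_def half using packet_UNIV[of k "M / 2" t x] k0[of k] by auto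
    qed
  qed
  have Pb: "norm (P k M) \<le> B k" if "k1 \<le> k" for k M
    using packet_tail_bound[OF dim _ t k1(2)[OF that], of "M / 2" x] k0[of k] that k1(1)
    unfolding P_def B_def half by simp
  \<comment> \<open>The product filter asks for the majorant only for large k; the condition k \<ge>
    k1 therefore suffices, without one on M.\<close>
  have bound: "eventually (\<lambda>(k, M). norm (P k M) \<le> B k) (at_top \<times>\<^sub>F at_top)"
    unfolding eventually_prod_filter using Pb
    by (intro exI[of _ "\<lambda>k. k1 \<le> k"] exI[of _ "\<lambda>_. True"]) (auto simp: eventually_ge_at_top)
  have Bs: "summable B" unfolding B_def by (rule tail_summable)
  have T: "summable (\<lambda>k. norm (P' k))" "((\<lambda>M. \<Sum>k. P k M) \<longlongrightarrow> suminf P') at_top"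
    using tannerys_theorem[OF lim bound Bs] by auto
  have eq: "(LINT \<xi>:cubeQ M|lborel. ghat \<phi> a b k0 \<xi> * wave t x \<xi>) = (\<Sum>k. P k M)" for M
  proof -
    obtain K where K: "M < 2 ^ K" using real_arch_pow[of 2 M] by auto
    have KM: "M \<le> Rk k" if "K \<le> k" for k
    proof -
      have "(2::real) ^ K \<le> 2 ^ k" using that by (intro power_increasing) auto
      thus ?thesis using K unfolding Rk_def by linarith
    qed
    define e where "e \<xi> = wave t x \<xi>" for \<xi>
    define I where "I k \<xi> = (if k0 \<le> k then complex_of_real (coef k) * (indicator (coord_box {-M/2..M/2}) \<xi> *\<^sub>R (FT (fD \<phi> (Rk k) (D k)) \<xi> * e \<xi>)) else 0)" for k \<xi>
    have Ii: "integrable lborel (I k)" and II: "(LBINT \<xi>. I k \<xi>) = P k M" for k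
    proof -
      have S: "{-M/2..M/2} \<in> sets borel" by simp
      note p = schro_packet_integrable[OF Rk_pos[of k] S, of "D k" t x] schro_packet[OF Rk_pos[of k] S, of "D k" t x]
      show "integrable lborel (I k)" unfolding I_def[abs_def] e_def
        by (cases "k0 \<le> k") (simp_all only: if_True if_False integrable_mult_right[OF p(1)] Bochner_Integration.integrable_zero)
      show "(LBINT \<xi>. I k \<xi>) = P k M"
        unfolding I_def P_def e_def packet_def F_def
        by (cases "k0 \<le> k") (simp_all only: if_True if_False integral_mult_right_zero p(2) Bochner_Integration.integral_zero)
    qed
    have pt: "indicator (cubeQ M) \<xi> *\<^sub>R (ghat \<phi> a b k0 \<xi> * e \<xi>) = (\<Sum>k<K. I k \<xi>)" for \<xi>
    proof (cases "\<xi> \<in> cubeQ M")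
      case True
      have "ghat \<phi> a b k0 \<xi> = (\<Sum>k. if k0 \<le> k then complex_of_real (coef k) * FT (fD \<phi> (Rk k) (D k)) \<xi> else 0)"
        by (rule ghat_eq[OF dim]) (rule k0)
      also have "\<dots> = (\<Sum>k<K. if k0 \<le> k then complex_of_real (coef k) * FT (fD \<phi> (Rk k) (D k)) \<xi> else 0)"
        by (rule suminf_finite) (use FT_fD_outside_cube[OF True KM k0] in auto)
      finally show ?thesis using True unfolding I_def cubeQ_eq_box[symmetric]
        by (simp add: sum_distrib_right if_distrib[of "\<lambda>z. z * e \<xi>"] mult.assoc cong: if_cong)
    next
      case False
      thus ?thesis unfolding I_def cubeQ_eq_box[symmetric] by (simp cong: if_cong)
    qed
    have "(LINT \<xi>:cubeQ M|lborel. ghat \<phi> a b k0 \<xi> * e \<xi>) = (\<Sum>k<K. P k M)"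
      unfolding set_lebesgue_integral_def pt by (subst Bochner_Integration.integral_sum) (simp_all only: Ii II)
    also have "\<dots> = (\<Sum>k. P k M)"
    proof (rule suminf_finite[symmetric])
      fix k assume "k \<notin> {..<K}"
      hence "I k \<xi> = 0" for \<xi>
        unfolding I_def cubeQ_eq_box[symmetric] using FT_fD_outside_cube[OF _ KM k0, of \<xi> k] by (cases "\<xi> \<in> cubeQ M") auto
      thus "P k M = 0" using II[of k] by simp
    qed simp
    finally show ?thesis unfolding e_def .
  qed
  have "schro_conv (ghat \<phi> a b k0) t x (suminf P')"
    unfolding schro_conv_def eq using T(2) .
  moreover have "cmod (suminf P' - (\<Sum>k\<in>{k0..<k1}. packet k UNIV t x)) \<le> C\<^sub>3"
  proof -
    have P's: "summable P'" using T(1) by (rule summable_norm_cancel)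
    \<comment> \<open>A cube of side 4 R_k does not cut the k-th packet, so the truncated bound
      passes to the full one.\<close>
    have P'b: "norm (P' k) \<le> B k" if "k1 \<le> k" for k
      using Pb[OF that, of "4 * Rk k"] packet_UNIV[of k "2 * Rk k" t x] k0[of k] unfolding P_def P'_def half by (auto split: if_splits)
    have "(\<Sum>k\<in>{k0..<k1}. packet k UNIV t x) = (\<Sum>k<k1. P' k)"
      unfolding P'_def by (simp add: sum.If_cases) (intro sum.cong, auto)
    hence "suminf P' - (\<Sum>k\<in>{k0..<k1}. packet k UNIV t x) = (\<Sum>k. P' (k + k1))"
      using suminf_split_initial_segment[OF P's, of k1] by simp
    also have "cmod \<dots> \<le> (\<Sum>k. B (k + k1))"
    proof -
      have s2: "summable (\<lambda>k. norm (P' (k + k1)))" by (rule summable_ignore_initial_segment[OF T(1)])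
      have "cmod (\<Sum>k. P' (k + k1)) \<le> (\<Sum>k. norm (P' (k + k1)))" by (rule summable_norm[OF s2])
      also have "\<dots> \<le> (\<Sum>k. B (k + k1))"
        by (rule suminf_le[OF _ s2 summable_ignore_initial_segment[OF Bs]]) (simp add: P'b)
      finally show ?thesis .
    qed
    also have "\<dots> \<le> suminf B"
    proof -
      have "suminf B = (\<Sum>k. B (k + k1)) + (\<Sum>k<k1. B k)" by (rule suminf_split_initial_segment[OF Bs])
      moreover have "0 \<le> B k" for k
        using \<psi>_L1_ge_1 \<psi>_sup_nonneg c\<phi>_pos by (auto simp: B_def C\<^sub>2_def)
      hence "0 \<le> (\<Sum>k<k1. B k)" by (intro sum_nonneg)
      ultimately show ?thesis by linarith
    qed
    finally show ?thesis unfolding C\<^sub>3_def B_def .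
  qed
  ultimately show ?thesis by blast
qed

end

section \<open>Lower bound for a packet on its own slab\<close>

lemma cis_lipschitz: "cmod (cis x - cis y) \<le> \<bar>x - y\<bar>"
proof -
  have 1: "cmod (cis z - 1) \<le> \<bar>z\<bar>" for z
    using iexp_approx1[of z 0] by (simp add: cis_conv_exp)
  have "cis x - cis y = cis y * (cis (x - y) - 1)" by (simp add: right_diff_distrib cis_mult)
  hence "cmod (cis x - cis y) = cmod (cis (x - y) - 1)" by (simp only: norm_mult norm_cis mult_1_left)
  thus ?thesis using 1[of "x - y"] by simp
qed

context band_limited
begin

lemma \<psi>_cis_integrable:
  assumes [measurable]: "g \<in> borel_measurable borel"
  shows "integrable lborel (\<lambda>\<eta>. \<psi> \<eta> * cis (g \<eta>))"
  by (rule Bochner_Integration.integrable_bound[OF \<psi>_integrable]) (auto simp: norm_mult)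

text \<open>The phases have to be close only on the support of \<psi>. Together with the integral 1
  of \<psi> this keeps slowly oscillating integrals close to 1.\<close>

lemma \<psi>_phase_perturbation:
  assumes g[measurable]: "g \<in> borel_measurable borel" "h \<in> borel_measurable borel"
    and e: "\<And>\<eta>. \<bar>\<eta>\<bar> < 1 \<Longrightarrow> \<bar>g \<eta> - h \<eta>\<bar> \<le> \<epsilon>"
  shows "cmod ((LBINT \<eta>. \<psi> \<eta> * cis (g \<eta>)) - (LBINT \<eta>. \<psi> \<eta> * cis (h \<eta>))) \<le> \<epsilon> * \<psi>_L1"
proof -
  have "(LBINT \<eta>. \<psi> \<eta> * cis (g \<eta>)) - (LBINT \<eta>. \<psi> \<eta> * cis (h \<eta>)) = (LBINT \<eta>. \<psi> \<eta> * cis (g \<eta>) - \<psi> \<eta> * cis (h \<eta>))"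
    by (rule Bochner_Integration.integral_diff[symmetric]) (intro \<psi>_cis_integrable g)+
  also have "cmod \<dots> \<le> (LBINT \<eta>. cmod (\<psi> \<eta> * cis (g \<eta>) - \<psi> \<eta> * cis (h \<eta>)))"
    by (rule integral_norm_bound)
  also have "\<dots> \<le> (LBINT \<eta>. \<epsilon> * cmod (\<psi> \<eta>))"
  proof (rule integral_mono')
    show "integrable lborel (\<lambda>\<eta>. \<epsilon> * cmod (\<psi> \<eta>))" using \<psi>_integrable by simp
    have e0: "0 \<le> \<epsilon>" using order_trans[OF abs_ge_zero e[of 0]] by simp
    fix \<eta>
    show "cmod (\<psi> \<eta> * cis (g \<eta>) - \<psi> \<eta> * cis (h \<eta>)) \<le> \<epsilon> * cmod (\<psi> \<eta>)"
    proof (cases "\<bar>\<eta>\<bar> < 1")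
      case True
      have "cmod (\<psi> \<eta> * cis (g \<eta>) - \<psi> \<eta> * cis (h \<eta>)) = cmod (\<psi> \<eta>) * cmod (cis (g \<eta>) - cis (h \<eta>))"
        unfolding right_diff_distrib[symmetric] by (rule norm_mult)
      also have "\<dots> \<le> cmod (\<psi> \<eta>) * \<epsilon>"
        by (intro mult_left_mono order_trans[OF cis_lipschitz e[OF True]]) simp
      finally show ?thesis by (simp add: mult.commute)
    qed (simp add: \<psi>_zero)
    show "0 \<le> \<epsilon> * cmod (\<psi> \<eta>)" using e0 by simp
  qed
  finally show ?thesis by (simp add: \<psi>_L1_def)
qed

lemma \<psi>_phase_perturbation_1:
  assumes g: "g \<in> borel_measurable borel" and e: "\<And>\<eta>. \<bar>\<eta>\<bar> < 1 \<Longrightarrow> \<bar>g \<eta>\<bar> \<le> \<epsilon>"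
  shows "cmod ((LBINT \<eta>. \<psi> \<eta> * cis (g \<eta>)) - 1) \<le> \<epsilon> * \<psi>_L1"
  using \<psi>_phase_perturbation[OF g, of "\<lambda>_. 0" \<epsilon>] e by (simp add: \<psi>_integral)

text \<open>A wave of frequency R has group velocity R and is at tR at time t. After \<xi> = R +
  sqrt R \<eta> the remaining phase is governed by sqrt R |x - tR|, which explains the slab length
  of order R^(-1/2), and by tR.\<close>

lemma osc1_lower:
  assumes R: "0 < R" and e: "2 * pi * (sqrt R * \<bar>x - t * R\<bar>) + pi * (\<bar>t\<bar> * R) \<le> \<epsilon>" and \<epsilon>: "\<epsilon> * \<psi>_L1 \<le> 1 / 2"
  shows "1 / 2 \<le> cmod (osc1 R UNIV t x)"
proof -
  define g where "g \<eta> = 2 * pi * (sqrt R * (x - t * R)) * \<eta> - pi * t * R * \<eta>\<^sup>2" for \<eta>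
  have gm[measurable]: "g \<in> borel_measurable borel" unfolding g_def by measurable
  define c where "c = cis (- pi * t * R\<^sup>2 + 2 * pi * (x * R))"
  have "osc1 R UNIV t x = \<bar>sqrt R\<bar> *\<^sub>R (LBINT \<eta>. FD1 \<psi> R (R + sqrt R * \<eta>) * chirp t x (R + sqrt R * \<eta>))"
    unfolding osc1_def indicator_UNIV scaleR_one using R by (intro lborel_integral_real_affine) simp
  also have "\<dots> = (LBINT \<eta>. c * (\<psi> \<eta> * cis (g \<eta>)))"
  proof -
    have "\<bar>sqrt R\<bar> *\<^sub>R (FD1 \<psi> R (R + sqrt R * \<eta>) * chirp t x (R + sqrt R * \<eta>)) = c * (\<psi> \<eta> * cis (g \<eta>))" for \<eta>
    proof -
      have "- pi * t * (R + sqrt R * \<eta>)\<^sup>2 + 2 * pi * (x * (R + sqrt R * \<eta>)) = (- pi * t * R\<^sup>2 + 2 * pi * (x * R)) + (2 * pi * (sqrt R * (x - t * R)) * \<eta> - pi * t * (sqrt R)\<^sup>2 * \<eta>\<^sup>2)"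
      proof -
        have "- pi * t * (R + r * \<eta>)\<^sup>2 + 2 * pi * (x * (R + r * \<eta>)) = (- pi * t * R\<^sup>2 + 2 * pi * (x * R)) + (2 * pi * (r * (x - t * R)) * \<eta> - pi * t * r\<^sup>2 * \<eta>\<^sup>2)" for r
          by (simp add: power2_eq_square algebra_simps)
        thus ?thesis .
      qed
      also have "(sqrt R)\<^sup>2 = R" using R by simp
      finally show ?thesis using R unfolding c_def g_def FD1_def
        by (simp add: cis_mult[symmetric] scaleR_conv_of_real)
    qed
    thus ?thesis by (simp only: integral_scaleR_right[symmetric])
  qed
  also have "\<dots> = c * (LBINT \<eta>. \<psi> \<eta> * cis (g \<eta>))" by simp
  finally have "cmod (osc1 R UNIV t x) = cmod (LBINT \<eta>. \<psi> \<eta> * cis (g \<eta>))" by (simp add: norm_mult c_def)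
  moreover have "cmod ((LBINT \<eta>. \<psi> \<eta> * cis (g \<eta>)) - 1) \<le> \<epsilon> * \<psi>_L1"
  proof (rule \<psi>_phase_perturbation_1[OF gm])
    fix \<eta> :: real assume \<eta>: "\<bar>\<eta>\<bar> < 1"
    have "\<bar>g \<eta>\<bar> \<le> \<bar>2 * pi * (sqrt R * (x - t * R)) * \<eta>\<bar> + \<bar>pi * t * R * \<eta>\<^sup>2\<bar>" unfolding g_def by (rule abs_triangle_ineq4)
    also have "\<dots> = (2 * pi * (sqrt R * \<bar>x - t * R\<bar>)) * \<bar>\<eta>\<bar> + (pi * (\<bar>t\<bar> * R)) * \<eta>\<^sup>2" using R by (simp add: abs_mult)
    also have "\<dots> \<le> (2 * pi * (sqrt R * \<bar>x - t * R\<bar>)) * 1 + (pi * (\<bar>t\<bar> * R)) * 1"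
    proof (intro add_mono mult_left_mono)
      show "\<eta>\<^sup>2 \<le> 1" using \<eta> by (simp add: abs_square_le_1)
    qed (use \<eta> R in auto)
    finally show "\<bar>g \<eta>\<bar> \<le> \<epsilon>" using e by simp
  qed
  ultimately show ?thesis
    using \<epsilon> norm_triangle_ineq2[of 1 "1 - (LBINT \<eta>. \<psi> \<eta> * cis (g \<eta>))"] by (simp add: norm_minus_commute)
qed

text \<open>Because t D^2 = 2 p1/q and x D is close to p/q, the chirp at the frequency D l is the
  Gauss phase (-p1 l^2 + p l)/q up to a slowly varying factor. The slab width of order 1/R is what
  keeps the error of x harmless for all frequencies D l < R.\<close>

lemma osc2_lower:
  fixes p1 p q :: int
  assumes R: "1 \<le> R" and D: "0 < D" and RD: "2 \<le> R / D"
    and q: "1 \<le> q" and gcd: "gcd p1 q = 1" and par: "odd q \<or> q mod 4 = 0 \<and> even p \<or> q mod 4 = 2 \<and> odd p"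
    and t: "t = 2 * of_int p1 / (of_int q * D\<^sup>2)" and t0: "0 \<le> t" and tR: "t * R \<le> 2 * c1"
    and x: "0 \<le> x" "x \<le> c1" and xp: "\<bar>x - of_int p / (D * of_int q)\<bar> \<le> c / (2 * R)"
    and c: "c \<le> 1 / (32 * \<psi>_L1)" and c1: "c1 \<le> 1 / (128 * \<psi>_L1)"
  shows "real (card (freqs R D)) / (2 * sqrt (of_int q)) - 6 * sqrt (of_int q * (21 + 16 * ln (of_int q))) \<le> cmod (osc2 (freqs R D) D UNIV t x)"
proof -
  define P where "P = \<psi>_L1"
  have P: "1 \<le> P" using \<psi>_L1_ge_1 by (simp add: P_def)
  have cP: "c * P \<le> 1 / 32" and c1P: "c1 * P \<le> 1 / 128" using c c1 P by (simp_all add: P_def field_simps)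
  have c10: "0 \<le> c1" using x by simp
  have c0: "0 \<le> c"
  proof -
    have "0 \<le> c / (2 * R)" using order_trans[OF abs_ge_zero xp] .
    thus ?thesis using R by (simp add: zero_le_divide_iff)
  qed
  obtain l0 where L: "freqs R D = {l0..<l0 + int (card (freqs R D))}"
    and cu: "real (card (freqs R D)) \<le> R / (2 * D) + 1"
    using freqs_interval[of R D] R D RD by auto
  define nn where "nn = card (freqs R D)"
  have nRD: "real nn \<le> R / D"
  proof -
    have "R / (2 * D) = R / D / 2" by simp
    thus ?thesis using cu RD unfolding nn_def by linarith
  qed
  define \<epsilon> where "\<epsilon> = x - of_int p / (D * of_int q)"
  have \<epsilon>: "\<bar>\<epsilon>\<bar> \<le> c / (2 * R)" using xp by (simp add: \<epsilon>_def)
  define l where "l i = l0 + int i" for i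
  have lF: "l i \<in> freqs R D" if "i < nn" for i using that by (subst L) (simp add: l_def nn_def)
  have lb: "0 \<le> D * of_int (l i)" "D * of_int (l i) \<le> R" if "i < nn" for i
    using freqs_bounds[OF lF[OF that] D] R by auto
  define g where "g i \<eta> = 2 * pi * (x - t * (D * of_int (l i))) * \<eta> - pi * t * \<eta>\<^sup>2" for i \<eta>
  have gm[measurable]: "g i \<in> borel_measurable borel" for i unfolding g_def by measurable
  define B where "B i = (LBINT \<eta>. \<psi> \<eta> * cis (g i \<eta>))" for i
  \<comment> \<open>The slow modulation: the deviation of x from the fraction, and the integral over
    the bump, which is close to 1.\<close>
  define \<beta> where "\<beta> i = cis (2 * pi * (\<epsilon> * (D * of_int (l i)))) * B i" for i
  \<comment> \<open>Coefficients after the shift l = l0 + i. The number \<open>b'\<close> has the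
    parity of p, so the parity condition survives the shift.\<close>
  define a' b' where "a' = - p1" and "b' = p - 2 * p1 * l0"
  define q' where "q' = nat q"
  have q': "int q' = q" "real q' = of_int q" "0 < q'" using q by (auto simp: q'_def)
  define \<theta> where "\<theta> = cis (2 * pi * of_int (- p1 * l0\<^sup>2 + p * l0) / of_int q)"
  have tm: "chirp t x (D * of_int (l i)) * B i = \<theta> * (qphase a' b' q' i * \<beta> i)" for i
  proof -
    have tD: "t * D\<^sup>2 = 2 * of_int p1 / of_int q" using D q by (simp add: t field_simps)
    have xD: "x * D = of_int p / of_int q + \<epsilon> * D" using D q by (simp add: \<epsilon>_def field_simps)
    have "- pi * t * (D * of_int (l i))\<^sup>2 + 2 * pi * (x * (D * of_int (l i))) = - pi * (t * D\<^sup>2) * (of_int (l i))\<^sup>2 + 2 * pi * ((x * D) * of_int (l i))"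
      by (simp add: power_mult_distrib)
    also have "\<dots> = 2 * pi * (- of_int p1 * (of_int (l i))\<^sup>2 + of_int p * of_int (l i)) / of_int q + 2 * pi * (\<epsilon> * (D * of_int (l i)))"
      unfolding tD xD by (simp add: distrib_left distrib_right right_diff_distrib diff_divide_distrib add_divide_distrib mult_ac)
    also have "- of_int p1 * (of_int (l i))\<^sup>2 + of_int p * of_int (l i) = (of_int (- p1 * l0\<^sup>2 + p * l0) + of_int (a' * (int i)\<^sup>2 + b' * int i) :: real)"
      by (simp add: l_def a'_def b'_def power2_eq_square algebra_simps)
    also have "2 * pi * (of_int (- p1 * l0\<^sup>2 + p * l0) + of_int (a' * (int i)\<^sup>2 + b' * int i)) / of_int q = 2 * pi * of_int (- p1 * l0\<^sup>2 + p * l0) / of_int q + 2 * pi * of_int (a' * (int i)\<^sup>2 + b' * int i) / real q'"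
      unfolding q'(2) distrib_left add_divide_distrib by simp
    finally show ?thesis unfolding \<theta>_def qphase_def \<beta>_def by (simp only: cis_mult[symmetric] mult_ac)
  qed
  have "osc2 (freqs R D) D UNIV t x = (\<Sum>i<nn. chirp t x (D * of_int (l i)) * B i)"
  proof -
    have "{l0..<l0 + int nn} = l ` {..<nn}"
    proof (intro equalityI subsetI)
      fix y assume "y \<in> {l0..<l0 + int nn}"
      hence "y = l (nat (y - l0))" "nat (y - l0) < nn" by (auto simp: l_def)
      thus "y \<in> l ` {..<nn}" by blast
    qed (auto simp: l_def)
    hence "freqs R D = l ` {..<nn}" using L unfolding nn_def by simp
    moreover have "inj_on l {..<nn}" by (auto simp: inj_on_def l_def)
    ultimately show ?thesis unfolding osc2_UNIV_expand B_def g_def by (simp only: sum.reindex o_def)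
  qed
  also have "\<dots> = \<theta> * (\<Sum>i<nn. qphase a' b' q' i * \<beta> i)" by (simp only: tm sum_distrib_left)
  finally have eq: "cmod (osc2 (freqs R D) D UNIV t x) = cmod (\<Sum>i<nn. qphase a' b' q' i * \<beta> i)"
    by (simp add: norm_mult \<theta>_def)
  have tc: "t \<le> 2 * c1" using mult_left_mono[OF R t0] tR by simp
  have pi4: "pi \<le> 4" using pi_less_4 by simp
  \<comment> \<open>With pi at most 4 the phase is at most 8 * 3 c1 + 4 * 2 c1, which is below 40
    c1. The defect 3/8 here and 1/8 from the deviation of x add up to the 1/2 allowed for
    \<beta>.\<close>
  have Bb: "cmod (B i - 1) \<le> 3 / 8" if i: "i < nn" for i
  proof -
    have "cmod (B i - 1) \<le> (40 * c1) * \<psi>_L1"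
      unfolding B_def
    proof (rule \<psi>_phase_perturbation_1[OF gm])
      fix \<eta> :: real assume \<eta>: "\<bar>\<eta>\<bar> < 1"
      have tl: "0 \<le> t * (D * of_int (l i))" "t * (D * of_int (l i)) \<le> 2 * c1"
        using lb[OF i] t0 mult_left_mono[OF lb(2)[OF i] t0] tR by auto
      have "\<bar>g i \<eta>\<bar> \<le> \<bar>2 * pi * (x - t * (D * of_int (l i))) * \<eta>\<bar> + \<bar>pi * t * \<eta>\<^sup>2\<bar>" unfolding g_def by (rule abs_triangle_ineq4)
      also have "\<dots> = 2 * pi * \<bar>x - t * (D * of_int (l i))\<bar> * \<bar>\<eta>\<bar> + pi * t * \<eta>\<^sup>2" using t0 by (simp add: abs_mult)
      also have "\<dots> \<le> 2 * 4 * (3 * c1) * 1 + 4 * (2 * c1) * 1"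
      proof (intro add_mono mult_mono)
        show "\<eta>\<^sup>2 \<le> 1" using \<eta> by (simp add: abs_square_le_1)
        show "\<bar>x - t * (D * of_int (l i))\<bar> \<le> 3 * c1" using tl x by linarith
      qed (use \<eta> pi4 tc t0 c10 in auto)
      finally show "\<bar>g i \<eta>\<bar> \<le> 40 * c1" using c10 by simp
    qed
    also have "\<dots> \<le> 3 / 8" using c1P unfolding P_def by linarith
    finally show ?thesis .
  qed
  have \<epsilon>l: "\<bar>2 * pi * (\<epsilon> * (D * of_int (l i)))\<bar> \<le> 1 / 8" if i: "i < nn" for i
  proof -
    have "\<bar>2 * pi * (\<epsilon> * (D * of_int (l i)))\<bar> = 2 * pi * (\<bar>\<epsilon>\<bar> * (D * of_int (l i)))" unfolding abs_mult[of "2 * pi"] abs_mult[of \<epsilon>] using lb[OF i] by simp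
    also have "\<dots> \<le> 2 * 4 * (c / (2 * R) * R)"
      using lb[OF i] \<epsilon> pi4 c0 R by (intro mult_mono) auto
    also have "\<dots> = 4 * c" using R by simp
    also have "\<dots> \<le> 4 * (c * P)" using mult_left_mono[OF P c0] by simp
    also have "\<dots> \<le> 1 / 8" using cP by simp
    finally show ?thesis .
  qed
  have "real nn / (2 * sqrt (real q')) - 6 * sqrt (real q' * (21 + 16 * ln (real q'))) \<le> cmod (\<Sum>i<nn. qphase a' b' q' i * \<beta> i)"
  proof (rule modulated_gauss_sum_lower)
    show "0 < q'" by fact
    show "coprime a' (int q')" using gcd by (simp add: a'_def q'(1) coprime_iff_gcd_eq_1)
    have "even b' \<longleftrightarrow> even p" by (simp add: b'_def)
    moreover have "odd q' \<longleftrightarrow> odd q" "q' mod 4 = 0 \<longleftrightarrow> q mod 4 = 0" "q' mod 4 = 2 \<longleftrightarrow> q mod 4 = 2"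
      unfolding q'(1)[symmetric] by presburger+
    ultimately show "odd q' \<or> q' mod 4 = 0 \<and> even b' \<or> q' mod 4 = 2 \<and> odd b'" using par by simp
  next
    fix i assume i: "i < nn"
    have "\<beta> i - 1 = cis (2 * pi * (\<epsilon> * (D * of_int (l i)))) * (B i - 1) + (cis (2 * pi * (\<epsilon> * (D * of_int (l i)))) - cis 0)"
      by (simp add: \<beta>_def algebra_simps)
    hence "cmod (\<beta> i - 1) \<le> cmod (cis (2 * pi * (\<epsilon> * (D * of_int (l i)))) * (B i - 1)) + cmod (cis (2 * pi * (\<epsilon> * (D * of_int (l i)))) - cis 0)"
      by (simp only: norm_triangle_ineq)
    also have "\<dots> \<le> cmod (B i - 1) + \<bar>2 * pi * (\<epsilon> * (D * of_int (l i))) - 0\<bar>"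
      unfolding norm_mult norm_cis mult_1_left by (intro add_left_mono cis_lipschitz)
    finally have "cmod (\<beta> i - 1) \<le> cmod (B i - 1) + \<bar>2 * pi * (\<epsilon> * (D * of_int (l i))) - 0\<bar>" .
    thus "cmod (\<beta> i - 1) \<le> 1 / 2" using Bb[OF i] \<epsilon>l[OF i] by simp
  next
    fix i assume i: "Suc i < nn"
    \<comment> \<open>In one step both factors of \<beta> move by a small multiple of D/R, and there
      are at most R/D steps.\<close>
    have ls: "D * of_int (l (Suc i)) - D * of_int (l i) = D" by (simp add: l_def algebra_simps)
    have B': "cmod (B (Suc i) - B i) \<le> (16 * (c1 * D / R)) * \<psi>_L1"
      unfolding B_def
    proof (rule \<psi>_phase_perturbation[OF gm gm])
      fix \<eta> :: real assume \<eta>: "\<bar>\<eta>\<bar> < 1"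
      have "g (Suc i) \<eta> - g i \<eta> = - (2 * pi * (t * (D * of_int (l (Suc i)) - D * of_int (l i))) * \<eta>)" by (simp add: g_def algebra_simps)
      hence "\<bar>g (Suc i) \<eta> - g i \<eta>\<bar> = 2 * pi * (t * D) * \<bar>\<eta>\<bar>" unfolding ls using t0 D by (simp add: abs_mult)
      also have "\<dots> \<le> 2 * 4 * (2 * c1 / R * D) * 1"
      proof (intro mult_mono)
        show "t \<le> 2 * c1 / R" using tR R by (simp add: field_simps)
      qed (use \<eta> pi4 t0 D c10 R in auto)
      finally show "\<bar>g (Suc i) \<eta> - g i \<eta>\<bar> \<le> 16 * (c1 * D / R)" by simp
    qed
    have Bn: "cmod (B (Suc i)) \<le> 2" using Bb[OF i] norm_triangle_ineq2[of "B (Suc i)" 1] by simp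
    define u where "u i = cis (2 * pi * (\<epsilon> * (D * of_int (l i))))" for i
    have "cmod (u (Suc i) - u i) \<le> \<bar>2 * pi * (\<epsilon> * (D * of_int (l (Suc i)))) - 2 * pi * (\<epsilon> * (D * of_int (l i)))\<bar>"
      unfolding u_def by (rule cis_lipschitz)
    also have "2 * pi * (\<epsilon> * (D * of_int (l (Suc i)))) - 2 * pi * (\<epsilon> * (D * of_int (l i))) = 2 * pi * (\<epsilon> * (D * of_int (l (Suc i)) - D * of_int (l i)))" by (simp add: algebra_simps)
    also have "\<bar>\<dots>\<bar> = 2 * pi * (\<bar>\<epsilon>\<bar> * D)" unfolding ls using D by (simp add: abs_mult)
    also have "\<dots> \<le> 2 * 4 * (c / (2 * R) * D)" using pi4 \<epsilon> D c0 R by (intro mult_mono) auto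
    finally have u': "cmod (u (Suc i) - u i) \<le> 4 * (c * D / R)" by (simp add: mult_ac)
    have "\<beta> (Suc i) - \<beta> i = (u (Suc i) - u i) * B (Suc i) + u i * (B (Suc i) - B i)"
      by (simp add: \<beta>_def u_def algebra_simps)
    hence "cmod (\<beta> (Suc i) - \<beta> i) \<le> cmod (u (Suc i) - u i) * cmod (B (Suc i)) + 1 * cmod (B (Suc i) - B i)"
      using norm_triangle_ineq[of "(u (Suc i) - u i) * B (Suc i)" "u i * (B (Suc i) - B i)"] by (simp add: norm_mult u_def)
    also have "\<dots> \<le> (4 * (c * D / R)) * 2 + 1 * (16 * (c1 * D / R) * \<psi>_L1)"
      using u' Bn B' c0 D R by (intro add_mono mult_mono) auto
    also have "\<dots> = (8 * c + 16 * (c1 * P)) * (D / R)" by (simp add: P_def algebra_simps)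
    also have "\<dots> \<le> 1 * (D / R)"
    proof (rule mult_right_mono)
      show "8 * c + 16 * (c1 * P) \<le> 1" using cP c1P mult_left_mono[OF P c0] by simp
    qed (use D R in simp)
    also have "1 * (D / R) \<le> 1 / real nn" using nRD i D R by (simp add: field_simps)
    finally show "cmod (\<beta> (Suc i) - \<beta> i) \<le> 1 / real nn" .
  qed
  thus ?thesis unfolding eq q'(2) nn_def .
qed

end

context divergence
begin

text \<open>The last condition makes the complete Gauss sums dominate the incomplete ones.\<close>
definition main_large :: "real \<Rightarrow> real \<Rightarrow> nat \<Rightarrow> bool" where
  "main_large c c1 k \<longleftrightarrow> large k \<and> c * Rk k powr (- 1 / 2) \<le> c1 / 10
     \<and> 24 * (Rk k powr q_exp * sqrt (21 + 16 * real k)) \<le> Rk k / D k / 4"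

lemma eventually_main_large:
  assumes "0 < c1"
  shows "eventually (main_large c c1) sequentially"
proof -
  have "((\<lambda>k. c * 2 powr (- 1 / 2 * real k)) \<longlonglongrightarrow> 0)"
    by real_asymp
  hence "eventually (\<lambda>k. c * 2 powr (- 1 / 2 * real k) < c1 / 10) sequentially"
    using assms by (intro order_tendstoD(2)[of _ 0]) auto
  hence 1: "eventually (\<lambda>k. c * Rk k powr (- 1 / 2) \<le> c1 / 10) sequentially"
    unfolding Rk_powr_powr by eventually_elim simp
  \<comment> \<open>The gap between the exponents of R/D and Q: a fixed positive power, which wins
    against sqrt k.\<close>
  define d where "d = \<delta> / (n + 1)"
  have d: "0 < d" using \<delta>_pos n_gt_1 by (simp add: d_def)
  have "eventually (\<lambda>k. 24 * sqrt (21 + 16 * real k) \<le> 2 powr (d * real k) / 4) sequentially"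
    using d by real_asymp
  hence 2: "eventually (\<lambda>k. 24 * (Rk k powr q_exp * sqrt (21 + 16 * real k)) \<le> Rk k / D k / 4) sequentially"
  proof eventually_elim
    case (elim k)
    have "2 powr (q_exp * real k) * (24 * sqrt (21 + 16 * real k)) \<le> 2 powr (q_exp * real k) * (2 powr (d * real k) / 4)"
      by (intro mult_left_mono elim) simp
    also have "\<dots> = 2 powr ((1 - \<beta>) * real k) / 4"
    proof -
      have "q_exp * real k + d * real k = (1 - \<beta>) * real k" by (simp add: q_exp_eq d_def algebra_simps)
      thus ?thesis by (simp add: powr_add[symmetric])
    qed
    finally show ?case unfolding RD_powr Rk_powr_powr by (simp add: mult_ac)
  qed
  show ?thesis using 1 2 eventually_large unfolding main_large_def by eventually_elim auto
qed

text \<open>Each lattice sum is at least N/(4 sqrt Q), and sqrt N is at least sqrt (R/D)/2; the two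
  constants give 4^m 2^m = 8^m, the first coordinate contributes the remaining 2, and the exponent
  balance removes all powers of R.\<close>

lemma packet_main_lower:
  fixes x :: "real \<times> (real^'m::finite)" and p1 q :: int and p :: "'m \<Rightarrow> int"
  assumes dim: "CARD('m) = m" and k: "main_large c c1 k" and adm: "admissible p1 p q" and q: "1 \<le> q" "of_int q \<le> Rk k powr q_exp"
    and t: "t = 2 * of_int p1 / (of_int q * (D k)\<^sup>2)"
    and x1: "\<bar>fst x - t * Rk k\<bar> \<le> c * Rk k powr (- 1 / 2) / 2"
    and xj: "\<And>j. \<bar>snd x $ j - of_int (p j) / (D k * of_int q)\<bar> \<le> c / (2 * Rk k)"
    and reg: "x \<in> region (c1 / 10) c1"
    and c: "0 < c" "c \<le> 1 / (32 * \<psi>_L1)" and c1: "0 < c1" "c1 \<le> 1 / (128 * \<psi>_L1)"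
  shows "c1 / 20 \<le> t * Rk k" "t * Rk k \<le> 2 * c1"
    and "real k / (2 * c\<phi> * 8 ^ m) \<le> cmod (packet k UNIV t x)"
proof -
  have lk: "large k" using k by (simp add: main_large_def)
  have r: "c1 / 10 \<le> fst x" "fst x \<le> c1" "\<And>j. 0 \<le> snd x $ j" "\<And>j. snd x $ j \<le> c1" using reg by (auto simp: region_def)
  have cc: "c * Rk k powr (- 1 / 2) \<le> c1 / 10" using k by (simp add: main_large_def)
  \<comment> \<open>Half the slab length is at most c1/20, so tR deviates from the first coordinate,
    which is at least c1/10, by no more than that. The lower bound on t ties the time scale to
    1/R.\<close>
  show tl: "c1 / 20 \<le> t * Rk k" and tu: "t * Rk k \<le> 2 * c1" using x1 r cc c1 by linarith+
  have R0: "0 < Rk k" by (rule Rk_pos)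
  have t0: "0 \<le> t"
  proof (rule ccontr)
    assume "\<not> 0 \<le> t"
    hence "t * Rk k < 0" using R0 by (simp add: mult_neg_pos)
    thus False using tl c1 by linarith
  qed
  note D4 = large_bounds[OF lk]
  have R1: "1 \<le> Rk k" by (simp add: Rk_def)
  define P where "P = \<psi>_L1"
  have P: "1 \<le> P" using \<psi>_L1_ge_1 by (simp add: P_def)
  have cP: "c * P \<le> 1 / 32" and c1P: "c1 * P \<le> 1 / 128" using c c1 P by (simp_all add: P_def field_simps)
  have pi4: "pi \<le> 4" using pi_less_4 by simp
  have o1: "1 / 2 \<le> cmod (osc1 (Rk k) UNIV t (fst x))"
  proof (rule osc1_lower[OF R0, where \<epsilon> = "4 * c + 8 * c1"])
    have "sqrt (Rk k) * \<bar>fst x - t * Rk k\<bar> \<le> sqrt (Rk k) * (c * Rk k powr (- 1 / 2) / 2)" using x1 R0 by (intro mult_left_mono) auto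
    also have "\<dots> = c / 2"
    proof -
      have "sqrt (Rk k) * Rk k powr (- 1 / 2) = 1"
        using R0 by (simp add: powr_half_sqrt[symmetric] powr_add[symmetric])
      thus ?thesis by simp
    qed
    finally have A: "sqrt (Rk k) * \<bar>fst x - t * Rk k\<bar> \<le> c / 2" .
    have "2 * pi * (sqrt (Rk k) * \<bar>fst x - t * Rk k\<bar>) \<le> 2 * 4 * (c / 2)"
      using A pi4 R0 c by (intro mult_mono) auto
    moreover have "pi * (\<bar>t\<bar> * Rk k) \<le> 4 * (2 * c1)"
      using mult_mono[OF pi4 tu] t0 R0 by simp
    ultimately show "2 * pi * (sqrt (Rk k) * \<bar>fst x - t * Rk k\<bar>) + pi * (\<bar>t\<bar> * Rk k) \<le> 4 * c + 8 * c1" by linarith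
    show "(4 * c + 8 * c1) * \<psi>_L1 \<le> 1 / 2" using cP c1P unfolding P_def by (simp add: distrib_right)
  qed
  define Q where "Q = Rk k powr q_exp"
  have Q1: "1 \<le> Q" using q by (simp add: Q_def)
  have o2: "N k / (4 * sqrt Q) \<le> cmod (osc2 (F k) (D k) UNIV t (snd x $ j))" for j
  proof -
    have gcd: "gcd p1 q = 1" and par: "odd q \<or> q mod 4 = 0 \<and> even (p j) \<or> q mod 4 = 2 \<and> odd (p j)"
      using adm by (auto simp: admissible_def)
    have 1: "N k / (2 * sqrt (of_int q)) - 6 * sqrt (of_int q * (21 + 16 * ln (of_int q))) \<le> cmod (osc2 (F k) (D k) UNIV t (snd x $ j))"
      unfolding N_def F_def
      by (rule osc2_lower[OF R1 D_pos _ q(1) gcd par t t0 tu r(3) r(4) xj c(2) c1(2)]) (use D4 in simp)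
    have "N k / (2 * sqrt Q) \<le> N k / (2 * sqrt (of_int q))"
      using q by (intro frac_le mult_left_mono) (auto simp: N_def Q_def)
    \<comment> \<open>The error of the incomplete sums takes at most half of the main term N/(2 sqrt
      Q).\<close>
    moreover have "6 * sqrt (of_int q * (21 + 16 * ln (of_int q))) \<le> N k / (4 * sqrt Q)"
    proof -
      have "ln (of_int q) \<le> ln Q" using q Q1 by (subst ln_le_cancel_iff) (auto simp: Q_def)
      also have "\<dots> = q_exp * (real k * ln 2)" by (simp add: Q_def Rk_powr_powr ln_powr)
      also have "\<dots> \<le> 1 * (real k * 1)"
      proof (intro mult_mono)
        have "0 < \<delta> / (n + 1)" using \<delta>_pos n_gt_1 by simp
        thus "q_exp \<le> 1" using q_exp_eq \<beta>_pos by linarith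
        show "ln 2 \<le> (1::real)" using ln_le_minus_one[of 2] by simp
      qed auto
      finally have lq: "ln (of_int q) \<le> real k" by simp
      have "sqrt (of_int q * (21 + 16 * ln (of_int q))) \<le> sqrt (Q * (21 + 16 * real k))"
        using q lq by (intro real_sqrt_le_mono mult_mono) (auto simp: Q_def)
      also have "\<dots> = sqrt Q * sqrt (21 + 16 * real k)" by (rule real_sqrt_mult)
      finally have "24 * (sqrt (of_int q * (21 + 16 * ln (of_int q))) * sqrt Q) \<le> 24 * ((sqrt Q * sqrt (21 + 16 * real k)) * sqrt Q)"
        using Q1 by (intro mult_left_mono mult_right_mono) auto
      also have "\<dots> = 24 * (Q * sqrt (21 + 16 * real k))" using Q1 by simp
      also have "\<dots> \<le> Rk k / D k / 4" using k by (simp add: main_large_def Q_def)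
      also have "\<dots> \<le> N k" using N_bounds(1)[OF lk] by (simp add: mult.commute)
      finally show ?thesis using Q1 by (simp add: field_simps)
    qed
    moreover have "N k / (2 * sqrt Q) = 2 * (N k / (4 * sqrt Q))" by simp
    ultimately show ?thesis using 1 by linarith
  qed
  have N1: "1 \<le> N k" using N_bounds[OF lk] by simp
  have "coef k * (1 / 2 * (\<Prod>j\<in>(UNIV::'m set). N k / (4 * sqrt Q))) \<le> coef k * (cmod (osc1 (Rk k) UNIV t (fst x)) * (\<Prod>j\<in>UNIV. cmod (osc2 (F k) (D k) UNIV t (snd x $ j))))"
    using o1 o2 N1 Q1 by (intro mult_left_mono mult_mono prod_mono prod_nonneg coef_nonneg) auto
  also have "\<dots> = cmod (packet k UNIV t x)" by (simp add: packet_def norm_mult prod_norm coef_nonneg)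
  finally have A: "coef k * (1 / 2 * (N k / (4 * sqrt Q)) ^ m) \<le> cmod (packet k UNIV t x)" by (simp add: dim)
  have "coef k * (1 / 2 * (N k / (4 * sqrt Q)) ^ m) = real k / (2 * c\<phi> * 4 ^ m) * (Rk k powr (1 / 4 - s) * (sqrt (N k) / sqrt Q) ^ m)"
  proof -
    have "(N k / (4 * sqrt Q)) ^ m = sqrt (N k) ^ m * ((sqrt (N k) / sqrt Q) ^ m / 4 ^ m)"
    proof -
      have "N k / (4 * sqrt Q) = sqrt (N k) * ((sqrt (N k) / sqrt Q) / 4)" using N1 by simp
      thus ?thesis by (simp only: power_mult_distrib power_divide)
    qed
    moreover have "sqrt (N k) ^ m \<noteq> 0" using N1 by simp
    ultimately show ?thesis unfolding coef_eq using c\<phi>_pos by simp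
  qed
  also have "\<dots> \<ge> real k / (2 * c\<phi> * 4 ^ m) * (1 / 2 ^ m)"
  proof (intro mult_left_mono)
    have "1 / 2 * (Rk k powr ((1 - \<beta>) / 2) / Rk k powr (q_exp / 2)) \<le> sqrt (N k) / sqrt Q"
    proof -
      have "Rk k / D k / 4 \<le> N k" using N_bounds(1)[OF lk] by (simp add: mult.commute)
      hence "sqrt (Rk k / D k / 4) \<le> sqrt (N k)" by (rule real_sqrt_le_mono)
      also have "sqrt (Rk k / D k / 4) = 1 / 2 * Rk k powr ((1 - \<beta>) / 2)"
        by (simp only: real_sqrt_divide real_sqrt_four RD_powr Rk_powr_powr powr_half_sqrt[symmetric] powr_ge_zero powr_powr) simp
      finally have "1 / 2 * Rk k powr ((1 - \<beta>) / 2) / sqrt Q \<le> sqrt (N k) / sqrt Q"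
        using Q1 by (intro divide_right_mono) auto
      moreover have "sqrt Q = Rk k powr (q_exp / 2)"
        using Q1 by (simp add: Q_def Rk_powr_powr powr_half_sqrt[symmetric] powr_powr)
      ultimately show ?thesis by (simp only: times_divide_eq_right)
    qed
    hence "(1 / 2 * (Rk k powr ((1 - \<beta>) / 2) / Rk k powr (q_exp / 2))) ^ m \<le> (sqrt (N k) / sqrt Q) ^ m"
      by (intro power_mono) auto
    hence "Rk k powr (1 / 4 - s) * (1 / 2 * (Rk k powr ((1 - \<beta>) / 2) / Rk k powr (q_exp / 2))) ^ m \<le> Rk k powr (1 / 4 - s) * (sqrt (N k) / sqrt Q) ^ m"
      by (intro mult_left_mono) auto
    moreover have "Rk k powr (1 / 4 - s) * (1 / 2 * (Rk k powr ((1 - \<beta>) / 2) / Rk k powr (q_exp / 2))) ^ m = 1 / 2 ^ m"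
    proof -
      have "(Rk k powr ((1 - \<beta>) / 2) / Rk k powr (q_exp / 2)) ^ m = Rk k powr ((1 - \<beta>) * (real m / 2) - q_exp * (real m / 2))"
        using R0 by (simp add: powr_diff[symmetric] powr_realpow[symmetric] powr_powr left_diff_distrib diff_divide_distrib[symmetric])
      moreover have "Rk k powr (1 / 4 - s) * Rk k powr ((1 - \<beta>) * (real m / 2) - q_exp * (real m / 2)) = 1"
      proof -
        have "1 / 4 - s + ((1 - \<beta>) * (real m / 2) - q_exp * (real m / 2)) = 0" using coef_exp_balance by linarith
        thus ?thesis using R0 by (simp only: powr_add[symmetric]) simp
      qed
      ultimately have "(1 / 2) ^ m * (Rk k powr (1 / 4 - s) * (Rk k powr ((1 - \<beta>) / 2) / Rk k powr (q_exp / 2)) ^ m) = (1 / 2) ^ m"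
        by (simp only: mult_1_right)
      thus ?thesis by (simp only: power_mult_distrib[of "1 / 2"] mult.left_commute power_one_over)
    qed
    ultimately show "1 / 2 ^ m \<le> Rk k powr (1 / 4 - s) * (sqrt (N k) / sqrt Q) ^ m" by simp
  qed (use c\<phi>_pos in auto)
  finally have "real k / (2 * c\<phi> * 4 ^ m) * (1 / 2 ^ m) \<le> cmod (packet k UNIV t x)" using A by linarith
  moreover have "(8::real) ^ m = 4 ^ m * 2 ^ m" by (simp flip: power_mult_distrib)
  ultimately show "real k / (2 * c\<phi> * 8 ^ m) \<le> cmod (packet k UNIV t x)" by (simp add: mult_ac)
qed

end

section \<open>Isolating one packet\<close>

lemma (in band_limited) FT_fD_L1:
  assumes R: "0 < R"
  shows "(\<integral>\<xi>. cmod (FT (fD \<phi> R D) \<xi>) \<partial>(lborel :: (real \<times> (real^'m::finite)) measure)) \<le> \<psi>_L1 * (real (card (freqs R D)) * \<psi>_L1) ^ CARD('m)"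
proof -
  define u where "u \<xi> = complex_of_real (cmod (FD1 \<psi> R \<xi>))" for \<xi>
  define v where "v \<xi> = complex_of_real (cmod (FD2 \<psi> (freqs R D) D \<xi>))" for \<xi>
  have ui: "integrable lborel u" and vi: "integrable lborel v"
    unfolding u_def v_def using FD1_integrable[OF R] FD2_integrable by simp_all
  have "complex_of_real (\<integral>\<xi>. cmod (FT (fD \<phi> R D) \<xi>) \<partial>(lborel :: (real \<times> (real^'m)) measure)) = (\<integral>\<xi>. u (fst \<xi>) * (\<Prod>j\<in>UNIV. v (snd \<xi> $ j)) \<partial>(lborel :: (real \<times> (real^'m)) measure))"
    unfolding integral_complex_of_real[symmetric] FT_fD[OF int R, folded \<psi>_def] u_def v_def
    by (simp add: norm_mult prod_norm[symmetric])
  also have "\<dots> = (LBINT \<xi>. u \<xi>) * (LBINT \<xi>. v \<xi>) ^ CARD('m)"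
    by (rule integral_prod_real_vec[OF ui vi])
  also have "\<dots> = complex_of_real (\<psi>_L1 * (LBINT \<xi>. cmod (FD2 \<psi> (freqs R D) D \<xi>)) ^ CARD('m))"
    unfolding u_def v_def integral_complex_of_real FD1_L1[OF R] by simp
  finally have "(\<integral>\<xi>. cmod (FT (fD \<phi> R D) \<xi>) \<partial>(lborel :: (real \<times> (real^'m)) measure)) = \<psi>_L1 * (LBINT \<xi>. cmod (FD2 \<psi> (freqs R D) D \<xi>)) ^ CARD('m)"
    using of_real_eq_iff by blast
  also have "\<dots> \<le> \<psi>_L1 * (real (card (freqs R D)) * \<psi>_L1) ^ CARD('m)"
    using \<psi>_L1_ge_1 by (intro mult_left_mono power_mono FD2_L1) auto
  finally show ?thesis .
qed

context divergence
begin

text \<open>The spatial phase is absorbed, so that time enters only through exp(-i t pi |\<xi>|^2);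
  the time frequency of the packet is then pi |\<xi>|^2.\<close>

definition spectrum :: "nat \<Rightarrow> (real \<times> (real^'m::finite)) \<Rightarrow> (real \<times> (real^'m)) \<Rightarrow> complex" where
  "spectrum k x \<xi> = complex_of_real (coef k) * (FT (fD \<phi> (Rk k) (D k)) \<xi> * cis (2 * pi * (x \<bullet> \<xi>)))"

lemma spectrum_integrable: "integrable lborel (spectrum k x)"
  using schro_packet_integrable[OF Rk_pos[of k], of UNIV "D k" 0 x]
  unfolding spectrum_def[abs_def] by (intro integrable_mult_right) (simp add: coord_box_def)

lemma spectrum_packet:
  "(LBINT \<xi>. spectrum k x \<xi> * cis (- t * (pi * (norm \<xi>)\<^sup>2))) = packet k UNIV t x"
proof -
  have "spectrum k x \<xi> * cis (- t * (pi * (norm \<xi>)\<^sup>2)) = complex_of_real (coef k) * (indicator (coord_box UNIV) \<xi> *\<^sub>R (FT (fD \<phi> (Rk k) (D k)) \<xi> * wave t x \<xi>))" for \<xi>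
  proof -
    have "wave t x \<xi> = cis (2 * pi * (x \<bullet> \<xi>)) * cis (- t * (pi * (norm \<xi>)\<^sup>2))"
      by (simp add: cis_mult mult_ac)
    thus ?thesis by (simp add: spectrum_def coord_box_def mult_ac)
  qed
  moreover have "UNIV \<in> sets (borel :: real measure)" by simp
  ultimately show ?thesis by (simp only: integral_mult_right_zero schro_packet[OF Rk_pos] packet_def F_def)
qed

definition C\<^sub>1 :: real where "C\<^sub>1 = \<psi>_L1 * \<psi>_L1 ^ m / c\<phi>"

text \<open>No cancellation is used. A power of R is affordable since it only meets the
  exponentially small errors of the filter.\<close>

lemma spectrum_L1:
  fixes x :: "real \<times> (real^'m::finite)"
  assumes dim: "CARD('m) = m" and k: "large k"
  shows "(LBINT \<xi>. cmod (spectrum k x \<xi>)) \<le> C\<^sub>1 * (real k * Rk k ^ m)"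
proof -
  have N: "1 \<le> N k" "N k \<le> Rk k" using N_bounds[OF k] by auto
  have "(LBINT \<xi>. cmod (spectrum k x \<xi>)) = coef k * (\<integral>\<xi>. cmod (FT (fD \<phi> (Rk k) (D k)) \<xi>) \<partial>(lborel :: (real \<times> (real^'m)) measure))"
    by (simp add: spectrum_def norm_mult coef_nonneg)
  also have "\<dots> \<le> coef k * (\<psi>_L1 * (N k * \<psi>_L1) ^ m)"
    using FT_fD_L1[OF Rk_pos[of k], of "D k", where ?'m = 'm] unfolding dim N_def F_def
    by (intro mult_left_mono coef_nonneg) auto
  also have "\<dots> = C\<^sub>1 * (real k * (sqrt (N k) ^ m * Rk k powr (1 / 4 - s)))"
  proof -
    have "N k ^ m = sqrt (N k) ^ m * sqrt (N k) ^ m" using N by (simp flip: power_mult_distrib)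
    moreover have "sqrt (N k) ^ m \<noteq> 0" using N by simp
    ultimately show ?thesis unfolding coef_eq C\<^sub>1_def power_mult_distrib by simp
  qed
  also have "\<dots> \<le> C\<^sub>1 * (real k * (Rk k ^ m * 1))"
  proof (intro mult_left_mono mult_mono power_mono)
    have "sqrt (N k) \<le> N k" using N by (intro real_le_lsqrt) (auto simp: power2_eq_square)
    thus "sqrt (N k) \<le> Rk k" using N by linarith
  qed (use \<psi>_L1_ge_1 c\<phi>_pos Rk_powr_le_1 Rk_pos[of k] in \<open>auto simp: N_def C\<^sub>1_def\<close>)
  finally show ?thesis by simp
qed

text \<open>The first coordinate is about R and the others range from about R/2 to R, so |\<xi>|^2
  lies between R^2 (1 + m/4) and R^2 (1 + m) up to lower-order terms; by \<open>large\<close> these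
  fit into the slack R^2/8.\<close>

lemma spectrum_support:
  fixes x :: "real \<times> (real^'m::finite)"
  assumes dim: "CARD('m) = m" and k: "large k" and nz: "spectrum k x \<xi> \<noteq> 0"
  shows "(Rk k)\<^sup>2 * (7 / 8 + real m / 4) \<le> (norm \<xi>)\<^sup>2" "(norm \<xi>)\<^sup>2 \<le> (Rk k)\<^sup>2 * (9 / 8 + real m)"
proof -
  define R where "R = Rk k"
  have R4: "4 \<le> R" using large_bounds(3)[OF k] by (simp add: R_def)
  have "FD1 \<psi> R (fst \<xi>) \<noteq> 0" and F2: "FD2 \<psi> (freqs R (D k)) (D k) (snd \<xi> $ j) \<noteq> 0" for j
    using nz unfolding spectrum_def FT_fD[OF int Rk_pos, folded \<psi>_def] R_def by auto
  hence "\<bar>fst \<xi> - R\<bar> < sqrt R" using FD1_support[of R] R4 by auto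
  hence f: "R - sqrt R \<le> fst \<xi>" "fst \<xi> \<le> R + sqrt R" by auto
  have sR: "sqrt R \<le> R" using R4 by (intro real_le_lsqrt) (auto simp: power2_eq_square)
  have g: "R / 2 - 1 \<le> snd \<xi> $ j" "snd \<xi> $ j \<le> R + 1" for j
    using FD2_support[OF F2[of j] D_pos] by auto
  have norm: "(norm \<xi>)\<^sup>2 = (fst \<xi>)\<^sup>2 + (\<Sum>j\<in>UNIV. (snd \<xi> $ j)\<^sup>2)"
    by (subst power2_norm_eq_inner) (simp add: inner_prod_def inner_vec_def power2_eq_square)
  have sq: "(sqrt R)\<^sup>2 = R" using R4 by simp
  have L1: "2 * R * sqrt R + real m * R \<le> R\<^sup>2 / 8" and L2: "2 * R * sqrt R + R + real m * (2 * R + 1) \<le> R\<^sup>2 / 8"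
    using k by (auto simp: large_def R_def)
  have "R\<^sup>2 * (7 / 8 + real m / 4) \<le> (R - sqrt R)\<^sup>2 + real m * (R / 2 - 1)\<^sup>2"
  proof -
    have "(R - sqrt R)\<^sup>2 = R\<^sup>2 - 2 * R * sqrt R + R" by (simp add: power2_diff sq)
    moreover have "real m * (R / 2 - 1)\<^sup>2 = R\<^sup>2 * (real m / 4) - real m * R + real m" by (simp add: power2_eq_square algebra_simps)
    moreover have "R\<^sup>2 * (7 / 8 + real m / 4) = R\<^sup>2 - R\<^sup>2 / 8 + R\<^sup>2 * (real m / 4)" by (simp add: algebra_simps)
    ultimately show ?thesis using L1 R4 by linarith
  qed
  also have "\<dots> \<le> (fst \<xi>)\<^sup>2 + (\<Sum>j\<in>(UNIV::'m set). (snd \<xi> $ j)\<^sup>2)"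
  proof (rule add_mono)
    show "(R - sqrt R)\<^sup>2 \<le> (fst \<xi>)\<^sup>2" using f sR by (intro power_mono) auto
    have "(\<Sum>j\<in>(UNIV::'m set). (R / 2 - 1)\<^sup>2) \<le> (\<Sum>j\<in>UNIV. (snd \<xi> $ j)\<^sup>2)" using g R4 by (intro sum_mono power_mono) auto
    thus "real m * (R / 2 - 1)\<^sup>2 \<le> (\<Sum>j\<in>UNIV. (snd \<xi> $ j)\<^sup>2)" by (simp add: dim)
  qed
  finally show "(Rk k)\<^sup>2 * (7 / 8 + real m / 4) \<le> (norm \<xi>)\<^sup>2" unfolding norm R_def .
  have "(fst \<xi>)\<^sup>2 + (\<Sum>j\<in>(UNIV::'m set). (snd \<xi> $ j)\<^sup>2) \<le> (R + sqrt R)\<^sup>2 + real m * (R + 1)\<^sup>2"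
  proof (rule add_mono)
    show "(fst \<xi>)\<^sup>2 \<le> (R + sqrt R)\<^sup>2" using f sR by (intro power_mono) auto
    have "0 \<le> snd \<xi> $ j" for j using g(1)[of j] R4 by linarith
    hence "(\<Sum>j\<in>(UNIV::'m set). (snd \<xi> $ j)\<^sup>2) \<le> (\<Sum>j\<in>(UNIV::'m set). (R + 1)\<^sup>2)" using g by (intro sum_mono power_mono) auto
    thus "(\<Sum>j\<in>UNIV. (snd \<xi> $ j)\<^sup>2) \<le> real m * (R + 1)\<^sup>2" by (simp add: dim)
  qed
  also have "\<dots> \<le> R\<^sup>2 * (9 / 8 + real m)"
  proof -
    have "(R + sqrt R)\<^sup>2 = R\<^sup>2 + 2 * R * sqrt R + R" by (simp add: power2_sum sq)
    moreover have "real m * (R + 1)\<^sup>2 = R\<^sup>2 * real m + real m * (2 * R + 1)" by (simp add: power2_eq_square algebra_simps)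
    moreover have "R\<^sup>2 * (9 / 8 + real m) = R\<^sup>2 + R\<^sup>2 / 8 + R\<^sup>2 * real m" by (simp add: algebra_simps)
    ultimately show ?thesis using L2 by linarith
  qed
  finally show "(norm \<xi>)\<^sup>2 \<le> (Rk k)\<^sup>2 * (9 / 8 + real m)" unfolding norm R_def .
qed

text \<open>Neighbouring R_k differ by the factor 2, hence the bands by 4: in units of R_k^2 the
  next lower band ends at (m + 9/8)/4 and the next higher one starts at m + 7/2.\<close>

lemma spectrum_support_other:
  fixes x :: "real \<times> (real^'m::finite)"
  assumes dim: "CARD('m) = m" and k: "large j" and jk: "j \<noteq> k" and nz: "spectrum j x \<xi> \<noteq> 0"
  shows "(norm \<xi>)\<^sup>2 \<le> (Rk k)\<^sup>2 * (real m / 4 + 3 / 8) \<or> (Rk k)\<^sup>2 * (real m + 9 / 4) \<le> (norm \<xi>)\<^sup>2"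
proof (cases "j < k")
  case True
  have "Rk j * 2 = 2 ^ Suc j" by (simp add: Rk_def)
  also have "\<dots> \<le> Rk k" unfolding Rk_def using True by (intro power_increasing) auto
  finally have "(Rk j * 2)\<^sup>2 \<le> (Rk k)\<^sup>2" using Rk_pos[of j] by (intro power_mono) auto
  hence "(Rk j)\<^sup>2 \<le> (Rk k)\<^sup>2 / 4" by (simp add: power_mult_distrib)
  hence "(Rk j)\<^sup>2 * (9 / 8 + real m) \<le> (Rk k)\<^sup>2 / 4 * (9 / 8 + real m)" by (intro mult_right_mono) auto
  also have "\<dots> \<le> (Rk k)\<^sup>2 * (real m / 4 + 3 / 8)" by (simp add: algebra_simps)
  finally show ?thesis using spectrum_support(2)[OF dim k nz] by linarith
next
  case False
  have "2 * Rk k = 2 ^ Suc k" by (simp add: Rk_def)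
  also have "\<dots> \<le> Rk j" unfolding Rk_def using False jk by (intro power_increasing) auto
  finally have "(2 * Rk k)\<^sup>2 \<le> (Rk j)\<^sup>2" using Rk_pos[of k] by (intro power_mono) auto
  hence "(2 * Rk k)\<^sup>2 * (7 / 8 + real m / 4) \<le> (Rk j)\<^sup>2 * (7 / 8 + real m / 4)" by (intro mult_right_mono) auto
  moreover have "(Rk k)\<^sup>2 * (real m + 9 / 4) \<le> (2 * Rk k)\<^sup>2 * (7 / 8 + real m / 4)" by (simp add: algebra_simps)
  ultimately show ?thesis using spectrum_support(1)[OF dim k nz] by linarith
qed

text \<open>The \<open>k\<close>-th packet is isolated from the whole solution by averaging over the time window
  \<open>{t / 2..3 * t / 2}\<close>, because the packets occupy pairwise separated bands of time frequencies.\<close>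
lemma packet_le_sup_solution:
  fixes x :: "real \<times> (real^'m::finite)"
  assumes dim: "CARD('m) = m" and k0: "\<And>j. k0 \<le> j \<Longrightarrow> large j" and k: "k0 \<le> k" "k < k1"
    and t: "0 < t" and l: "0 < l" and k1: "\<And>j. k1 \<le> j \<Longrightarrow> 4 / t\<^sup>2 \<le> D j"
    and M: "\<And>t' L. t / 2 \<le> t' \<Longrightarrow> t' \<le> 3 * t / 2 \<Longrightarrow> schro_conv (ghat \<phi> a b k0) t' x L \<Longrightarrow> cmod L \<le> M"
  defines "A \<equiv> pi * (Rk k)\<^sup>2 * (3 * real m / 4 + 11 / 8)"
  shows "cmod (packet k UNIV t x) \<le> A / (sqrt (2 * pi) * l) * (M + C\<^sub>3)
    + (2 * exp (- (pi * (Rk k)\<^sup>2 / 4 / l)\<^sup>2 / 4) + A / l * exp (- (l * (t / 2))\<^sup>2 / 4)) * (C\<^sub>1 * (real k1)\<^sup>2 * 2 ^ (m * k1))"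
proof -
  define f where "f = spectrum k x"
  define g where "g \<xi> = (\<Sum>j\<in>{k0..<k1} - {k}. spectrum j x \<xi>)" for \<xi>
  define w where "w \<xi> = pi * (norm \<xi>)\<^sup>2" for \<xi> :: "real \<times> (real^'m)"
  \<comment> \<open>In units of pi R_k^2 the own band lies between m/4 + 7/8 and m + 9/8, all others
    below m/4 + 3/8 or above m + 9/4. Thus \<alpha> is the midpoint of the lower gap and
    \<open>v\<close> half its length; \<gamma> keeps the same distance \<open>v\<close> in the upper
    gap.\<close>
  define \<alpha> where "\<alpha> = pi * (Rk k)\<^sup>2 * (real m / 4 + 5 / 8)"
  define \<gamma> where "\<gamma> = pi * (Rk k)\<^sup>2 * (real m + 2)"
  define v where "v = pi * (Rk k)\<^sup>2 / 4"
  have fi: "integrable lborel f" unfolding f_def by (rule spectrum_integrable)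
  have gi: "integrable lborel g" unfolding g_def[abs_def] by (intro Bochner_Integration.integrable_sum spectrum_integrable)
  have fg: "f \<xi> + g \<xi> = (\<Sum>j\<in>{k0..<k1}. spectrum j x \<xi>)" for \<xi>
    unfolding f_def g_def using k by (subst (2) sum.remove[of _ k]) auto
  have A: "A = \<gamma> - \<alpha>" by (simp add: A_def \<gamma>_def \<alpha>_def algebra_simps)
  have e: "\<alpha> + v = pi * ((Rk k)\<^sup>2 * (real m / 4 + 7 / 8))" "\<gamma> - v = pi * ((Rk k)\<^sup>2 * (real m + 7 / 4))"
     "\<alpha> - v = pi * ((Rk k)\<^sup>2 * (real m / 4 + 3 / 8))" "\<gamma> + v = pi * ((Rk k)\<^sup>2 * (real m + 9 / 4))"
    by (simp_all add: \<alpha>_def \<gamma>_def v_def algebra_simps)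
  have 1: "cmod (LBINT \<xi>. f \<xi> * cis (- t * w \<xi>)) \<le> (\<gamma> - \<alpha>) / (sqrt (2 * pi) * l) * (M + C\<^sub>3)
    + (2 * exp (- (v / l)\<^sup>2 / 4) + (\<gamma> - \<alpha>) / l * exp (- (l * (t / 2))\<^sup>2 / 4)) * ((LBINT \<xi>. cmod (f \<xi>)) + (LBINT \<xi>. cmod (g \<xi>)))"
  proof (rule frequency_filter[OF fi gi _ l])
    show "w \<in> borel_measurable borel" unfolding w_def by measurable
    show "0 \<le> v" "0 \<le> t / 2" using t by (auto simp: v_def)
    show "\<alpha> \<le> \<gamma>" unfolding \<alpha>_def \<gamma>_def by (intro mult_left_mono) auto
  next
    fix \<xi> assume "f \<xi> \<noteq> 0"
    hence s: "(Rk k)\<^sup>2 * (7 / 8 + real m / 4) \<le> (norm \<xi>)\<^sup>2" "(norm \<xi>)\<^sup>2 \<le> (Rk k)\<^sup>2 * (9 / 8 + real m)"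
      using spectrum_support[OF dim k0[OF k(1)]] unfolding f_def by auto
    have "(Rk k)\<^sup>2 * (9 / 8 + real m) \<le> (Rk k)\<^sup>2 * (real m + 7 / 4)" by (intro mult_left_mono) auto
    thus "\<alpha> + v \<le> w \<xi> \<and> w \<xi> \<le> \<gamma> - v" unfolding e w_def using s by (intro conjI mult_left_mono) (auto simp: add.commute)
  next
    fix \<xi> assume "g \<xi> \<noteq> 0"
    then obtain j where j: "j \<in> {k0..<k1} - {k}" "spectrum j x \<xi> \<noteq> 0"
      unfolding g_def by (meson sum.not_neutral_contains_not_neutral)
    hence "(norm \<xi>)\<^sup>2 \<le> (Rk k)\<^sup>2 * (real m / 4 + 3 / 8) \<or> (Rk k)\<^sup>2 * (real m + 9 / 4) \<le> (norm \<xi>)\<^sup>2"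
      by (intro spectrum_support_other[OF dim k0]) auto
    thus "w \<xi> \<le> \<alpha> - v \<or> \<gamma> + v \<le> w \<xi>" unfolding e w_def by auto
  next
    fix s assume s: "\<bar>s\<bar> \<le> t / 2"
    define t' where "t' = t + s"
    have t': "t / 2 \<le> t'" "t' \<le> 3 * t / 2" "0 < t'" using s t by (auto simp: t'_def)
    \<comment> \<open>Times in the window can be as small as t/2, which is why 4/t^2 is required of
      D.\<close>
    have D: "1 / t'\<^sup>2 \<le> D j" if "k1 \<le> j" for j
    proof -
      have "(t / 2)\<^sup>2 \<le> t'\<^sup>2" using t' t by (intro power_mono) auto
      hence "1 / t'\<^sup>2 \<le> 1 / (t / 2)\<^sup>2" using t t'(3) by (intro divide_left_mono) auto
      also have "\<dots> = 4 / t\<^sup>2" by (simp add: power_divide)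
      finally show ?thesis using k1[OF that] by linarith
    qed
    have "\<exists>L. schro_conv (ghat \<phi> a b k0) t' x L \<and> cmod (L - (\<Sum>j\<in>{k0..<k1}. packet j UNIV t' x)) \<le> C\<^sub>3"
      by (rule schro_conv_ghat[OF dim k0 t'(3) _ D]) (use k in auto)
    then obtain L where L: "schro_conv (ghat \<phi> a b k0) t' x L" "cmod (L - (\<Sum>j\<in>{k0..<k1}. packet j UNIV t' x)) \<le> C\<^sub>3"
      by blast
    have "(LBINT \<xi>. (f \<xi> + g \<xi>) * cis (- (t + s) * w \<xi>)) = (\<Sum>j\<in>{k0..<k1}. packet j UNIV t' x)"
    proof -
      have i: "integrable lborel (\<lambda>\<xi>. spectrum j x \<xi> * cis (- t' * (pi * (norm \<xi>)\<^sup>2)))" for j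
        by (rule Bochner_Integration.integrable_bound[OF spectrum_integrable[of j x]]) (use spectrum_integrable[of j x] in \<open>auto simp: norm_mult borel_measurable_integrable\<close>)
      show ?thesis unfolding fg w_def t'_def[symmetric] sum_distrib_right
        by (subst Bochner_Integration.integral_sum) (simp_all only: i spectrum_packet)
    qed
    moreover have "cmod (\<Sum>j\<in>{k0..<k1}. packet j UNIV t' x) \<le> M + C\<^sub>3"
      using M[OF t'(1,2) L(1)] L(2) norm_triangle_ineq4[of L "L - (\<Sum>j\<in>{k0..<k1}. packet j UNIV t' x)"] by simp
    ultimately show "cmod (LBINT \<xi>. (f \<xi> + g \<xi>) * cis (- (t + s) * w \<xi>)) \<le> M + C\<^sub>3" by simp
  qed
  have 2: "(LBINT \<xi>. f \<xi> * cis (- t * w \<xi>)) = packet k UNIV t x"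
    unfolding f_def w_def by (rule spectrum_packet)
  have 3: "(LBINT \<xi>. cmod (f \<xi>)) + (LBINT \<xi>. cmod (g \<xi>)) \<le> C\<^sub>1 * (real k1)\<^sup>2 * 2 ^ (m * k1)"
  proof -
    have i: "integrable lborel (\<lambda>\<xi>. cmod (spectrum j x \<xi>))" for j using spectrum_integrable by (rule integrable_norm)
    have "(LBINT \<xi>. cmod (g \<xi>)) \<le> (LBINT \<xi>. (\<Sum>j\<in>{k0..<k1} - {k}. cmod (spectrum j x \<xi>)))"
      unfolding g_def by (intro integral_mono' Bochner_Integration.integrable_sum i norm_sum sum_nonneg) auto
    also have "\<dots> = (\<Sum>j\<in>{k0..<k1} - {k}. LBINT \<xi>. cmod (spectrum j x \<xi>))"
      by (rule Bochner_Integration.integral_sum) (rule i)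
    finally have "(LBINT \<xi>. cmod (f \<xi>)) + (LBINT \<xi>. cmod (g \<xi>)) \<le> (\<Sum>j\<in>{k0..<k1}. LBINT \<xi>. cmod (spectrum j x \<xi>))"
      unfolding f_def using k by (subst sum.remove[of _ k]) auto
    also have "\<dots> \<le> (\<Sum>j\<in>{k0..<k1}. C\<^sub>1 * (real k1 * 2 ^ (m * k1)))"
    proof (rule sum_mono)
      fix j assume j: "j \<in> {k0..<k1}"
      have "(LBINT \<xi>. cmod (spectrum j x \<xi>)) \<le> C\<^sub>1 * (real j * Rk j ^ m)" using j by (intro spectrum_L1[OF dim k0]) auto
      also have "Rk j ^ m = 2 ^ (m * j)" by (simp add: Rk_def power_mult[symmetric] mult.commute)
      also have "C\<^sub>1 * (real j * 2 ^ (m * j)) \<le> C\<^sub>1 * (real k1 * 2 ^ (m * k1))"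
        using j \<psi>_L1_ge_1 c\<phi>_pos by (intro mult_left_mono mult_mono power_increasing) (auto simp: C\<^sub>1_def)
      finally show "(LBINT \<xi>. cmod (spectrum j x \<xi>)) \<le> C\<^sub>1 * (real k1 * 2 ^ (m * k1))" .
    qed
    also have "\<dots> = real (k1 - k0) * (C\<^sub>1 * (real k1 * 2 ^ (m * k1)))" by simp
    also have "\<dots> \<le> real k1 * (C\<^sub>1 * (real k1 * 2 ^ (m * k1)))"
      using \<psi>_L1_ge_1 c\<phi>_pos by (intro mult_right_mono) (auto simp: C\<^sub>1_def)
    finally show ?thesis by (simp add: power2_eq_square mult_ac)
  qed
  have "0 \<le> 2 * exp (- (v / l)\<^sup>2 / 4) + A / l * exp (- (l * (t / 2))\<^sup>2 / 4)" using l by (simp add: A_def)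
  from mult_left_mono[OF 3 this] show ?thesis using 1 unfolding 2 A[symmetric] v_def by linarith
qed

text \<open>The time of the slab itself need not be a witness, since other packets may cancel the
  k-th one there; some time in the window around it must be one. The argument is therefore by
  contradiction, and as the limit exists at every positive time, the negation bounds the solution on
  the whole window.\<close>

lemma divergence_at_point:
  fixes x :: "real \<times> (real^'m::finite)"
  assumes dim: "CARD('m) = m" and k0: "\<And>k. k0 \<le> k \<Longrightarrow> main_large c c1 k"
    and c: "0 < c" "c \<le> 1 / (32 * \<psi>_L1)" and c1: "0 < c1" "c1 \<le> 1 / (128 * \<psi>_L1)"
    and x: "x \<in> divset c a b k0" and reg: "x \<in> region (c1 / 10) c1" and \<epsilon>: "0 < \<epsilon>"
  shows "\<exists>t L. 0 < t \<and> t < \<epsilon> \<and> schro_conv (ghat \<phi> a b k0) t x L \<and> M < norm L"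
proof (rule ccontr)
  assume "\<not> ?thesis"
  hence bounded: "cmod L \<le> M" if "0 < t" "t < \<epsilon>" "schro_conv (ghat \<phi> a b k0) t x L" for t L
    using that by force
  have large: "large k" if "k0 \<le> k" for k using k0[OF that] by (simp add: main_large_def)
  \<comment> \<open>Chosen so that exp(-C k/8) cancels 2^(m k1) for k1 up to 4k/\<beta> and leaves
    exp(-k) against the polynomial factors.\<close>
  define C where "C = 8 * (4 * real m / \<beta> * ln 2 + 1)"
  define B where "B = pi * (3 * real m / 4 + 11 / 8)"
  define G where "G = 1 / (2 * c\<phi> * 8 ^ m)"
  define E where "E = C\<^sub>1 * (4 / \<beta>)\<^sup>2"
  have C0: "0 < C" using \<beta>_pos by (simp add: C_def add_nonneg_pos)
  have G0: "0 < G" using c\<phi>_pos by (simp add: G_def)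
  have B0: "0 < B" unfolding B_def by (intro mult_pos_pos) auto
  have "eventually (\<lambda>k. 3 * c1 / 2 ^ k < \<epsilon>) sequentially" using \<epsilon> by real_asymp
  moreover have "eventually (\<lambda>k. 1600 / c1\<^sup>2 \<le> 2 ^ k) sequentially" by real_asymp
  moreover have "eventually (\<lambda>k. C * real k / 8 \<le> c1\<^sup>2 * (2 ^ k)\<^sup>2 / (6400 * (C * real k))) sequentially"
    using C0 c1(1) by real_asymp
  moreover have "eventually (\<lambda>k. (2 + B * sqrt (C * real k)) * (E * (real k)\<^sup>2 * exp (- real k)) \<le> 1) sequentially"
  proof -
    have "((\<lambda>k. (2 + B * sqrt (C * real k)) * (E * (real k)\<^sup>2 * exp (- real k))) \<longlonglongrightarrow> 0)" using C0 by real_asymp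
    hence "eventually (\<lambda>k. (2 + B * sqrt (C * real k)) * (E * (real k)\<^sup>2 * exp (- real k)) < 1) sequentially"
      by (rule order_tendstoD) simp
    thus ?thesis by eventually_elim simp
  qed
  moreover have "eventually (\<lambda>k. B * sqrt (C * real k) / sqrt (2 * pi) * (M + C\<^sub>3) + 1 < G * real k) sequentially"
  proof -
    have "((\<lambda>k. B * sqrt C / sqrt (2 * pi) * (M + C\<^sub>3) * (sqrt (real k) / real k) + 1 / real k) \<longlonglongrightarrow> B * sqrt C / sqrt (2 * pi) * (M + C\<^sub>3) * 0 + 0)"
      by (intro tendsto_add tendsto_mult tendsto_const; real_asymp)
    hence "((\<lambda>k. (B * sqrt (C * real k) / sqrt (2 * pi) * (M + C\<^sub>3) + 1) / real k) \<longlonglongrightarrow> 0)"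
      by (simp add: real_sqrt_mult add_divide_distrib mult_ac)
    hence "eventually (\<lambda>k. (B * sqrt (C * real k) / sqrt (2 * pi) * (M + C\<^sub>3) + 1) / real k < G) sequentially"
      using G0 by (rule order_tendstoD)
    thus ?thesis using eventually_gt_at_top[of 0] by eventually_elim (simp add: field_simps)
  qed
  ultimately have "eventually (\<lambda>k. 3 * c1 / 2 ^ k < \<epsilon> \<and> 1600 / c1\<^sup>2 \<le> 2 ^ k \<and> C * real k / 8 \<le> c1\<^sup>2 * (2 ^ k)\<^sup>2 / (6400 * (C * real k))
      \<and> (2 + B * sqrt (C * real k)) * (E * (real k)\<^sup>2 * exp (- real k)) \<le> 1
      \<and> B * sqrt (C * real k) / sqrt (2 * pi) * (M + C\<^sub>3) + 1 < G * real k) sequentially"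
    by eventually_elim blast
  then obtain K where K: "\<And>k. K \<le> k \<Longrightarrow> 3 * c1 / 2 ^ k < \<epsilon> \<and> 1600 / c1\<^sup>2 \<le> 2 ^ k \<and> C * real k / 8 \<le> c1\<^sup>2 * (2 ^ k)\<^sup>2 / (6400 * (C * real k))
      \<and> (2 + B * sqrt (C * real k)) * (E * (real k)\<^sup>2 * exp (- real k)) \<le> 1
      \<and> B * sqrt (C * real k) / sqrt (2 * pi) * (M + C\<^sub>3) + 1 < G * real k"
    unfolding eventually_sequentially by blast
  obtain k where kk: "K \<le> k" "k0 \<le> k"
    and xF: "x \<in> Fset c (Rk k) (Dk (real CARD('m) + 1) a b k) (Qk (real CARD('m) + 1) a b k)"
    using x unfolding divset_def by (auto dest!: spec[of _ K])
  note k = K[OF kk(1), folded Rk_def]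
  have mk: "main_large c c1 k" by (rule k0[OF kk(2)])
  have k1': "1 \<le> k" "1 \<le> real k" using large[OF kk(2)] by (auto simp: large_def)
  have R0: "0 < Rk k" by (rule Rk_pos)
  obtain p1 p q where adm: "admissible p1 p q" and q: "1 \<le> q" "of_int q \<le> Rk k powr q_exp"
    and x1: "\<bar>fst x - 2 * of_int p1 * Rk k / (of_int q * (D k)\<^sup>2)\<bar> \<le> c * Rk k powr (- 1 / 2) / 2"
    and xj: "\<And>j. \<bar>snd x $ j - of_int (p j) / (D k * of_int q)\<bar> \<le> c * Rk k powr (- 1) / 2"
    using xF unfolding Fset_def dim n_def[symmetric] D_def[symmetric] Qk_def q_exp_def[symmetric] by auto
  define t where "t = 2 * of_int p1 / (of_int q * (D k)\<^sup>2)"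
  have x1': "\<bar>fst x - t * Rk k\<bar> \<le> c * Rk k powr (- 1 / 2) / 2" using x1 by (simp add: t_def)
  have xj': "\<bar>snd x $ j - of_int (p j) / (D k * of_int q)\<bar> \<le> c / (2 * Rk k)" for j
    using xj[of j] R0 by (simp add: powr_minus_divide)
  note main = packet_main_lower[OF dim mk adm q t_def x1' xj' reg c c1]
  have t0: "0 < t"
  proof (rule ccontr)
    assume "\<not> 0 < t"
    hence "t * Rk k \<le> 0" using R0 by (simp add: mult_nonpos_nonneg)
    thus False using main(1) c1 by linarith
  qed
  have t_lower: "c1 / 20 / Rk k \<le> t" using main(1) R0 by (simp add: field_simps)
  have t_upper: "3 * t / 2 < \<epsilon>"
  proof -
    have "t \<le> 2 * c1 / Rk k" using main(2) R0 by (simp add: field_simps)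
    hence "3 * t / 2 \<le> 3 * c1 / Rk k" by simp
    thus ?thesis using k by linarith
  qed
  \<comment> \<open>As t is at least c1/(20 R_k), 4/t^2 is at most a constant times R_k^2, hence at
    most R_k^3 = 2^(3k) for large k; and D_j = 2^(\<beta> j) reaches this from j = 3k/\<beta>
    on.\<close>
  define k1 where "k1 = nat \<lceil>3 * real k / \<beta>\<rceil>"
  have k1_lower: "3 * real k / \<beta> \<le> real k1" unfolding k1_def by (rule real_nat_ceiling_ge)
  have k1_upper: "real k1 \<le> 4 * real k / \<beta>"
  proof -
    have "0 \<le> 3 * real k / \<beta>" using \<beta>_pos by simp
    hence "real k1 \<le> 3 * real k / \<beta> + 1" unfolding k1_def by linarith
    also have "1 \<le> real k / \<beta>" using k1' \<beta>_pos \<beta>_less_1 by simp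
    finally show ?thesis by (simp add: add_divide_distrib[symmetric])
  qed
  have "real k < 3 * real k" using k1' by simp
  also have "\<dots> \<le> 3 * real k / \<beta>" using \<beta>_pos \<beta>_less_1 k1' by (simp add: field_simps mult_left_le)
  finally have kk1: "k < k1" using k1_lower by linarith
  have D: "4 / t\<^sup>2 \<le> D j" if "k1 \<le> j" for j
  proof -
    have "(c1 / 20 / Rk k)\<^sup>2 \<le> t\<^sup>2" using t_lower c1 R0 by (intro power_mono) auto
    hence "4 / t\<^sup>2 \<le> 4 / (c1 / 20 / Rk k)\<^sup>2" using c1 R0 t0 by (intro divide_left_mono) auto
    also have "\<dots> = 1600 / c1\<^sup>2 * (Rk k)\<^sup>2" by (simp add: power_divide)
    also have "\<dots> \<le> Rk k * (Rk k)\<^sup>2" using k by (intro mult_right_mono) auto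
    also have "\<dots> = 2 powr (3 * real k)"
      by (simp add: Rk_powr power2_eq_square powr_add[symmetric])
    also have "\<dots> \<le> 2 powr (\<beta> * real j)"
    proof (intro powr_mono)
      have "3 * real k / \<beta> \<le> real j" using k1_lower that by linarith
      thus "3 * real k \<le> \<beta> * real j" using \<beta>_pos by (simp add: field_simps)
    qed simp
    finally show ?thesis by (simp add: D_powr)
  qed
  \<comment> \<open>The largest width, up to constants, whose leakage across the gaps is still
    exponentially small in k; the L1 norm of the kernel is then of order sqrt k.\<close>
  define l where "l = (Rk k)\<^sup>2 / sqrt (C * real k)"
  have Ck: "0 < C * real k" using C0 k1' by simp
  have l0: "0 < l" using R0 Ck by (simp add: l_def)
  have Al: "pi * (Rk k)\<^sup>2 * (3 * real m / 4 + 11 / 8) / l = B * sqrt (C * real k)"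
    using R0 Ck by (simp add: l_def B_def)
  have e1: "exp (- (pi * (Rk k)\<^sup>2 / 4 / l)\<^sup>2 / 4) \<le> exp (- (C * real k / 8))"
  proof -
    have "(pi * (Rk k)\<^sup>2 / 4 / l)\<^sup>2 / 4 = pi\<^sup>2 * (C * real k) / 64"
      using R0 Ck by (simp add: l_def power_divide power_mult_distrib)
    moreover have "8 * (C * real k) \<le> pi\<^sup>2 * (C * real k)"
    proof (rule mult_right_mono)
      have "3\<^sup>2 \<le> pi\<^sup>2" using pi_gt3 by (intro power_mono) auto
      thus "8 \<le> pi\<^sup>2" by simp
    qed (use Ck in simp)
    ultimately show ?thesis by simp
  qed
  \<comment> \<open>Here l t is of order R_k/sqrt k, so the true decay is far stronger; it is
    weakened to match the other error term.\<close>
  have e2: "exp (- (l * (t / 2))\<^sup>2 / 4) \<le> exp (- (C * real k / 8))"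
  proof -
    have "l * (c1 / 40 / Rk k) \<le> l * (t / 2)" using t_lower l0 by (intro mult_left_mono) auto
    hence "(l * (c1 / 40 / Rk k))\<^sup>2 \<le> (l * (t / 2))\<^sup>2" using l0 c1 R0 by (intro power_mono) auto
    moreover have "(l * (c1 / 40 / Rk k))\<^sup>2 = c1\<^sup>2 * (Rk k)\<^sup>2 / (1600 * (C * real k))"
    proof -
      have "l * (c1 / 40 / Rk k) = c1 * Rk k / (40 * sqrt (C * real k))"
        using R0 by (simp add: l_def power2_eq_square mult_ac)
      thus ?thesis using Ck by (simp add: power_divide power_mult_distrib)
    qed
    ultimately show ?thesis using k by simp
  qed
  have pow: "C\<^sub>1 * (real k1)\<^sup>2 * 2 ^ (m * k1) \<le> E * (real k)\<^sup>2 * exp (4 * real m / \<beta> * ln 2 * real k)"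
  proof -
    have "(2::real) ^ (m * k1) = exp (real m * real k1 * ln 2)" by (simp add: powr_realpow[symmetric] powr_def)
    also have "\<dots> \<le> exp (real m * (4 * real k / \<beta>) * ln 2)"
      unfolding exp_le_cancel_iff by (intro mult_right_mono mult_left_mono k1_upper) auto
    also have "real m * (4 * real k / \<beta>) * ln 2 = 4 * real m / \<beta> * ln 2 * real k" by simp
    finally have 1: "(2::real) ^ (m * k1) \<le> exp (4 * real m / \<beta> * ln 2 * real k)" .
    have "(real k1)\<^sup>2 \<le> (4 * real k / \<beta>)\<^sup>2" using k1_upper by (intro power_mono) auto
    also have "\<dots> = (4 / \<beta>)\<^sup>2 * (real k)\<^sup>2" by (simp add: power_mult_distrib power_divide)
    finally have 2: "C\<^sub>1 * (real k1)\<^sup>2 \<le> E * (real k)\<^sup>2"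
      unfolding E_def mult.assoc using \<psi>_L1_ge_1 c\<phi>_pos by (intro mult_left_mono) (auto simp: C\<^sub>1_def)
    show ?thesis using \<psi>_L1_ge_1 c\<phi>_pos by (intro mult_mono[OF 2 1]) (auto simp: E_def C\<^sub>1_def)
  qed
  have "cmod (packet k UNIV t x) \<le> pi * (Rk k)\<^sup>2 * (3 * real m / 4 + 11 / 8) / (sqrt (2 * pi) * l) * (M + C\<^sub>3)
    + (2 * exp (- (pi * (Rk k)\<^sup>2 / 4 / l)\<^sup>2 / 4) + pi * (Rk k)\<^sup>2 * (3 * real m / 4 + 11 / 8) / l * exp (- (l * (t / 2))\<^sup>2 / 4)) * (C\<^sub>1 * (real k1)\<^sup>2 * 2 ^ (m * k1))"
  proof (rule packet_le_sup_solution[OF dim large kk(2) kk1 t0 l0 D])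
    fix t' L assume "t / 2 \<le> t'" "t' \<le> 3 * t / 2" "schro_conv (ghat \<phi> a b k0) t' x L"
    thus "cmod L \<le> M" using t0 t_upper by (intro bounded[of t']) auto
  qed
  also have "\<dots> \<le> B * sqrt (C * real k) / sqrt (2 * pi) * (M + C\<^sub>3) + 1"
  proof (rule add_mono)
    have "pi * (Rk k)\<^sup>2 * (3 * real m / 4 + 11 / 8) / (sqrt (2 * pi) * l) = pi * (Rk k)\<^sup>2 * (3 * real m / 4 + 11 / 8) / l / sqrt (2 * pi)"
      by simp
    thus "pi * (Rk k)\<^sup>2 * (3 * real m / 4 + 11 / 8) / (sqrt (2 * pi) * l) * (M + C\<^sub>3) \<le> B * sqrt (C * real k) / sqrt (2 * pi) * (M + C\<^sub>3)"
      unfolding Al by simp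
    have "(2 * exp (- (pi * (Rk k)\<^sup>2 / 4 / l)\<^sup>2 / 4) + B * sqrt (C * real k) * exp (- (l * (t / 2))\<^sup>2 / 4)) * (C\<^sub>1 * (real k1)\<^sup>2 * 2 ^ (m * k1))
      \<le> (2 * exp (- (C * real k / 8)) + B * sqrt (C * real k) * exp (- (C * real k / 8))) * (E * (real k)\<^sup>2 * exp (4 * real m / \<beta> * ln 2 * real k))"
      using e1 e2 B0 Ck \<psi>_L1_ge_1 c\<phi>_pos
      by (intro mult_mono[OF _ pow] add_mono mult_left_mono add_nonneg_nonneg mult_nonneg_nonneg) (auto simp: C\<^sub>1_def)
    also have "\<dots> = (2 + B * sqrt (C * real k)) * (E * (real k)\<^sup>2 * (exp (- (C * real k / 8)) * exp (4 * real m / \<beta> * ln 2 * real k)))"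
      by (simp add: algebra_simps)
    also have "exp (- (C * real k / 8)) * exp (4 * real m / \<beta> * ln 2 * real k) = exp (- real k)"
    proof -
      have "- (C * real k / 8) + 4 * real m / \<beta> * ln 2 * real k = - real k"
      proof -
        have "8 * (z + 1) * real k / 8 = z * real k + real k" for z :: real by (simp add: distrib_right)
        thus ?thesis unfolding C_def by (simp only:)
      qed
      thus ?thesis by (simp only: exp_add[symmetric])
    qed
    also have "(2 + B * sqrt (C * real k)) * (E * (real k)\<^sup>2 * exp (- real k)) \<le> 1" using k by blast
    finally show "(2 * exp (- (pi * (Rk k)\<^sup>2 / 4 / l)\<^sup>2 / 4) + pi * (Rk k)\<^sup>2 * (3 * real m / 4 + 11 / 8) / l * exp (- (l * (t / 2))\<^sup>2 / 4)) * (C\<^sub>1 * (real k1)\<^sup>2 * 2 ^ (m * k1)) \<le> 1"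
      unfolding Al .
  qed
  also have "\<dots> < G * real k" using k by blast
  also have "G * real k = real k / (2 * c\<phi> * 8 ^ m)" by (simp add: G_def)
  finally show False using main(3) by linarith
qed

end

text \<open>Covering by empty sets costs nothing for every real \<gamma>, as
  \<open>0 powr \<gamma>\<close> is 0 even for \<gamma> \<le> 0.\<close>

lemma hausdorff_measure_empty: "hausdorff_measure \<gamma> {} = 0"
proof -
  have "(INF U\<in>{U::nat \<Rightarrow> 'a set. {} \<subseteq> (\<Union>i. U i) \<and> (\<forall>i. bounded (U i) \<and> diameter (U i) \<le> \<delta>)}. (\<Sum>i. ennreal (diameter (U i) powr \<gamma>))) = 0"
    if "\<delta> \<in> {0<..}" for \<delta> :: real
  proof -
    have "(INF U\<in>{U::nat \<Rightarrow> 'a set. {} \<subseteq> (\<Union>i. U i) \<and> (\<forall>i. bounded (U i) \<and> diameter (U i) \<le> \<delta>)}. (\<Sum>i. ennreal (diameter (U i) powr \<gamma>)))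
      \<le> (\<Sum>i::nat. ennreal (diameter ({} :: 'a set) powr \<gamma>))"
      using that by (intro INF_lower2[of "\<lambda>_. {}"]) auto
    thus ?thesis by (simp add: le_zero_eq)
  qed
  hence "hausdorff_measure \<gamma> ({} :: 'a set) = (SUP \<delta>\<in>{0<..} :: real set. 0)"
    unfolding hausdorff_measure_def by (rule SUP_cong[OF refl])
  thus ?thesis by simp
qed

theorem theorem4p3:
  fixes \<phi> :: "real \<Rightarrow> real" and a b :: real
  assumes smooth: "\<forall>k x. ((deriv ^^ k) \<phi>) differentiable (at x)"
    and pos: "\<forall>x. \<phi> x > 0"
    and integ: "integrable lborel \<phi>"
    and supp: "closure {\<xi>. FT (\<lambda>x. complex_of_real (\<phi> x)) \<xi> \<noteq> 0} \<subseteq> {-1<..<1}"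
    and phi0: "\<phi> 0 = 1"
    and a: "0 < a" "a \<le> 1" and b: "0 < b" "b \<le> 1/2" and ab: "1 + b \<le> 2 * a"
  shows "\<exists>cbar>0. \<forall>c. 0 < c \<and> c < cbar \<longrightarrow>
          (\<exists>c1bar>0. \<forall>c1. 0 < c1 \<and> c1 < c1bar \<longrightarrow>
            (\<exists>K::nat. \<forall>k0\<ge>K. \<exists>\<Omega> :: (real \<times> (real^'m::finite)) set.
               (\<forall>\<gamma>. \<gamma> > real CARD('m) + 1 - 2 * s_exp (real CARD('m) + 1) a b
                      \<longrightarrow> hausdorff_measure \<gamma> \<Omega> = 0) \<and>
               (\<forall>x \<in> (divset c a b k0 \<inter> region (c1 / 10) c1) - \<Omega>.
                  \<forall>M \<epsilon>. \<epsilon> > 0 \<longrightarrow>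
                    (\<exists>t L. 0 < t \<and> t < \<epsilon> \<and> schro_conv (ghat \<phi> a b k0) t x L \<and> norm L > M))))"
proof -
  interpret divergence \<phi> a b "CARD('m)"
  proof
    show "isCont \<phi> x" for x
      using smooth[rule_format, of 0 x] by (auto intro: differentiable_imp_continuous_within)
    show "FT (\<lambda>x. complex_of_real (\<phi> x)) \<xi> = 0" if "1 \<le> \<bar>\<xi>\<bar>" for \<xi>
    proof (rule ccontr)
      assume "FT (\<lambda>x. complex_of_real (\<phi> x)) \<xi> \<noteq> 0"
      hence "\<xi> \<in> closure {\<xi>. FT (\<lambda>x. complex_of_real (\<phi> x)) \<xi> \<noteq> 0}"
        by (intro subsetD[OF closure_subset]) simp
      hence "\<xi> \<in> {-1<..<1}" by (rule subsetD[OF supp])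
      thus False using that by auto
    qed
    show "1 \<le> CARD('m)" by (simp add: Suc_le_eq card_gt_0_iff)
  qed (use assms in auto)
  have P: "0 < \<psi>_L1" using \<psi>_L1_ge_1 by linarith
  \<comment> \<open>The two thresholds are those of the packet lower bound; the one for
    \<open>c1\<close> can be chosen independently of \<open>c\<close>, and only the starting index
    \<open>K\<close> depends on both.\<close>
  show ?thesis
  proof (rule exI[of _ "1 / (32 * \<psi>_L1)"], intro conjI allI impI, use P in simp,
      rule exI[of _ "1 / (128 * \<psi>_L1)"], intro conjI allI impI, use P in simp)
    fix c c1 :: real
    assume c: "0 < c \<and> c < 1 / (32 * \<psi>_L1)" and c1: "0 < c1 \<and> c1 < 1 / (128 * \<psi>_L1)"
    obtain K where K: "\<And>k. K \<le> k \<Longrightarrow> main_large c c1 k"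
      using eventually_main_large[of c1 c] c1 unfolding eventually_sequentially by blast
    show "\<exists>K::nat. \<forall>k0\<ge>K. \<exists>\<Omega> :: (real \<times> (real^'m)) set.
               (\<forall>\<gamma>. \<gamma> > real CARD('m) + 1 - 2 * s_exp (real CARD('m) + 1) a b
                      \<longrightarrow> hausdorff_measure \<gamma> \<Omega> = 0) \<and>
               (\<forall>x \<in> (divset c a b k0 \<inter> region (c1 / 10) c1) - \<Omega>.
                  \<forall>M \<epsilon>. \<epsilon> > 0 \<longrightarrow>
                    (\<exists>t L. 0 < t \<and> t < \<epsilon> \<and> schro_conv (ghat \<phi> a b k0) t x L \<and> norm L > M))"
    proof (intro exI[of _ K] allI impI exI[of _ "{}"] conjI ballI)
      fix k0 x and M \<epsilon> :: real
      assume "K \<le> k0" and x: "x \<in> divset c a b k0 \<inter> region (c1 / 10) c1 - ({} :: (real \<times> (real^'m)) set)" and "0 < \<epsilon>"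
      thus "\<exists>t L. 0 < t \<and> t < \<epsilon> \<and> schro_conv (ghat \<phi> a b k0) t x L \<and> norm L > M"
        using c c1 K by (intro divergence_at_point[of k0 c c1]) auto
    qed (rule hausdorff_measure_empty)
  qed
qed

end
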